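(* Consider the optimal control NLP and the Gauss–Newton SQP method with block-wise TR1 Jacobian updates described in the context, under the assumptions (AS1)–(AS6) listed there, with iterates converging to a regular KKT point $z^*=(w^*,\lambda^*,\mu^* )$. Let $J(z^* )$, $\tilde J_{\mathrm{GN}}(z^* )$ and $\tilde J_{\mathrm{IN}}(z^* )$ be the exact KKT matrix, the KKT matrix with Gauss–Newton Hessian and exact constraint Jacobian, and the KKT matrix with Gauss–Newton Hessian and the (limiting) block-TR1 Jacobian approximation, as defined in the context, with $\tilde J_{\mathrm{IN}}(z^* )$ invertible. Then the (local, i.e. valid when the iterates are sufficiently close to $z^*$) linear contraction rate of the block-TR1 based optimization algorithm coincides with the linear contraction rate of the exact Jacobian based Gauss–Newton method: $$\kappa^*_{\mathrm{BTR1}}=\kappa^*_{\mathrm{GN}},$$ where $$\kappa^*_{\mathrm{BTR1}}:=\rho\!\left(\tilde J_{\mathrm{IN}}(z^* )^{-1}J(z^* )-I\right),\qquad \kappa^*_{\mathrm{GN}}:=\rho\!\left(\tilde J_{\mathrm{GN}}(z^* )^{-1}J(z^* )-I\right),$$ and $\rho$ denotes the spectral radius.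
   Context: **NLP.** Horizon $N$; stage variables $w_i=(x_i,u_i)$ for $i=0,\dots,N-1$, $w_N=x_N$; $w=(w_0,\dots,w_N)$. The NLP is: minimize $\sum_{i=0}^{N-1}l_i(x_i,u_i)+l_N(x_N)$ subject to $x_0=\hat x_0$ (given), $F_i(x_i,u_i)=x_{i+1}$ for $i=0,\dots,N-1$, and $P_iw_i\le p_i$ for $i=0,\dots,N$. Put $F(w)=(F_0(w_0),\dots,F_{N-1}(w_{N-1}))$ and let $E$ be the constant matrix with $Ew=(x_1,\dots,x_N)$, so the dynamics read $F(w)=Ew$. The initial condition is lumped together with the affine stage-wise constraints, so all of these are given by a stage-separable matrix $P$. The Lagrangian (omitting affine constraints) is $\mathcal L(w,\lambda)=\sum_{i=0}^{N-1}\big(l_i(x_i,u_i)+\lambda_i^\top(F_i(w_i)-x_{i+1})\big)+l_N(x_N)$. The costs are least squares, $l_i=\tfrac12\|R_i(w_i)\|_2^2$. **SQP method.** Given $w^k,\lambda^k$, matrices $A_i^k$ (approximating $\frac{\partial F_i}{\partial w_i}(w_i^k)$) and $H_i^k=\nabla R_i(w_i^k)\nabla R_i(w_i^k)^\top$, solve the convex QP $$\min_{\Delta w}\ \sum_{i=0}^N \tfrac12\Delta w_i^\top H_i^k\Delta w_i+h_i^{k\top}\Delta w_i\quad\text{s.t.}\quad \Delta x_0=\hat x_0-x_0^k,\quad F_i(w_i^k)-x_{i+1}^k+A_i^k\Delta w_i=\Delta x_{i+1}\ (0\le i\le N-1),\quad P_i\Delta w_i\le p_i-P_iw_i^k\ (0\le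 i\le N),$$ where $h_i^k=\nabla l_i(w_i^k)+\big(\frac{\partial F_i}{\partial w_i}(w_i^k)-A_i^k\big)^\top\lambda_i^k$ for $i<N$ and $h_N^k=\nabla l_N(w_N^k)$. Set $w^{k+1}=w^k+\Delta w^k$ and let $\lambda^{k+1}$ be the QP multipliers of the linearized dynamics constraints. **Block-wise TR1 update.** For each $i=0,\dots,N-1$ put $s_i^k=w_i^{k+1}-w_i^k$, $\sigma_i^k=\lambda_i^{k+1}-\lambda_i^k$, $y_i^k=F_i(w_i^{k+1})-F_i(w_i^k)$, $\gamma_i^k=\frac{\partial F_i}{\partial w_i}(w_i^{k+1})^\top\sigma_i^k$, and $A_i^{k+1}=A_i^k+\alpha_i^k(y_i^k-A_i^ks_i^k)(\gamma_i^{k\top}-\sigma_i^{k\top}A_i^k)$, where $\alpha_i^k$ is either $1/\big((\gamma_i^{k\top}-\sigma_i^{k\top}A_i^k)s_i^k\big)$ (forward) or $1/\big(\sigma_i^{k\top}(y_i^k-A_i^ks_i^k)\big)$ (adjoint), the chosen denominator being nonzero. $A^k$ is the approximation of $\frac{\partial F}{\partial w}$ whose $i$-th block row has $A_i^k$ in the columns of $w_i$ and zeros elsewhere. **Null space.** $P_A$ consists of the active rows of $P$ (including the initial condition, counted once). $Z$ has orthonormal columns ($Z^\top Z=I$) spanning the null space of $P_A$ ($P_AZ=0$); by stage-separability $Z=\mathrm{blkdiag}(Z_0,\dots,Z_N)$ with $Z_i$ having $q_i$ columns. **Assumptions.** (AS1) The Lagrangian is twice continuously differentiable. (AS2) $\nabla_wF$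 is Lipschitz continuous with constant $c_3$. (AS3) $\{(w^k,\lambda^k)\}$ is generated by the Gauss–Newton SQP method with block-wise TR1 Jacobian updates (at each iteration $k$: solve the convex QP with Hessian blocks $H_i^k$ and Jacobian blocks $A_i^k$, take the full step $w^{k+1}=w^k+\Delta w^k$ with $\lambda^{k+1}$ the QP multipliers of the linearized dynamics constraints, then update each block by $A_i^{k+1}=A_i^k+\alpha_i^k(y_i^k-A_i^ks_i^k)(\gamma_i^{k\top}-\sigma_i^{k\top}A_i^k)$) with arbitrary forward/adjoint choices of $\alpha_i^k$, while satisfying, for each $i$ and $k$ and some $c_1\in(0,1)$, the skipping criteria $|(\gamma_i^{k\top}-\sigma_i^{k\top}A_i^k)s_i^k|\ge c_1\|\sigma_i^k\|\,\|y_i^k-A_i^ks_i^k\|$ and $|\sigma_i^{k\top}(y_i^k-A_i^ks_i^k)|\ge c_1\|s_i^k\|\,\|\gamma_i^k-A_i^{k\top}\sigma_i^k\|$. (AS4) $(w^k,\lambda^k)\to(w^*,\lambda^* )$. (AS5) There is $k_0$ such that the active set is constant for all iterates $k\ge k_0$. (AS6) For each block $i=0,\dots,N-1$ there exist $c_4>0$ and $l\ge q_i$ such that for each $k_i\ge k_0$ there are $q_i$ distinct indices $k_i\le k_i^1<\dots<k_i^{q_i}\le k_i+l$ and vectors $s_{Z,i}^{k_i^j}\in\mathbb R^{q_i}$ with $s_i^{k_i^j}=Z_is_{Z,i}^{k_i^j}$ such that the matrix with columns $s_{Z,i}^{k_i^j}/\|s_{Z,i}^{k_i^j}\|$, $j=1,\dots,q_i$,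 has minimum singular value at least $c_4$. **Regular KKT point.** For the fixed active set the NLP is an equality constrained problem (constraints $F(w)=Ew$ and $P_Aw=p_A$); a minimizer $z^*=(w^*,\lambda^*,\mu^* )$ is a regular KKT point if both the linear independence constraint qualification (LICQ) and the second order sufficient conditions (SOSC, the Hessian of the Lagrangian being positive definite on the critical cone) hold there. **Matrices.** With all quantities evaluated at $z^*$, $H$ the block-diagonal Gauss–Newton Hessian approximation at $w^*$, and $A=\lim_{k\to\infty}A^k$ the limiting block-TR1 Jacobian approximation, $$J=\begin{bmatrix}\nabla_w^2\mathcal L&(\frac{\partial F}{\partial w}-E)^\top&P_A^\top\\ \frac{\partial F}{\partial w}-E&0&0\\P_A&0&0\end{bmatrix},\quad \tilde J_{\mathrm{GN}}=\begin{bmatrix}H&(\frac{\partial F}{\partial w}-E)^\top&P_A^\top\\ \frac{\partial F}{\partial w}-E&0&0\\P_A&0&0\end{bmatrix},\quad \tilde J_{\mathrm{IN}}=\begin{bmatrix}H&(A-E)^\top&P_A^\top\\ A-E&0&0\\P_A&0&0\end{bmatrix}.$$ **Contraction rate.** The linear contraction rate of a Newton-type iteration $\tilde J(z)\Delta z=-\mathcal F(z)$ at $z^*$ is by definition the spectral radius $\rho(\tilde J(z^* )^{-1}J(z^* )-I)$; it is the asymptotic local linear convergence rate when this value is smaller than one. *)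

theory Defs
  imports
    "HOL-Analysis.Analysis"
    "Jordan_Normal_Form.Spectral_Radius"
    "Jordan_Normal_Form.Gauss_Jordan_Elimination"
    "Jordan_Normal_Form.Matrix_Kernel"
begin

no_notation inner (infix \<open>\<bullet>\<close> 70)
no_notation Finite_Cartesian_Product.vec_nth (infixl \<open>$\<close> 90)

text \<open>
  The dimensions of the stages may differ, so vectors and matrices are those of
  Jordan_Normal_Form, with explicit carriers. That vector type is not a normed space; the norm
  and the derivative below are the usual ones, restricted to \<open>carrier_vec n\<close>.
\<close>

section \<open>Calculus on \<open>carrier_vec n\<close>\<close>

definition vnorm :: "real vec \<Rightarrow> real" where
  "vnorm v = sqrt (v \<bullet> v)"

definition op_norm :: "real mat \<Rightarrow> real" where
  "op_norm M = (SUP v \<in> {v \<in> carrier_vec (dim_col M). vnorm v \<le> 1}. vnorm (M *\<^sub>v v))"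

definition has_jacobian ::
    "nat \<Rightarrow> nat \<Rightarrow> (real vec \<Rightarrow> real vec) \<Rightarrow> real vec \<Rightarrow> real mat \<Rightarrow> bool" where
  "has_jacobian n m f w M \<longleftrightarrow> M \<in> carrier_mat m n \<and>
     (\<forall>e>0. \<exists>d>0. \<forall>v \<in> carrier_vec n. vnorm (v - w) < d \<longrightarrow>
        vnorm (f v - f w - M *\<^sub>v (v - w)) \<le> e * vnorm (v - w))"

definition differentiable_vec ::
    "nat \<Rightarrow> nat \<Rightarrow> (real vec \<Rightarrow> real vec) \<Rightarrow> real vec \<Rightarrow> bool" where
  "differentiable_vec n m f w \<longleftrightarrow> (\<exists>M. has_jacobian n m f w M)"

text \<open>A matrix as in \<open>has_jacobian\<close> is unique; the value is only meaningful where the map is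
  differentiable.\<close>

definition jacobian ::
    "nat \<Rightarrow> nat \<Rightarrow> (real vec \<Rightarrow> real vec) \<Rightarrow> real vec \<Rightarrow> real mat" where
  "jacobian n m f w = (SOME M. has_jacobian n m f w M)"

abbreviation vec_fun :: "(real vec \<Rightarrow> real) \<Rightarrow> real vec \<Rightarrow> real vec" where
  "vec_fun f \<equiv> (\<lambda>v. Matrix.vec 1 (\<lambda>_. f v))"

definition gradient :: "nat \<Rightarrow> (real vec \<Rightarrow> real) \<Rightarrow> real vec \<Rightarrow> real vec" where
  "gradient n f w = Matrix.row (jacobian n 1 (vec_fun f) w) 0"

definition hessian :: "nat \<Rightarrow> (real vec \<Rightarrow> real) \<Rightarrow> real vec \<Rightarrow> real mat" where
  "hessian n f = jacobian n n (gradient n f)"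

definition twice_cont_differentiable :: "nat \<Rightarrow> (real vec \<Rightarrow> real) \<Rightarrow> bool" where
  "twice_cont_differentiable n f \<longleftrightarrow>
     (\<forall>w \<in> carrier_vec n.
        differentiable_vec n 1 (vec_fun f) w \<and>
        differentiable_vec n n (gradient n f) w \<and>
        (\<forall>e>0. \<exists>d>0. \<forall>v \<in> carrier_vec n. vnorm (v - w) < d \<longrightarrow>
           op_norm (hessian n f v - hessian n f w) < e))"

section \<open>Matrices\<close>

definition outer :: "real vec \<Rightarrow> real vec \<Rightarrow> real mat" where
  "outer u v = Matrix.mat (dim_vec u) (dim_vec v) (\<lambda>(r, c). u $ r * v $ c)"

definition append_cols :: "real mat \<Rightarrow> real mat \<Rightarrow> real mat" where
  "append_cols A B = four_block_mat A B (0\<^sub>m 0 (dim_col A)) (0\<^sub>m 0 (dim_col B))"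

definition vec_concat :: "real vec list \<Rightarrow> real vec" where
  "vec_concat vs = foldr append_vec vs (0\<^sub>v 0)"

definition singular_values :: "real mat \<Rightarrow> real set" where
  "singular_values M = {s. 0 \<le> s \<and> eigenvalue (M\<^sup>T * M) (s^2)}"

text \<open>\<open>mat_inverse M\<close> is \<open>None\<close> exactly if the square matrix \<open>M\<close> is singular.\<close>

definition contraction_rate :: "real mat \<Rightarrow> real mat \<Rightarrow> real" where
  "contraction_rate Jt J =
     spectral_radius (map_mat complex_of_real (the (mat_inverse Jt) * J - 1\<^sub>m (dim_row J)))"

section \<open>The optimal control problem\<close>

text \<open>Stage functions take the stacked stage variable, \<open>(x\<^sub>i, u\<^sub>i)\<close> for \<open>i < horizon\<close> and \<open>x\<^sub>N\<close>
  for \<open>i = N = horizon\<close>.\<close>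

record ocp =
  horizon :: nat
  xdim :: "nat \<Rightarrow> nat"
  udim :: "nat \<Rightarrow> nat"
  resdim :: "nat \<Rightarrow> nat"
  condim :: "nat \<Rightarrow> nat"
  residual :: "nat \<Rightarrow> real vec \<Rightarrow> real vec"
  dynamics :: "nat \<Rightarrow> real vec \<Rightarrow> real vec"
  conmat :: "nat \<Rightarrow> real mat"
  conrhs :: "nat \<Rightarrow> real vec"
  xinit :: "real vec"

definition wdim :: "ocp \<Rightarrow> nat \<Rightarrow> nat" where
  "wdim Q i = (if i < horizon Q then xdim Q i + udim Q i else xdim Q i)"

definition dimW :: "ocp \<Rightarrow> nat" where
  "dimW Q = (\<Sum>i\<le>horizon Q. wdim Q i)"

definition dimL :: "ocp \<Rightarrow> nat" where
  "dimL Q = (\<Sum>i<horizon Q. xdim Q (Suc i))"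

definition stage :: "ocp \<Rightarrow> nat \<Rightarrow> real vec \<Rightarrow> real vec" where
  "stage Q i w = Matrix.vec (wdim Q i) (\<lambda>j. w $ ((\<Sum>k<i. wdim Q k) + j))"

definition state :: "ocp \<Rightarrow> nat \<Rightarrow> real vec \<Rightarrow> real vec" where
  "state Q i w = vec_first (stage Q i w) (xdim Q i)"

definition mult_stage :: "ocp \<Rightarrow> nat \<Rightarrow> real vec \<Rightarrow> real vec" where
  "mult_stage Q i lam = Matrix.vec (xdim Q (Suc i)) (\<lambda>j. lam $ ((\<Sum>k<i. xdim Q (Suc k)) + j))"

text \<open>Differentiability of the residuals is what makes the Gauss--Newton Hessian meaningful; it does
  not follow from smoothness of the squared norms.\<close>

definition well_formed :: "ocp \<Rightarrow> bool" where
  "well_formed Q \<longleftrightarrow>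
     (\<forall>i\<le>horizon Q. residual Q i \<in> carrier_vec (wdim Q i) \<rightarrow> carrier_vec (resdim Q i)) \<and>
     (\<forall>i\<le>horizon Q. \<forall>v \<in> carrier_vec (wdim Q i).
        differentiable_vec (wdim Q i) (resdim Q i) (residual Q i) v) \<and>
     (\<forall>i<horizon Q. dynamics Q i \<in> carrier_vec (wdim Q i) \<rightarrow> carrier_vec (xdim Q (Suc i))) \<and>
     (\<forall>i\<le>horizon Q. conmat Q i \<in> carrier_mat (condim Q i) (wdim Q i)) \<and>
     (\<forall>i\<le>horizon Q. conrhs Q i \<in> carrier_vec (condim Q i)) \<and>
     xinit Q \<in> carrier_vec (xdim Q 0)"

definition stage_cost :: "ocp \<Rightarrow> nat \<Rightarrow> real vec \<Rightarrow> real" where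
  "stage_cost Q i v = 1/2 * (vnorm (residual Q i v))^2"

definition cost :: "ocp \<Rightarrow> real vec \<Rightarrow> real" where
  "cost Q w = (\<Sum>i\<le>horizon Q. stage_cost Q i (stage Q i w))"

definition Fmap :: "ocp \<Rightarrow> real vec \<Rightarrow> real vec" where
  "Fmap Q w = vec_concat (map (\<lambda>i. dynamics Q i (stage Q i w)) [0..<horizon Q])"

definition lagrangian :: "ocp \<Rightarrow> real vec \<Rightarrow> real vec \<Rightarrow> real" where
  "lagrangian Q w lam = cost Q w +
     (\<Sum>i<horizon Q. mult_stage Q i lam \<bullet> (dynamics Q i (stage Q i w) - state Q (Suc i) w))"

definition DF :: "ocp \<Rightarrow> real vec \<Rightarrow> real mat" where
  "DF Q w = jacobian (dimW Q) (dimL Q) (Fmap Q) w"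

definition stage_DF :: "ocp \<Rightarrow> nat \<Rightarrow> real vec \<Rightarrow> real mat" where
  "stage_DF Q i v = jacobian (wdim Q i) (xdim Q (Suc i)) (dynamics Q i) v"

text \<open>Block row \<open>i\<close> carries the matrix \<open>B i\<close> in the columns of \<open>w\<^sub>i\<close>; the columns of \<open>w\<^sub>N\<close> vanish.\<close>

definition assemble_jac :: "ocp \<Rightarrow> (nat \<Rightarrow> real mat) \<Rightarrow> real mat" where
  "assemble_jac Q B =
     append_cols (diag_block_mat (map B [0..<horizon Q])) (0\<^sub>m (dimL Q) (wdim Q (horizon Q)))"

definition state_sel :: "ocp \<Rightarrow> nat \<Rightarrow> real mat" where
  "state_sel Q i = Matrix.mat (xdim Q i) (wdim Q i) (\<lambda>(r, c). if r = c then 1 else 0)"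

text \<open>\<open>Emat Q *\<^sub>v w\<close> stacks \<open>x\<^sub>1, \<dots>, x\<^sub>N\<close>: no entries in the columns of \<open>w\<^sub>0\<close>, and the selection of
  \<open>x\<^sub>i\<close> out of \<open>w\<^sub>i\<close> in block row \<open>i - 1\<close>.\<close>

definition Emat :: "ocp \<Rightarrow> real mat" where
  "Emat Q = append_cols (0\<^sub>m (dimL Q) (wdim Q 0))
     (diag_block_mat (map (state_sel Q) [1..<Suc (horizon Q)]))"

definition stage_gn_hess :: "ocp \<Rightarrow> nat \<Rightarrow> real vec \<Rightarrow> real mat" where
  "stage_gn_hess Q i v =
     (let D = jacobian (wdim Q i) (resdim Q i) (residual Q i) v in D\<^sup>T * D)"

definition gn_hess :: "ocp \<Rightarrow> real vec \<Rightarrow> real mat" where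
  "gn_hess Q w = diag_block_mat (map (\<lambda>i. stage_gn_hess Q i (stage Q i w)) [0..<Suc (horizon Q)])"

section \<open>The QP subproblem\<close>

definition qp_feasible ::
    "ocp \<Rightarrow> real vec \<Rightarrow> (nat \<Rightarrow> real mat) \<Rightarrow> real vec \<Rightarrow> bool" where
  "qp_feasible Q w A d \<longleftrightarrow> d \<in> carrier_vec (dimW Q) \<and>
     state Q 0 d = xinit Q - state Q 0 w \<and>
     (\<forall>i<horizon Q. dynamics Q i (stage Q i w) - state Q (Suc i) w + A i *\<^sub>v stage Q i d
        = state Q (Suc i) d) \<and>
     (\<forall>i\<le>horizon Q. conmat Q i *\<^sub>v stage Q i d \<le> conrhs Q i - conmat Q i *\<^sub>v stage Q i w)"

definition qp_linear ::
    "ocp \<Rightarrow> real vec \<Rightarrow> real vec \<Rightarrow> (nat \<Rightarrow> real mat) \<Rightarrow> nat \<Rightarrow> real vec" where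
  "qp_linear Q w lam A i =
     (if i < horizon Q
      then gradient (wdim Q i) (stage_cost Q i) (stage Q i w)
           + (stage_DF Q i (stage Q i w) - A i)\<^sup>T *\<^sub>v mult_stage Q i lam
      else gradient (wdim Q i) (stage_cost Q i) (stage Q i w))"

definition qp_objective ::
    "ocp \<Rightarrow> real vec \<Rightarrow> real vec \<Rightarrow> (nat \<Rightarrow> real mat) \<Rightarrow> real vec \<Rightarrow> real" where
  "qp_objective Q w lam A d =
     (\<Sum>i\<le>horizon Q. 1/2 * (stage Q i d \<bullet> (stage_gn_hess Q i (stage Q i w) *\<^sub>v stage Q i d))
        + qp_linear Q w lam A i \<bullet> stage Q i d)"

definition qp_lagrangian ::
    "ocp \<Rightarrow> real vec \<Rightarrow> real vec \<Rightarrow> (nat \<Rightarrow> real mat) \<Rightarrow>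
     real vec \<Rightarrow> real vec \<Rightarrow> (nat \<Rightarrow> real vec) \<Rightarrow> real vec \<Rightarrow> real" where
  "qp_lagrangian Q w lam A lam' nu mu d = qp_objective Q w lam A d
     + (\<Sum>i<horizon Q. mult_stage Q i lam' \<bullet>
          (dynamics Q i (stage Q i w) - state Q (Suc i) w + A i *\<^sub>v stage Q i d
             - state Q (Suc i) d))
     + nu \<bullet> (state Q 0 d - (xinit Q - state Q 0 w))
     + (\<Sum>i\<le>horizon Q. mu i \<bullet>
          (conmat Q i *\<^sub>v stage Q i d - (conrhs Q i - conmat Q i *\<^sub>v stage Q i w)))"

text \<open>\<open>d\<close> minimizes the QP, and \<open>lam'\<close>, completed by some multipliers \<open>nu\<close> of the initial
  condition and \<open>mu\<close> of the inequalities, satisfies the KKT conditions of the QP at \<open>d\<close>.\<close>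

definition qp_solution ::
    "ocp \<Rightarrow> real vec \<Rightarrow> real vec \<Rightarrow> (nat \<Rightarrow> real mat) \<Rightarrow> real vec \<Rightarrow> real vec \<Rightarrow> bool" where
  "qp_solution Q w lam A d lam' \<longleftrightarrow>
     qp_feasible Q w A d \<and>
     (\<forall>d'. qp_feasible Q w A d' \<longrightarrow> qp_objective Q w lam A d \<le> qp_objective Q w lam A d') \<and>
     lam' \<in> carrier_vec (dimL Q) \<and>
     (\<exists>nu mu. nu \<in> carrier_vec (xdim Q 0) \<and>
        (\<forall>i\<le>horizon Q. mu i \<in> carrier_vec (condim Q i) \<and> 0\<^sub>v (condim Q i) \<le> mu i \<and>
           mu i \<bullet> (conmat Q i *\<^sub>v stage Q i d
                     - (conrhs Q i - conmat Q i *\<^sub>v stage Q i w)) = 0) \<and>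
        gradient (dimW Q) (qp_lagrangian Q w lam A lam' nu mu) d = 0\<^sub>v (dimW Q))"

section \<open>The SQP method with block-wise TR1 updates\<close>

text \<open>\<open>w k\<close> and \<open>lam k\<close> are the stacked iterates, \<open>A k i\<close> is the Jacobian approximation of
  block \<open>i\<close> at iteration \<open>k\<close>.\<close>

definition s_step :: "ocp \<Rightarrow> (nat \<Rightarrow> real vec) \<Rightarrow> nat \<Rightarrow> nat \<Rightarrow> real vec" where
  "s_step Q w k i = stage Q i (w (Suc k)) - stage Q i (w k)"

definition sigma_step :: "ocp \<Rightarrow> (nat \<Rightarrow> real vec) \<Rightarrow> nat \<Rightarrow> nat \<Rightarrow> real vec" where
  "sigma_step Q lam k i = mult_stage Q i (lam (Suc k)) - mult_stage Q i (lam k)"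

definition y_diff :: "ocp \<Rightarrow> (nat \<Rightarrow> real vec) \<Rightarrow> nat \<Rightarrow> nat \<Rightarrow> real vec" where
  "y_diff Q w k i = dynamics Q i (stage Q i (w (Suc k))) - dynamics Q i (stage Q i (w k))"

definition gamma_adj ::
    "ocp \<Rightarrow> (nat \<Rightarrow> real vec) \<Rightarrow> (nat \<Rightarrow> real vec) \<Rightarrow> nat \<Rightarrow> nat \<Rightarrow> real vec" where
  "gamma_adj Q w lam k i =
     (stage_DF Q i (stage Q i (w (Suc k))))\<^sup>T *\<^sub>v sigma_step Q lam k i"

text \<open>Residuals \<open>y - A s\<close> and \<open>\<gamma> - A\<^sup>T \<sigma>\<close> of the direct and the adjoint secant condition;
  the latter is the row vector \<open>\<gamma>\<^sup>T - \<sigma>\<^sup>T A\<close> written as a column.\<close>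

definition sec_res ::
    "ocp \<Rightarrow> (nat \<Rightarrow> real vec) \<Rightarrow> (nat \<Rightarrow> nat \<Rightarrow> real mat) \<Rightarrow> nat \<Rightarrow> nat \<Rightarrow> real vec" where
  "sec_res Q w A k i = y_diff Q w k i - A k i *\<^sub>v s_step Q w k i"

definition adj_res ::
    "ocp \<Rightarrow> (nat \<Rightarrow> real vec) \<Rightarrow> (nat \<Rightarrow> real vec) \<Rightarrow> (nat \<Rightarrow> nat \<Rightarrow> real mat)
      \<Rightarrow> nat \<Rightarrow> nat \<Rightarrow> real vec" where
  "adj_res Q w lam A k i = gamma_adj Q w lam k i - (A k i)\<^sup>T *\<^sub>v sigma_step Q lam k i"

definition denom_fwd ::
    "ocp \<Rightarrow> (nat \<Rightarrow> real vec) \<Rightarrow> (nat \<Rightarrow> real vec) \<Rightarrow> (nat \<Rightarrow> nat \<Rightarrow> real mat)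
      \<Rightarrow> nat \<Rightarrow> nat \<Rightarrow> real" where
  "denom_fwd Q w lam A k i = adj_res Q w lam A k i \<bullet> s_step Q w k i"

definition denom_adj ::
    "ocp \<Rightarrow> (nat \<Rightarrow> real vec) \<Rightarrow> (nat \<Rightarrow> real vec) \<Rightarrow> (nat \<Rightarrow> nat \<Rightarrow> real mat)
      \<Rightarrow> nat \<Rightarrow> nat \<Rightarrow> real" where
  "denom_adj Q w lam A k i = sigma_step Q lam k i \<bullet> sec_res Q w A k i"

definition tr1_update ::
    "ocp \<Rightarrow> (nat \<Rightarrow> real vec) \<Rightarrow> (nat \<Rightarrow> real vec) \<Rightarrow> (nat \<Rightarrow> nat \<Rightarrow> real mat)
      \<Rightarrow> nat \<Rightarrow> nat \<Rightarrow> bool" where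
  "tr1_update Q w lam A k i \<longleftrightarrow>
     (\<exists>\<alpha>. (denom_fwd Q w lam A k i \<noteq> 0 \<and> \<alpha> = 1 / denom_fwd Q w lam A k i \<or>
           denom_adj Q w lam A k i \<noteq> 0 \<and> \<alpha> = 1 / denom_adj Q w lam A k i) \<and>
          A (Suc k) i =
            A k i + \<alpha> \<cdot>\<^sub>m outer (sec_res Q w A k i) (adj_res Q w lam A k i))"

definition btr1_sqp_sequence ::
    "ocp \<Rightarrow> (nat \<Rightarrow> real vec) \<Rightarrow> (nat \<Rightarrow> real vec) \<Rightarrow> (nat \<Rightarrow> nat \<Rightarrow> real mat) \<Rightarrow> bool" where
  "btr1_sqp_sequence Q w lam A \<longleftrightarrow>
     w 0 \<in> carrier_vec (dimW Q) \<and> lam 0 \<in> carrier_vec (dimL Q) \<and>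
     (\<forall>i<horizon Q. A 0 i \<in> carrier_mat (xdim Q (Suc i)) (wdim Q i)) \<and>
     (\<forall>k. (\<exists>d. qp_solution Q (w k) (lam k) (A k) d (lam (Suc k)) \<and> w (Suc k) = w k + d) \<and>
          (\<forall>i<horizon Q. tr1_update Q w lam A k i))"

definition skipping_criteria ::
    "ocp \<Rightarrow> (nat \<Rightarrow> real vec) \<Rightarrow> (nat \<Rightarrow> real vec) \<Rightarrow> (nat \<Rightarrow> nat \<Rightarrow> real mat) \<Rightarrow> real \<Rightarrow> bool" where
  "skipping_criteria Q w lam A c1 \<longleftrightarrow>
     (\<forall>k. \<forall>i<horizon Q.
        \<bar>denom_fwd Q w lam A k i\<bar> \<ge> c1 * vnorm (sigma_step Q lam k i) * vnorm (sec_res Q w A k i) \<and>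
        \<bar>denom_adj Q w lam A k i\<bar> \<ge> c1 * vnorm (s_step Q w k i) * vnorm (adj_res Q w lam A k i))"

section \<open>Active constraints, null space and regularity\<close>

definition active_set :: "ocp \<Rightarrow> real vec \<Rightarrow> (nat \<times> nat) set" where
  "active_set Q w = {(i, j). i \<le> horizon Q \<and> j < condim Q i \<and>
     (conmat Q i *\<^sub>v stage Q i w) $ j = conrhs Q i $ j}"

text \<open>\<open>Act\<close> below is the set of constraints active at all late iterates. The rows of the initial
  condition are equalities and come first; they are not part of \<open>Act\<close>.\<close>

definition active_idx :: "ocp \<Rightarrow> (nat \<times> nat) set \<Rightarrow> nat \<Rightarrow> nat list" where
  "active_idx Q Act i = filter (\<lambda>j. (i, j) \<in> Act) [0..<condim Q i]"

definition stage_PA :: "ocp \<Rightarrow> (nat \<times> nat) set \<Rightarrow> nat \<Rightarrow> real mat" where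
  "stage_PA Q Act i =
     (let Pact = mat_of_rows (wdim Q i) (map (Matrix.row (conmat Q i)) (active_idx Q Act i))
      in if i = 0 then state_sel Q 0 @\<^sub>r Pact else Pact)"

definition stage_pA :: "ocp \<Rightarrow> (nat \<times> nat) set \<Rightarrow> nat \<Rightarrow> real vec" where
  "stage_pA Q Act i =
     (let pact = vec_of_list (map (($) (conrhs Q i)) (active_idx Q Act i))
      in if i = 0 then xinit Q @\<^sub>v pact else pact)"

definition PA :: "ocp \<Rightarrow> (nat \<times> nat) set \<Rightarrow> real mat" where
  "PA Q Act = diag_block_mat (map (stage_PA Q Act) [0..<Suc (horizon Q)])"

definition pA :: "ocp \<Rightarrow> (nat \<times> nat) set \<Rightarrow> real vec" where
  "pA Q Act = vec_concat (map (stage_pA Q Act) [0..<Suc (horizon Q)])"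

text \<open>\<open>Z i\<close> has \<open>q i\<close> columns.\<close>

definition null_space_basis ::
    "ocp \<Rightarrow> (nat \<times> nat) set \<Rightarrow> (nat \<Rightarrow> nat) \<Rightarrow> (nat \<Rightarrow> real mat) \<Rightarrow> bool" where
  "null_space_basis Q Act q Z \<longleftrightarrow>
     (\<forall>i\<le>horizon Q. Z i \<in> carrier_mat (wdim Q i) (q i)) \<and>
     (let ZZ = diag_block_mat (map Z [0..<Suc (horizon Q)]); nz = (\<Sum>i\<le>horizon Q. q i)
      in ZZ\<^sup>T * ZZ = 1\<^sub>m nz \<and> mat_kernel (PA Q Act) = (\<lambda>v. ZZ *\<^sub>v v) ` carrier_vec nz)"

definition eq_feasible :: "ocp \<Rightarrow> (nat \<times> nat) set \<Rightarrow> real vec \<Rightarrow> bool" where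
  "eq_feasible Q Act w \<longleftrightarrow> w \<in> carrier_vec (dimW Q) \<and>
     Fmap Q w = Emat Q *\<^sub>v w \<and> PA Q Act *\<^sub>v w = pA Q Act"

definition regular_kkt_point ::
    "ocp \<Rightarrow> (nat \<times> nat) set \<Rightarrow> real vec \<Rightarrow> real vec \<Rightarrow> real vec \<Rightarrow> bool" where
  "regular_kkt_point Q Act w lam mu \<longleftrightarrow>
     eq_feasible Q Act w \<and>
     lam \<in> carrier_vec (dimL Q) \<and> mu \<in> carrier_vec (dim_row (PA Q Act)) \<and>
     (\<exists>e>0. \<forall>w'. eq_feasible Q Act w' \<and> vnorm (w' - w) < e \<longrightarrow> cost Q w \<le> cost Q w') \<and>
     gradient (dimW Q) (\<lambda>w. lagrangian Q w lam) w + (PA Q Act)\<^sup>T *\<^sub>v mu = 0\<^sub>v (dimW Q) \<and>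
     (let C = (DF Q w - Emat Q) @\<^sub>r PA Q Act in
        \<comment> \<open>LICQ\<close>
        distinct (Matrix.rows C) \<and>
        \<not> module.lin_dep class_ring (module_vec TYPE(real) (dimW Q)) (set (Matrix.rows C)) \<and>
        \<comment> \<open>SOSC\<close>
        (\<forall>d \<in> mat_kernel C. d \<noteq> 0\<^sub>v (dimW Q) \<longrightarrow>
           d \<bullet> (hessian (dimW Q) (\<lambda>w. lagrangian Q w lam) w *\<^sub>v d) > 0))"

text \<open>With \<open>C\<close> consisting of the rows of \<open>D - E\<close> followed by those of \<open>P\<^sub>A\<close>, this is the
  matrix with block rows \<open>(H, (D - E)\<^sup>T, P\<^sub>A\<^sup>T)\<close>, \<open>(D - E, 0, 0)\<close> and \<open>(P\<^sub>A, 0, 0)\<close>.\<close>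

definition kkt_matrix ::
    "ocp \<Rightarrow> (nat \<times> nat) set \<Rightarrow> real mat \<Rightarrow> real mat \<Rightarrow> real mat" where
  "kkt_matrix Q Act H D =
     (let C = (D - Emat Q) @\<^sub>r PA Q Act
      in four_block_mat H C\<^sup>T C (0\<^sub>m (dim_row C) (dim_row C)))"

definition J_exact :: "ocp \<Rightarrow> (nat \<times> nat) set \<Rightarrow> real vec \<Rightarrow> real vec \<Rightarrow> real mat" where
  "J_exact Q Act w lam =
     kkt_matrix Q Act (hessian (dimW Q) (\<lambda>w. lagrangian Q w lam) w) (DF Q w)"

definition J_GN :: "ocp \<Rightarrow> (nat \<times> nat) set \<Rightarrow> real vec \<Rightarrow> real mat" where
  "J_GN Q Act w = kkt_matrix Q Act (gn_hess Q w) (DF Q w)"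

definition J_IN :: "ocp \<Rightarrow> (nat \<times> nat) set \<Rightarrow> real vec \<Rightarrow> real mat \<Rightarrow> real mat" where
  "J_IN Q Act w A = kkt_matrix Q Act (gn_hess Q w) A"

section \<open>Convergence assumptions\<close>

definition vec_tendsto :: "(nat \<Rightarrow> real vec) \<Rightarrow> real vec \<Rightarrow> bool" where
  "vec_tendsto x l \<longleftrightarrow> (\<lambda>k. vnorm (x k - l)) \<longlonglongrightarrow> 0"

definition mat_tendsto :: "(nat \<Rightarrow> real mat) \<Rightarrow> real mat \<Rightarrow> bool" where
  "mat_tendsto X L \<longleftrightarrow> (\<lambda>k. op_norm (X k - L)) \<longlonglongrightarrow> 0"

definition lipschitz_jacobian :: "ocp \<Rightarrow> real \<Rightarrow> bool" where
  "lipschitz_jacobian Q c3 \<longleftrightarrow>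
     (\<forall>w \<in> carrier_vec (dimW Q). differentiable_vec (dimW Q) (dimL Q) (Fmap Q) w) \<and>
     (\<forall>w \<in> carrier_vec (dimW Q). \<forall>w' \<in> carrier_vec (dimW Q).
        op_norm (DF Q w - DF Q w') \<le> c3 * vnorm (w - w'))"

text \<open>In block \<open>i\<close>, every window of \<open>l + 1\<close> iterations contains \<open>q\<^sub>i\<close> uniformly linearly
  independent steps in the range of \<open>Z\<^sub>i\<close>.\<close>

definition unif_lin_indep_steps ::
    "ocp \<Rightarrow> (nat \<Rightarrow> real vec) \<Rightarrow> (nat \<Rightarrow> nat) \<Rightarrow> (nat \<Rightarrow> real mat) \<Rightarrow> nat \<Rightarrow> nat \<Rightarrow> bool" where
  "unif_lin_indep_steps Q w q Z k0 i \<longleftrightarrow>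
     (\<exists>c4>0. \<exists>l\<ge>q i. \<forall>k\<ge>k0. \<exists>(idx :: nat \<Rightarrow> nat) (sZ :: nat \<Rightarrow> real vec).
        strict_mono_on {1..q i} idx \<and>
        (\<forall>j \<in> {1..q i}. k \<le> idx j \<and> idx j \<le> k + l \<and>
           sZ j \<in> carrier_vec (q i) \<and> s_step Q w (idx j) i = Z i *\<^sub>v sZ j) \<and>
        (\<forall>s \<in> singular_values
           (mat_of_cols (q i) (map (\<lambda>j. (1 / vnorm (sZ j)) \<cdot>\<^sub>v sZ j) [1..<Suc (q i)])).
             c4 \<le> s))"

end

theory Submission
  imports Defs
begin

text \<open>
  A TR1 update reproduces the secant condition \<open>A s = y\<close> up to an error of second order in the step
  (the skipping criteria control the adjoint variant), so \<open>A s\<^sub>k - F'(w\<^sup>*) s\<^sub>k = o(\<parallel>s\<^sub>k\<parallel>)\<close> for the limit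
  \<open>A\<close>. Late windows contain uniformly independent steps spanning the range of each \<open>Z\<^sub>i\<close>, hence
  \<open>A - F'(w\<^sup>*)\<close> vanishes on \<open>ker P\<^sub>A\<close>. Invertibility of the inexact KKT matrix makes the rows of \<open>P\<^sub>A\<close>
  independent, so \<open>A - F'(w\<^sup>*) = K P\<^sub>A\<close> for some \<open>K\<close>: the constraint rows of the inexact matrix arise from
  \<open>C = (F'(w\<^sup>*) - E; P\<^sub>A)\<close> by the unipotent transformation \<open>W = (1, K; 0, 1)\<close>. The eigenvalues \<open>x\<close> of
  \<open>J'\<^sup>-\<^sup>1 J - 1\<close> are the zeros of \<open>det (a J' - J)\<close> with \<open>a = x + 1\<close>, and pulling \<open>a W - 1\<close> out of the
  constraint rows and columns shows that this determinant is
  \<open>det (a W - 1)\<^sup>2 det (a H - L, C\<^sup>T; C, 0)\<close>, where \<open>det (a W - 1)\<close> does not depend on \<open>K\<close>.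
\<close>


section \<open>Spectra of KKT pencils\<close>

text \<open>Both contraction matrices are instances of one determinant formula: the exact Jacobian
  is the case \<open>K = 0\<close>, and for every \<open>K\<close> the factor
  \<open>det (a W - 1)\<close> is the same power of \<open>a - 1\<close>. Working with determinants
  rather than with inverses keeps the formula valid at \<open>a = 1\<close>, where
  \<open>a W - 1\<close> is singular, so the full spectra agree and not merely their radii. On the
  analytic side the bases supplied by (AS6) change from window to window and need not converge.
  Their singular value bound is therefore turned into a lower bound for a determinant, and the
  adjugate formula yields estimates that are uniform over all windows; a fixed matrix that is
  arbitrarily small on such bases is zero. Since the approximations converge, every step can be
  compared with the limit through its own update alone, without tracking how later updates disturb
  earlier secant conditions. Secant conditions live in single blocks, whereas smoothness is known
  for the stacked map. Steps of one block are therefore padded with zeros, and blocks are cut out by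
  selection matrices.\<close>

text \<open>Congruence with blkdiag(1, V): its determinant enters once from the left and once,
  transposed, from the right. \<open>V\<close> may be singular, as it is for \<open>a W - 1\<close>
  at \<open>a = 1\<close>.\<close>

lemma det_four_block_congruence:
  fixes X :: "'a::idom mat"
  assumes X: "X \<in> carrier_mat n n" and C: "C \<in> carrier_mat r n" and V: "V \<in> carrier_mat r r"
  shows "Determinant.det (four_block_mat X (V * C)\<^sup>T (V * C) (0\<^sub>m r r))
       = (Determinant.det V)^2 * Determinant.det (four_block_mat X C\<^sup>T C (0\<^sub>m r r))"
proof -
  let ?B = "four_block_mat X C\<^sup>T C (0\<^sub>m r r)"
  let ?S = "four_block_mat (1\<^sub>m n) (0\<^sub>m n r) (0\<^sub>m r n) V"
  let ?T = "four_block_mat (1\<^sub>m n) (0\<^sub>m n r) (0\<^sub>m r n) V\<^sup>T"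
  have c: "C\<^sup>T \<in> carrier_mat n r" "V\<^sup>T \<in> carrier_mat r r" "V * C \<in> carrier_mat r n"
    "C\<^sup>T * V\<^sup>T \<in> carrier_mat n r"
    using C V by auto
  have SB: "?S * ?B = four_block_mat X C\<^sup>T (V * C) (0\<^sub>m r r)"
    using X C V c by (subst mult_four_block_mat[where ?nr1.0=n and ?n1.0=n and ?n2.0=r and ?nr2.0=r and ?nc1.0=n and ?nc2.0=r]) auto
  have "?S * ?B * ?T = four_block_mat X (C\<^sup>T * V\<^sup>T) (V * C) (0\<^sub>m r r)"
    unfolding SB using X C V c
    by (subst mult_four_block_mat[where ?nr1.0=n and ?n1.0=n and ?n2.0=r and ?nr2.0=r and ?nc1.0=n and ?nc2.0=r]) auto
  also have "C\<^sup>T * V\<^sup>T = (V * C)\<^sup>T"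
    using transpose_mult[OF V C] by simp
  finally have eq: "?S * ?B * ?T = four_block_mat X (V * C)\<^sup>T (V * C) (0\<^sub>m r r)" .
  have cB: "?B \<in> carrier_mat (n + r) (n + r)" and cS: "?S \<in> carrier_mat (n + r) (n + r)"
    and cT: "?T \<in> carrier_mat (n + r) (n + r)" and cSB: "?S * ?B \<in> carrier_mat (n + r) (n + r)"
    using X C V c by auto
  have "Determinant.det ?S = Determinant.det V"
    using det_four_block_mat_lower_left_zero[OF one_carrier_mat zero_carrier_mat refl V] by simp
  moreover have "Determinant.det ?T = Determinant.det V"
    using det_four_block_mat_lower_left_zero[OF one_carrier_mat zero_carrier_mat refl c(2)]
    by (simp add: Determinant.det_transpose[OF V])
  moreover have "Determinant.det (?S * ?B * ?T)
      = Determinant.det ?S * Determinant.det ?B * Determinant.det ?T"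
    using Determinant.det_mult[OF cSB cT] Determinant.det_mult[OF cS cB] by simp
  ultimately show ?thesis
    unfolding eq by (simp add: power2_eq_square)
qed

text \<open>The off-diagonal blocks of the pencil are \<open>V C\<close> and its transpose with
  \<open>V = a W - 1\<close>, so the congruence applies. The second factor no longer involves
  \<open>W\<close>.\<close>

lemma det_kkt_pencil:
  fixes H :: "'a::idom mat"
  assumes H: "H \<in> carrier_mat n n" and L: "L \<in> carrier_mat n n"
    and C: "C \<in> carrier_mat r n" and W: "W \<in> carrier_mat r r"
  shows "Determinant.det (a \<cdot>\<^sub>m four_block_mat H (W * C)\<^sup>T (W * C) (0\<^sub>m r r)
             - four_block_mat L C\<^sup>T C (0\<^sub>m r r))
       = (Determinant.det (a \<cdot>\<^sub>m W - 1\<^sub>m r))^2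
           * Determinant.det (four_block_mat (a \<cdot>\<^sub>m H - L) C\<^sup>T C (0\<^sub>m r r))"
proof -
  let ?V = "a \<cdot>\<^sub>m W - 1\<^sub>m r"
  have V: "?V \<in> carrier_mat r r" and X: "a \<cdot>\<^sub>m H - L \<in> carrier_mat n n"
    using W H L by auto
  have WC: "W * C \<in> carrier_mat r n" using W C by auto
  have VC: "?V * C = a \<cdot>\<^sub>m (W * C) - C"
    using minus_mult_distrib_mat[of "a \<cdot>\<^sub>m W" r r "1\<^sub>m r" C n] W C
    by (simp add: mult_smult_assoc_mat[OF W C])
  have "a \<cdot>\<^sub>m four_block_mat H D\<^sup>T D (0\<^sub>m r r) - four_block_mat L C\<^sup>T C (0\<^sub>m r r)
      = four_block_mat (a \<cdot>\<^sub>m H - L) (a \<cdot>\<^sub>m D - C)\<^sup>T (a \<cdot>\<^sub>m D - C) (0\<^sub>m r r)"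
    if "D \<in> carrier_mat r n" for D
    using H L C that by (intro eq_matI) auto
  from this[OF WC]
  have "a \<cdot>\<^sub>m four_block_mat H (W * C)\<^sup>T (W * C) (0\<^sub>m r r) - four_block_mat L C\<^sup>T C (0\<^sub>m r r)
      = four_block_mat (a \<cdot>\<^sub>m H - L) (?V * C)\<^sup>T (?V * C) (0\<^sub>m r r)"
    unfolding VC .
  then show ?thesis
    using det_four_block_congruence[OF X C V] by simp
qed

lemma det_pencil_unipotent:
  fixes K :: "'a::idom mat"
  assumes K: "K \<in> carrier_mat m p"
  shows "Determinant.det (a \<cdot>\<^sub>m four_block_mat (1\<^sub>m m) K (0\<^sub>m p m) (1\<^sub>m p) - 1\<^sub>m (m + p)) = (a - 1)^(m + p)"
proof -
  have "a \<cdot>\<^sub>m four_block_mat (1\<^sub>m m) K (0\<^sub>m p m) (1\<^sub>m p) - 1\<^sub>m (m + p)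
      = four_block_mat ((a - 1) \<cdot>\<^sub>m 1\<^sub>m m) (a \<cdot>\<^sub>m K) (0\<^sub>m p m) ((a - 1) \<cdot>\<^sub>m 1\<^sub>m p)"
    using K by (intro eq_matI) (auto simp: algebra_simps)
  moreover have "Determinant.det (four_block_mat ((a - 1) \<cdot>\<^sub>m 1\<^sub>m m) (a \<cdot>\<^sub>m K) (0\<^sub>m p m) ((a - 1) \<cdot>\<^sub>m 1\<^sub>m p))
      = Determinant.det ((a - 1) \<cdot>\<^sub>m (1\<^sub>m m :: 'a mat)) * Determinant.det ((a - 1) \<cdot>\<^sub>m (1\<^sub>m p :: 'a mat))"
    using K by (intro det_four_block_mat_lower_left_zero) auto
  ultimately show ?thesis
    by (simp add: power_add)
qed

section \<open>Eigenvalues of a contraction matrix as zeros of a pencil\<close>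

lemma det_nonzero_mat_inverse:
  fixes M :: "'a::field mat"
  assumes M: "M \<in> carrier_mat n n" and d: "Determinant.det M \<noteq> 0"
  obtains B where "mat_inverse M = Some B" "B \<in> carrier_mat n n" "M * B = 1\<^sub>m n" "B * M = 1\<^sub>m n"
proof -
  have "mat_inverse M \<noteq> None"
    using mat_inverse(1)[OF M, of "()"] det_non_zero_imp_unit[OF M d, of "()"] by auto
  then obtain B where "mat_inverse M = Some B" by auto
  with mat_inverse(2)[OF M this] that show thesis by auto
qed

text \<open>Multiplying the pencil by the inverse \<open>B\<close> of \<open>Jt\<close> gives
  \<open>(x + 1) - B J\<close>, which is minus the characteristic matrix of \<open>B J - 1\<close>
  at \<open>x\<close>; the factor \<open>det B\<close> is nonzero.\<close>

lemma eigenvalue_contraction: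
  fixes Jt J :: "real mat"
  assumes Jt: "Jt \<in> carrier_mat n n" and J: "J \<in> carrier_mat n n" and d: "Determinant.det Jt \<noteq> 0"
  shows "eigenvalue (map_mat complex_of_real (the (mat_inverse Jt) * J - 1\<^sub>m (dim_row J))) x \<longleftrightarrow>
    Determinant.det ((x + 1) \<cdot>\<^sub>m map_mat complex_of_real Jt - map_mat complex_of_real J) = 0"
proof -
  let ?h = "map_mat complex_of_real"
  obtain B where B: "mat_inverse Jt = Some B" "B \<in> carrier_mat n n" "Jt * B = 1\<^sub>m n" "B * Jt = 1\<^sub>m n"
    using det_nonzero_mat_inverse[OF Jt d] .
  have cB: "?h B \<in> carrier_mat n n" and cJ: "?h J \<in> carrier_mat n n" and cJt: "?h Jt \<in> carrier_mat n n"
    using B Jt J by auto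
  have "?h B * ?h Jt = ?h (B * Jt)"
    by (rule of_real_hom.mat_hom_mult[OF B(2) Jt, symmetric])
  also have "\<dots> = 1\<^sub>m n"
    unfolding B(4) by (rule of_real_hom.mat_hom_one)
  finally have "?h B * ?h Jt = 1\<^sub>m n" .
  then have inv: "?h B * ((x + 1) \<cdot>\<^sub>m ?h Jt) = (x + 1) \<cdot>\<^sub>m 1\<^sub>m n"
    by (simp add: mult_smult_distrib[OF cB cJt])
  have "Determinant.det B \<noteq> 0"
    using Determinant.det_mult[OF Jt B(2)] B(3) by auto
  then have dB: "Determinant.det (?h B) \<noteq> 0"
    by simp
  have "?h (M - 1\<^sub>m n) = ?h M - 1\<^sub>m n" if "M \<in> carrier_mat n n" for M
    using that by (intro eq_matI) auto
  from this[of "B * J"] have "?h (B * J - 1\<^sub>m n) = ?h B * ?h J - 1\<^sub>m n"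
    using B(2) J by (simp add: of_real_hom.mat_hom_mult[OF B(2) J])
  moreover have "?h B * ((x + 1) \<cdot>\<^sub>m ?h Jt - ?h J) = (x + 1) \<cdot>\<^sub>m 1\<^sub>m n - ?h B * ?h J"
    using mult_minus_distrib_mat[OF cB _ cJ, of "(x + 1) \<cdot>\<^sub>m ?h Jt"] cJt inv by simp
  moreover have "P - 1\<^sub>m n + (- x) \<cdot>\<^sub>m 1\<^sub>m n = (-1) \<cdot>\<^sub>m ((x + 1) \<cdot>\<^sub>m 1\<^sub>m n - P)"
    if "P \<in> carrier_mat n n" for P :: "complex mat"
    using that by (intro eq_matI) (auto simp: algebra_simps)
  ultimately have "char_matrix (?h (B * J - 1\<^sub>m n)) x = (-1) \<cdot>\<^sub>m (?h B * ((x + 1) \<cdot>\<^sub>m ?h Jt - ?h J))"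
    unfolding char_matrix_def using mult_carrier_mat[OF cB cJ] B(2) J by simp
  then have "Determinant.det (char_matrix (?h (B * J - 1\<^sub>m n)) x) = 0 \<longleftrightarrow>
      Determinant.det (?h B * ((x + 1) \<cdot>\<^sub>m ?h Jt - ?h J)) = 0"
    by simp
  also have "\<dots> \<longleftrightarrow> Determinant.det ((x + 1) \<cdot>\<^sub>m ?h Jt - ?h J) = 0"
    using Determinant.det_mult[OF cB minus_carrier_mat[OF cJ], of "(x + 1) \<cdot>\<^sub>m ?h Jt"] dB by auto
  finally show ?thesis
    using eigenvalue_det[of "?h (B * J - 1\<^sub>m n)" n x] minus_carrier_mat[OF one_carrier_mat, of "B * J"] B J
    by simp
qed

text \<open>For every \<open>a\<close> both pencils have determinant
  \<open>(a - 1)^(2 (m + p))\<close> times the same factor, since the right-hand side is the same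
  construction with \<open>K = 0\<close>. Hence the two spectra are equal as sets.\<close>

lemma contraction_rate_kkt_unipotent:
  fixes H L C K :: "real mat"
  assumes H: "H \<in> carrier_mat n n" and L: "L \<in> carrier_mat n n" and C: "C \<in> carrier_mat (m + p) n"
    and K: "K \<in> carrier_mat m p"
    and W: "W = four_block_mat (1\<^sub>m m) K (0\<^sub>m p m) (1\<^sub>m p)"
    and nz: "Determinant.det (four_block_mat H (W * C)\<^sup>T (W * C) (0\<^sub>m (m + p) (m + p))) \<noteq> 0"
  shows "contraction_rate (four_block_mat H (W * C)\<^sup>T (W * C) (0\<^sub>m (m + p) (m + p)))
             (four_block_mat L C\<^sup>T C (0\<^sub>m (m + p) (m + p)))
       = contraction_rate (four_block_mat H C\<^sup>T C (0\<^sub>m (m + p) (m + p)))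
             (four_block_mat L C\<^sup>T C (0\<^sub>m (m + p) (m + p)))"
proof -
  let ?r = "m + p"
  let ?h = "map_mat complex_of_real"
  let ?k = "\<lambda>H C. four_block_mat H C\<^sup>T C (0\<^sub>m ?r ?r)"
  have cW: "W \<in> carrier_mat ?r ?r" and WC: "W * C \<in> carrier_mat ?r n"
    using K C unfolding W by auto
  have cKh: "?h K \<in> carrier_mat m p" using K by auto
  have hW: "?h W = four_block_mat (1\<^sub>m m) (?h K) (0\<^sub>m p m) (1\<^sub>m p)"
    unfolding W using K by (intro eq_matI) auto
  have hk: "?h (four_block_mat H' D\<^sup>T D (0\<^sub>m ?r ?r)) = four_block_mat (?h H') (?h D)\<^sup>T (?h D) (0\<^sub>m ?r ?r)"
    if "H' \<in> carrier_mat n n" "D \<in> carrier_mat ?r n" for H' D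
    using that by (intro eq_matI) auto
  have hWC: "?h (W * C) = ?h W * ?h C"
    by (rule of_real_hom.mat_hom_mult[OF cW C])
  have c: "?h H \<in> carrier_mat n n" "?h L \<in> carrier_mat n n" "?h C \<in> carrier_mat ?r n"
    "?h W \<in> carrier_mat ?r ?r" using H L C cW by auto
  have one: "1\<^sub>m ?r = four_block_mat (1\<^sub>m m) (0\<^sub>m m p) (0\<^sub>m p m) (1\<^sub>m p :: complex mat)"
    by simp
  have oneC: "1\<^sub>m ?r * ?h C = ?h C" using C by auto
  \<comment> \<open>As \<open>det W = 1\<close>, the congruence carries invertibility over to the
    matrix built from \<open>C\<close>; without it \<open>the (mat_inverse _)\<close> would be
    unspecified.\<close>
  have dW: "Determinant.det W = 1"
    unfolding W using det_four_block_mat_lower_left_zero[OF one_carrier_mat K refl one_carrier_mat] by simp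
  have nz': "Determinant.det (?k H C) \<noteq> 0"
    using nz det_four_block_congruence[OF H C cW] by auto
  have "Determinant.det (a \<cdot>\<^sub>m ?h (?k H (W * C)) - ?h (?k L C))
      = Determinant.det (a \<cdot>\<^sub>m ?h (?k H C) - ?h (?k L C))" for a
  proof -
    have "Determinant.det (a \<cdot>\<^sub>m ?h (?k H (W * C)) - ?h (?k L C))
        = ((a - 1)^?r)^2 * Determinant.det (four_block_mat (a \<cdot>\<^sub>m ?h H - ?h L) (?h C)\<^sup>T (?h C) (0\<^sub>m ?r ?r))"
      unfolding hk[OF H WC] hk[OF L C] hWC det_kkt_pencil[OF c(1-4)]
      using det_pencil_unipotent[OF cKh] by (simp add: hW)
    also have "\<dots> = Determinant.det (a \<cdot>\<^sub>m ?h (?k H C) - ?h (?k L C))"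
      unfolding hk[OF H C] hk[OF L C]
      using det_kkt_pencil[OF c(1-3) one_carrier_mat, of a]
        det_pencil_unipotent[of "0\<^sub>m m p :: complex mat" m p a]
      unfolding oneC one[symmetric] by simp
    finally show ?thesis .
  qed
  moreover have "?k H (W * C) \<in> carrier_mat (n + ?r) (n + ?r)" "?k H C \<in> carrier_mat (n + ?r) (n + ?r)"
    "?k L C \<in> carrier_mat (n + ?r) (n + ?r)"
    using H L C WC by auto
  ultimately show ?thesis
    unfolding contraction_rate_def spectral_radius_def spectrum_def
    using eigenvalue_contraction nz nz' by presburger
qed


section \<open>Norms\<close>

lemma eq_mat_on_vecI:
  fixes M :: "'a::comm_ring_1 mat"
  assumes M: "M \<in> carrier_mat m n" and N: "N \<in> carrier_mat m n"
    and eq: "\<And>u. u \<in> carrier_vec n \<Longrightarrow> M *\<^sub>v u = N *\<^sub>v u"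
  shows "M = N"
proof (rule eq_matI)
  fix i j assume ij: "i < dim_row N" "j < dim_col N"
  have "(X *\<^sub>v unit_vec n j) $ i = X $$ (i, j)" if "X \<in> carrier_mat m n" for X :: "'a mat"
    using that ij N by simp
  from this[OF M] this[OF N] show "M $$ (i, j) = N $$ (i, j)"
    using eq[of "unit_vec n j"] by simp
qed (use M N in auto)

lemma diff_add_cancel_right_vec:
  fixes u v x :: "'a::ab_group_add vec"
  assumes "u \<in> carrier_vec n" "v \<in> carrier_vec n" "x \<in> carrier_vec n"
  shows "u + x - (v + x) = u - v"
  using assms by auto

lemma vnorm_L2_set: "vnorm v = L2_set (($) v) {0..<dim_vec v}"
  unfolding vnorm_def scalar_prod_def L2_set_def by (simp add: power2_eq_square)

lemma vnorm_nonneg [simp]: "0 \<le> vnorm v"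
  unfolding vnorm_L2_set by (rule L2_set_nonneg)

lemma vnorm_square: "(vnorm v)^2 = v \<bullet> v"
  unfolding vnorm_def scalar_prod_def by (simp add: sum_nonneg)

lemma vnorm_zero [simp]: "vnorm (0\<^sub>v n) = 0"
  unfolding vnorm_def by simp

lemma vnorm_eq_0_iff:
  assumes "v \<in> carrier_vec n"
  shows "vnorm v = 0 \<longleftrightarrow> v = 0\<^sub>v n"
  using assms unfolding vnorm_L2_set by (auto simp: L2_set_eq_0_iff intro!: eq_vecI)

lemma vnorm_triangle:
  assumes "u \<in> carrier_vec n" "v \<in> carrier_vec n"
  shows "vnorm (u + v) \<le> vnorm u + vnorm v"
proof -
  have "vnorm (u + v) = L2_set (\<lambda>i. u $ i + v $ i) {0..<n}"
    using assms unfolding vnorm_L2_set by (intro L2_set_cong) auto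
  then show ?thesis
    using L2_set_triangle_ineq[of "($) u" "($) v" "{0..<n}"] assms by (simp add: vnorm_L2_set)
qed

lemma vnorm_smult [simp]: "vnorm (a \<cdot>\<^sub>v v) = \<bar>a\<bar> * vnorm v"
proof -
  have "(a \<cdot>\<^sub>v v) \<bullet> (a \<cdot>\<^sub>v v) = a^2 * (v \<bullet> v)"
    unfolding scalar_prod_def by (simp add: sum_distrib_left power2_eq_square mult_ac)
  then show ?thesis
    unfolding vnorm_def by (simp add: real_sqrt_mult)
qed

lemma vnorm_minus_commute:
  assumes "u \<in> carrier_vec n" "v \<in> carrier_vec n"
  shows "vnorm (u - v) = vnorm (v - u)"
proof -
  have "u - v = (-1) \<cdot>\<^sub>v (v - u)"
    using assms by auto
  then show ?thesis by simp
qed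

lemma vnorm_triangle_diff:
  assumes "u \<in> carrier_vec n" "v \<in> carrier_vec n" "x \<in> carrier_vec n"
  shows "vnorm (u - v) \<le> vnorm (u - x) + vnorm (x - v)"
proof -
  have "u - v = (u - x) + (x - v)"
    using assms by auto
  then show ?thesis
    using vnorm_triangle[of "u - x" n "x - v"] assms by auto
qed

lemma vnorm_diff_le:
  assumes "u \<in> carrier_vec n" "v \<in> carrier_vec n"
  shows "vnorm (u - v) \<le> vnorm u + vnorm v"
  using vnorm_triangle_diff[OF assms zero_carrier_vec] vnorm_minus_commute[OF assms(2) zero_carrier_vec] assms
  by (simp add: minus_zero_vec)

lemma scalar_prod_le_vnorm:
  assumes "u \<in> carrier_vec n" "v \<in> carrier_vec n"
  shows "\<bar>u \<bullet> v\<bar> \<le> vnorm u * vnorm v"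
proof -
  have "\<bar>u \<bullet> v\<bar> \<le> (\<Sum>i = 0..<n. \<bar>u $ i\<bar> * \<bar>v $ i\<bar>)"
    using assms unfolding scalar_prod_def by (auto intro!: order.trans[OF sum_abs] simp: abs_mult)
  also have "\<dots> \<le> vnorm u * vnorm v"
    using L2_set_mult_ineq[of "($) u" "($) v" "{0..<n}"] assms by (simp add: vnorm_L2_set)
  finally show ?thesis .
qed

section \<open>Entries and the operator norm\<close>

lemma abs_index_le_vnorm:
  assumes "i < dim_vec v"
  shows "\<bar>v $ i\<bar> \<le> vnorm v"
  using member_le_L2_set[of "{0..<dim_vec v}" i "\<lambda>i. \<bar>v $ i\<bar>"] assms
  by (simp add: vnorm_def L2_set_def scalar_prod_def power2_eq_square abs_mult_self_eq)

lemma vnorm_le_sum_abs: "vnorm v \<le> (\<Sum>i = 0..<dim_vec v. \<bar>v $ i\<bar>)"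
  unfolding vnorm_L2_set by (rule L2_set_le_sum_abs)

text \<open>Cauchy-Schwarz row by row. The value of the constant is irrelevant: it shows that the
  set whose supremum is \<open>op_norm\<close> is bounded.\<close>

lemma vnorm_mult_mat_vec_bounded:
  assumes M: "M \<in> carrier_mat m n"
  shows "\<exists>B. \<forall>v \<in> carrier_vec n. vnorm (M *\<^sub>v v) \<le> B * vnorm v"
proof (intro exI ballI)
  fix v :: "real vec" assume v: "v \<in> carrier_vec n"
  have "vnorm (M *\<^sub>v v) \<le> (\<Sum>i = 0..<m. \<bar>row M i \<bullet> v\<bar>)"
    using vnorm_le_sum_abs[of "M *\<^sub>v v"] M by simp
  also have "\<dots> \<le> (\<Sum>i = 0..<m. vnorm (row M i) * vnorm v)"
    using M v by (intro sum_mono scalar_prod_le_vnorm[of _ n]) auto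
  finally show "vnorm (M *\<^sub>v v) \<le> (\<Sum>i = 0..<m. vnorm (row M i)) * vnorm v"
    by (simp add: sum_distrib_right)
qed

lemma
  assumes M: "M \<in> carrier_mat m n"
  shows op_norm_nonneg: "0 \<le> op_norm M"
    and vnorm_mult_mat_vec_le: "v \<in> carrier_vec n \<Longrightarrow> vnorm (M *\<^sub>v v) \<le> op_norm M * vnorm v"
proof -
  let ?U = "{v \<in> carrier_vec n. vnorm v \<le> 1}"
  obtain B where B: "\<And>v. v \<in> carrier_vec n \<Longrightarrow> vnorm (M *\<^sub>v v) \<le> B * vnorm v"
    using vnorm_mult_mat_vec_bounded[OF M] by blast
  have "vnorm (M *\<^sub>v v) \<le> \<bar>B\<bar>" if "v \<in> ?U" for v
  proof -
    have "B * vnorm v \<le> \<bar>B\<bar> * 1"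
      using that by (intro mult_mono) auto
    then show ?thesis using B[of v] that by auto
  qed
  then have bdd: "bdd_above ((\<lambda>v. vnorm (M *\<^sub>v v)) ` ?U)"
    by (intro bdd_aboveI2)
  have op: "op_norm M = (SUP v \<in> ?U. vnorm (M *\<^sub>v v))"
    unfolding op_norm_def using M by simp
  have upper: "vnorm (M *\<^sub>v v) \<le> op_norm M" if "v \<in> ?U" for v
    unfolding op by (rule cSUP_upper[OF that bdd])
  show nonneg: "0 \<le> op_norm M"
    using order.trans[OF vnorm_nonneg upper[of "0\<^sub>v n"]] by simp
  show "vnorm (M *\<^sub>v v) \<le> op_norm M * vnorm v" if v: "v \<in> carrier_vec n"
  proof (cases "vnorm v = 0")
    case True
    then show ?thesis using B[OF v] by simp
  next
    case False
    then have pos: "0 < vnorm v" using vnorm_nonneg[of v] by linarith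
    have "M *\<^sub>v (inverse (vnorm v) \<cdot>\<^sub>v v) = inverse (vnorm v) \<cdot>\<^sub>v (M *\<^sub>v v)"
      using mult_mat_vec[OF M v] .
    moreover have "inverse (vnorm v) \<cdot>\<^sub>v v \<in> ?U" using v pos by auto
    ultimately have "\<bar>inverse (vnorm v)\<bar> * vnorm (M *\<^sub>v v) \<le> op_norm M"
      using upper[of "inverse (vnorm v) \<cdot>\<^sub>v v"] by simp
    then show ?thesis using pos by (simp add: field_simps)
  qed
qed

section \<open>Jacobians\<close>

lemma has_jacobianD:
  assumes "has_jacobian n m f w M" "0 < e"
  obtains d where "0 < d" "\<And>v. v \<in> carrier_vec n \<Longrightarrow> vnorm (v - w) < d \<Longrightarrow>
        vnorm (f v - f w - M *\<^sub>v (v - w)) \<le> e * vnorm (v - w)"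
  using assms unfolding has_jacobian_def by meson

lemma has_jacobian_carrier: "has_jacobian n m f w M \<Longrightarrow> M \<in> carrier_mat m n"
  unfolding has_jacobian_def by simp

text \<open>Along the ray \<open>w + t u\<close> the two linearizations differ by
  \<open>t (M - N) u\<close>, while both remainders are of smaller order in \<open>t\<close>. This
  is what makes the value chosen in \<open>jacobian\<close> computable.\<close>

lemma has_jacobian_unique:
  assumes M: "has_jacobian n m f w M" and N: "has_jacobian n m f w N"
    and w: "w \<in> carrier_vec n" and f: "f \<in> carrier_vec n \<rightarrow> carrier_vec m"
  shows "M = N"
proof -
  have c: "M \<in> carrier_mat m n" "N \<in> carrier_mat m n"
    using M N by (auto simp: has_jacobian_def)
  have "(M - N) *\<^sub>v u = 0\<^sub>v m" if u: "u \<in> carrier_vec n" for u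
  proof (rule ccontr)
    assume nz: "(M - N) *\<^sub>v u \<noteq> 0\<^sub>v m"
    let ?x = "(M - N) *\<^sub>v u"
    have cx: "?x \<in> carrier_vec m" using minus_carrier_mat[OF c(2)] u by (rule mult_mat_vec_carrier)
    then have pos: "0 < vnorm ?x"
      using vnorm_eq_0_iff[OF cx] nz vnorm_nonneg[of ?x] by linarith
    \<comment> \<open>\<open>b\<close> bounds the norm of \<open>u\<close> and is positive. With
      \<open>e\<close> and \<open>t\<close> as chosen below, both remainder estimates apply and
      together reach at most half of \<open>t * vnorm ?x\<close>.\<close>
    define b where "b = vnorm u + 1"
    have pu: "0 < b" and ub: "vnorm u \<le> b" using vnorm_nonneg[of u] unfolding b_def by linarith+
    define e where "e = vnorm ?x / (4 * b)"
    have e: "0 < e" using pos pu unfolding e_def by simp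
    obtain d1 where d1: "0 < d1" "\<And>v. v \<in> carrier_vec n \<Longrightarrow> vnorm (v - w) < d1 \<Longrightarrow>
        vnorm (f v - f w - M *\<^sub>v (v - w)) \<le> e * vnorm (v - w)"
      using has_jacobianD[OF M e] by auto
    obtain d2 where d2: "0 < d2" "\<And>v. v \<in> carrier_vec n \<Longrightarrow> vnorm (v - w) < d2 \<Longrightarrow>
        vnorm (f v - f w - N *\<^sub>v (v - w)) \<le> e * vnorm (v - w)"
      using has_jacobianD[OF N e] by auto
    define t where "t = min d1 d2 / (2 * b)"
    have t: "0 < t" using d1 d2 pu unfolding t_def by simp
    have "t * vnorm u \<le> t * b" using t ub by simp
    also have "\<dots> = min d1 d2 / 2" using pu unfolding t_def by simp
    finally have tu: "t * vnorm u < d1" "t * vnorm u < d2" using d1 d2 by auto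
    define v where "v = w + t \<cdot>\<^sub>v u"
    have v: "v \<in> carrier_vec n" using w u unfolding v_def by auto
    have vw: "v - w = t \<cdot>\<^sub>v u" using w u unfolding v_def by auto
    let ?a = "f v - f w - M *\<^sub>v (v - w)" and ?b = "f v - f w - N *\<^sub>v (v - w)"
    have cf: "f v \<in> carrier_vec m" "f w \<in> carrier_vec m" using f v w by auto
    have cM: "M *\<^sub>v u \<in> carrier_vec m" "N *\<^sub>v u \<in> carrier_vec m" using c u by auto
    have vn: "vnorm (v - w) = t * vnorm u" unfolding vw using t by simp
    have M': "M *\<^sub>v (v - w) = t \<cdot>\<^sub>v (M *\<^sub>v u)" and N': "N *\<^sub>v (v - w) = t \<cdot>\<^sub>v (N *\<^sub>v u)"
      unfolding vw using c u by (auto intro: mult_mat_vec)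
    have "t \<cdot>\<^sub>v (a - b) = (p - q - t \<cdot>\<^sub>v b) - (p - q - t \<cdot>\<^sub>v a)"
      if "a \<in> carrier_vec m" "b \<in> carrier_vec m" "p \<in> carrier_vec m" "q \<in> carrier_vec m" for a b p q
      using that by (auto simp: algebra_simps)
    from this[OF cM cf] have "t \<cdot>\<^sub>v ?x = ?b - ?a"
      unfolding M' N' minus_mult_distrib_mat_vec[OF c u] .
    then have "t * vnorm ?x = vnorm (?b - ?a)"
      using t vnorm_smult[of t ?x] by simp
    also have "\<dots> \<le> vnorm ?b + vnorm ?a"
      using cf c w v by (intro vnorm_diff_le[of _ m]) auto
    also have "\<dots> \<le> 2 * e * (t * vnorm u)"
      using d1(2)[OF v] d2(2)[OF v] tu unfolding vn by simp
    also have "\<dots> \<le> 2 * e * (t * b)"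
      using t e ub by simp
    also have "\<dots> = t * (vnorm ?x / 2)"
      unfolding e_def using pu by simp
    finally show False using t pos by simp
  qed
  then have "M - N = 0\<^sub>m m n"
    using c by (intro eq_mat_on_vecI[of _ m n]) (auto intro: minus_carrier_mat)
  then have "M $$ (i, j) - N $$ (i, j) = 0" if "i < m" "j < n" for i j
    using that c by (metis carrier_matD index_minus_mat(1) index_zero_mat(1))
  then show ?thesis
    using c by (intro eq_matI) auto
qed

lemma jacobian_eqI:
  assumes "has_jacobian n m f w M" "w \<in> carrier_vec n" "f \<in> carrier_vec n \<rightarrow> carrier_vec m"
  shows "jacobian n m f w = M"
  unfolding jacobian_def
  using assms by (intro some_equality) (auto intro: has_jacobian_unique)

lemma differentiable_vec_has_jacobian:
  "differentiable_vec n m f w \<Longrightarrow> has_jacobian n m f w (jacobian n m f w)"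
  unfolding differentiable_vec_def jacobian_def by (rule someI_ex)

lemma has_jacobian_cong:
  assumes "has_jacobian n m f w M" "w \<in> carrier_vec n" "\<And>v. v \<in> carrier_vec n \<Longrightarrow> f v = g v"
  shows "has_jacobian n m g w M"
  using assms unfolding has_jacobian_def by simp

text \<open>Together with the case of an affine inner map this is all of the chain rule that occurs:
  selecting blocks, padding with zeros and freezing variables are affine. The added 1 in the
  denominators covers a zero operator norm.\<close>

lemma has_jacobian_mult_left:
  assumes f: "f \<in> carrier_vec n \<rightarrow> carrier_vec m" and M: "has_jacobian n m f w M"
    and T: "T \<in> carrier_mat p m" and w: "w \<in> carrier_vec n"
  shows "has_jacobian n p (\<lambda>v. T *\<^sub>v f v) w (T * M)"
  unfolding has_jacobian_def
proof (intro conjI allI impI)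
  have cM: "M \<in> carrier_mat m n" by (rule has_jacobian_carrier[OF M])
  show "T * M \<in> carrier_mat p n" using T cM by auto
  fix e :: real assume e: "0 < e"
  have pT: "0 < op_norm T + 1" using op_norm_nonneg[OF T] by linarith
  obtain d where d: "0 < d" "\<And>v. v \<in> carrier_vec n \<Longrightarrow> vnorm (v - w) < d \<Longrightarrow>
        vnorm (f v - f w - M *\<^sub>v (v - w)) \<le> e / (op_norm T + 1) * vnorm (v - w)"
    using has_jacobianD[OF M, of "e / (op_norm T + 1)"] e pT by auto
  have "vnorm (T *\<^sub>v f v - T *\<^sub>v f w - T * M *\<^sub>v (v - w)) \<le> e * vnorm (v - w)"
    if v: "v \<in> carrier_vec n" and vd: "vnorm (v - w) < d" for v
  proof -
    let ?r = "f v - f w - M *\<^sub>v (v - w)"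
    have cf: "f v \<in> carrier_vec m" "f w \<in> carrier_vec m" using f v w by auto
    have cMv: "M *\<^sub>v (v - w) \<in> carrier_vec m" using cM v w by auto
    have "T *\<^sub>v f v - T *\<^sub>v f w - T * M *\<^sub>v (v - w) = T *\<^sub>v ?r"
      using T cM cf cMv v w assoc_mult_mat_vec[OF T cM, of "v - w"]
      by (simp add: mult_minus_distrib_mat_vec[OF T])
    then have "vnorm (T *\<^sub>v f v - T *\<^sub>v f w - T * M *\<^sub>v (v - w)) \<le> op_norm T * vnorm ?r"
      using vnorm_mult_mat_vec_le[OF T, of ?r] cf cMv by simp
    also have "\<dots> \<le> (op_norm T + 1) * (e / (op_norm T + 1) * vnorm (v - w))"
      using d(2)[OF v vd] pT op_norm_nonneg[OF T] by (intro mult_mono) auto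
    also have "\<dots> = e * vnorm (v - w)" using pT by simp
    finally show ?thesis .
  qed
  with d(1) show "\<exists>d>0. \<forall>v\<in>carrier_vec n. vnorm (v - w) < d \<longrightarrow>
      vnorm (T *\<^sub>v f v - T *\<^sub>v f w - T * M *\<^sub>v (v - w)) \<le> e * vnorm (v - w)"
    by blast
qed

lemma has_jacobian_affine:
  assumes M: "has_jacobian n m f (P *\<^sub>v u + b) M"
    and P: "P \<in> carrier_mat n k" and u: "u \<in> carrier_vec k" and b: "b \<in> carrier_vec n"
  shows "has_jacobian k m (\<lambda>u. f (P *\<^sub>v u + b)) u (M * P)"
  unfolding has_jacobian_def
proof (intro conjI allI impI)
  have cM: "M \<in> carrier_mat m n" by (rule has_jacobian_carrier[OF M])
  show "M * P \<in> carrier_mat m k" using P cM by auto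
  fix e :: real assume e: "0 < e"
  have pP: "0 < op_norm P + 1" using op_norm_nonneg[OF P] by linarith
  let ?e = "e / (op_norm P + 1)"
  let ?p = "\<lambda>u. P *\<^sub>v u + b"
  obtain d where d: "0 < d" "\<And>v. v \<in> carrier_vec n \<Longrightarrow> vnorm (v - ?p u) < d \<Longrightarrow>
        vnorm (f v - f (?p u) - M *\<^sub>v (v - ?p u)) \<le> ?e * vnorm (v - ?p u)"
    using has_jacobianD[OF M, of ?e] e pP by auto
  have "vnorm (f (?p v) - f (?p u) - M * P *\<^sub>v (v - u)) \<le> e * vnorm (v - u)"
    if v: "v \<in> carrier_vec k" and vd: "vnorm (v - u) < d / (op_norm P + 1)" for v
  proof -
    have vu: "v - u \<in> carrier_vec k" using v u by auto
    have cP: "P *\<^sub>v v \<in> carrier_vec n" "P *\<^sub>v u \<in> carrier_vec n" using P u v by auto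
    have diff: "?p v - ?p u = P *\<^sub>v (v - u)"
      unfolding mult_minus_distrib_mat_vec[OF P v u] using cP b by (rule diff_add_cancel_right_vec)
    have "vnorm (P *\<^sub>v (v - u)) \<le> op_norm P * vnorm (v - u)"
      by (rule vnorm_mult_mat_vec_le[OF P vu])
    also have "\<dots> \<le> (op_norm P + 1) * vnorm (v - u)"
      by (simp add: mult_right_mono)
    finally have le: "vnorm (?p v - ?p u) \<le> (op_norm P + 1) * vnorm (v - u)"
      unfolding diff .
    also have "\<dots> < d" using vd pP by (simp add: field_simps)
    finally have "vnorm (f (?p v) - f (?p u) - M *\<^sub>v (?p v - ?p u)) \<le> ?e * vnorm (?p v - ?p u)"
      using d(2)[of "?p v"] cP b by auto
    also have "\<dots> \<le> ?e * ((op_norm P + 1) * vnorm (v - u))"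
      using le e pP by (intro mult_left_mono) auto
    also have "\<dots> = e * vnorm (v - u)" using pP by simp
    finally show ?thesis
      unfolding diff assoc_mult_mat_vec[OF cM P vu] .
  qed
  moreover have "0 < d / (op_norm P + 1)" using d(1) pP by simp
  ultimately show "\<exists>d>0. \<forall>v\<in>carrier_vec k. vnorm (v - u) < d \<longrightarrow>
      vnorm (f (?p v) - f (?p u) - M * P *\<^sub>v (v - u)) \<le> e * vnorm (v - u)"
    by blast
qed

text \<open>Testing against a fixed vector \<open>g\<close> reduces to a real function of one real
  variable, for which the mean value theorem holds.\<close>

lemma has_jacobian_line_derivative:
  assumes M: "has_jacobian n m f (p + t \<cdot>\<^sub>v x) M" and f: "f \<in> carrier_vec n \<rightarrow> carrier_vec m"
    and c: "p \<in> carrier_vec n" "x \<in> carrier_vec n" "g \<in> carrier_vec m"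
  shows "((\<lambda>t. g \<bullet> f (p + t \<cdot>\<^sub>v x)) has_real_derivative g \<bullet> (M *\<^sub>v x)) (at t)"
proof -
  have cM: "M \<in> carrier_mat m n" by (rule has_jacobian_carrier[OF M])
  have cMx: "M *\<^sub>v x \<in> carrier_vec m" using cM c by auto
  let ?p = "\<lambda>t. p + t \<cdot>\<^sub>v x"
  have cp: "?p s \<in> carrier_vec n" for s using c by auto
  then have cf: "f (?p s) \<in> carrier_vec m" for s using f by auto
  let ?c = "vnorm g * vnorm x + 1"
  have pc: "0 < ?c" using mult_nonneg_nonneg[OF vnorm_nonneg[of g] vnorm_nonneg[of x]] by linarith
  have "\<exists>d>0. \<forall>y. \<bar>y - t\<bar> < d \<longrightarrow>
      \<bar>g \<bullet> f (?p y) - g \<bullet> f (?p t) - (g \<bullet> (M *\<^sub>v x)) * (y - t)\<bar> \<le> e * \<bar>y - t\<bar>"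
    if e: "0 < e" for e
  proof -
    obtain d where d: "0 < d" "\<And>v. v \<in> carrier_vec n \<Longrightarrow> vnorm (v - ?p t) < d \<Longrightarrow>
        vnorm (f v - f (?p t) - M *\<^sub>v (v - ?p t)) \<le> e / ?c * vnorm (v - ?p t)"
      using has_jacobianD[OF M, of "e / ?c"] e pc by auto
    have px: "0 < vnorm x + 1" using vnorm_nonneg[of x] by linarith
    have "\<bar>g \<bullet> f (?p y) - g \<bullet> f (?p t) - (g \<bullet> (M *\<^sub>v x)) * (y - t)\<bar> \<le> e * \<bar>y - t\<bar>"
      if y: "\<bar>y - t\<bar> < d / (vnorm x + 1)" for y
    proof -
      have diff: "?p y - ?p t = (y - t) \<cdot>\<^sub>v x"
        using c by (auto simp: algebra_simps)
      have Md: "M *\<^sub>v ((y - t) \<cdot>\<^sub>v x) = (y - t) \<cdot>\<^sub>v (M *\<^sub>v x)"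
        by (rule mult_mat_vec[OF cM c(2)])
      have "\<bar>y - t\<bar> * vnorm x \<le> \<bar>y - t\<bar> * (vnorm x + 1)" by (simp add: mult_left_mono)
      also have "\<dots> < d" using y px by (simp add: field_simps)
      finally have "vnorm (?p y - ?p t) < d" unfolding diff by simp
      then have r: "vnorm (f (?p y) - f (?p t) - (y - t) \<cdot>\<^sub>v (M *\<^sub>v x)) \<le> e / ?c * (\<bar>y - t\<bar> * vnorm x)"
        using d(2)[OF cp, of y] unfolding diff Md by simp
      have "g \<bullet> f (?p y) - g \<bullet> f (?p t) - (g \<bullet> (M *\<^sub>v x)) * (y - t)
          = g \<bullet> (f (?p y) - f (?p t) - (y - t) \<cdot>\<^sub>v (M *\<^sub>v x))"
        using c(3) cf[of y] cf[of t] cMx by (simp add: scalar_prod_minus_distrib[of _ m])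
      also have "\<bar>\<dots>\<bar> \<le> vnorm g * vnorm (f (?p y) - f (?p t) - (y - t) \<cdot>\<^sub>v (M *\<^sub>v x))"
        using c(3) cf[of y] cf[of t] cMx by (intro scalar_prod_le_vnorm[of _ m]) auto
      also have "\<dots> \<le> vnorm g * (e / ?c * (\<bar>y - t\<bar> * vnorm x))"
        by (intro mult_left_mono r) simp
      also have "\<dots> = (vnorm g * vnorm x) * (e / ?c * \<bar>y - t\<bar>)" by simp
      also have "\<dots> \<le> ?c * (e / ?c * \<bar>y - t\<bar>)"
        using e pc by (intro mult_right_mono) auto
      also have "\<dots> = e * \<bar>y - t\<bar>" using pc by simp
      finally show ?thesis .
    qed
    moreover have "0 < d / (vnorm x + 1)" using d(1) px by simp
    ultimately show ?thesis by blast
  qed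
  then show ?thesis
    unfolding has_field_derivative_def has_derivative_at_alt
    by (simp add: bounded_linear_mult_right)
qed

text \<open>The remainder is tested against itself: the mean value theorem for
  \<open>t \<mapsto> g \<bullet> f (v - x + t x)\<close> with \<open>g\<close> the remainder
  expresses \<open>g \<bullet> g\<close> through a difference of Jacobians. The derivative is taken
  at the end point \<open>v\<close> of the step, as in the adjoint secant condition. The constant is
  \<open>\<bar>c\<bar>\<close> because no sign of \<open>c\<close> is known.\<close>

lemma lipschitz_jacobian_remainder:
  assumes D: "\<And>v. v \<in> carrier_vec n \<Longrightarrow> has_jacobian n m f v (D v)"
    and f: "f \<in> carrier_vec n \<rightarrow> carrier_vec m"
    and lip: "\<And>v v'. v \<in> carrier_vec n \<Longrightarrow> v' \<in> carrier_vec n \<Longrightarrow>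
        op_norm (D v - D v') \<le> c * vnorm (v - v')"
    and v: "v \<in> carrier_vec n" and x: "x \<in> carrier_vec n"
  shows "vnorm (D v *\<^sub>v x - (f v - f (v - x))) \<le> \<bar>c\<bar> * (vnorm x)^2"
proof -
  let ?g = "D v *\<^sub>v x - (f v - f (v - x))"
  let ?p = "\<lambda>t. (v - x) + t \<cdot>\<^sub>v x"
  have cD: "D u \<in> carrier_mat m n" if "u \<in> carrier_vec n" for u
    using D[OF that] by (rule has_jacobian_carrier)
  have cp: "?p t \<in> carrier_vec n" for t using v x by auto
  have cf: "f v \<in> carrier_vec m" "f (v - x) \<in> carrier_vec m" using f v x by auto
  have cDx: "D u *\<^sub>v x \<in> carrier_vec m" if "u \<in> carrier_vec n" for u using cD[OF that] x by auto
  have cg: "?g \<in> carrier_vec m" using cf cDx[OF v] by auto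
  have "\<exists>t. 0 < t \<and> t < 1 \<and> ?g \<bullet> f (?p 1) - ?g \<bullet> f (?p 0) = (1 - 0) * (?g \<bullet> (D (?p t) *\<^sub>v x))"
    using v x cg f D cp by (intro MVT2 has_jacobian_line_derivative[of n m]) auto
  then obtain t where t: "0 < t" "t < 1"
    and mvt: "?g \<bullet> f (?p 1) - ?g \<bullet> f (?p 0) = ?g \<bullet> (D (?p t) *\<^sub>v x)"
    by auto
  have "?p 1 = v" "?p 0 = v - x" using v x by auto
  with mvt have mvt': "?g \<bullet> f v - ?g \<bullet> f (v - x) = ?g \<bullet> (D (?p t) *\<^sub>v x)" by simp
  have cDD: "D v - D (?p t) \<in> carrier_mat m n" by (rule minus_carrier_mat[OF cD[OF cp]])
  have "(vnorm ?g)^2 = ?g \<bullet> ?g" by (rule vnorm_square)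
  also have "\<dots> = ?g \<bullet> (D v *\<^sub>v x) - (?g \<bullet> f v - ?g \<bullet> f (v - x))"
    using cg cf cDx[OF v] by (simp add: scalar_prod_minus_distrib[of ?g m])
  also have "\<dots> = ?g \<bullet> ((D v - D (?p t)) *\<^sub>v x)"
    unfolding mvt' minus_mult_distrib_mat_vec[OF cD[OF v] cD[OF cp] x]
    using cg cDx[OF v] cDx[OF cp] by (simp add: scalar_prod_minus_distrib[of ?g m])
  also have "\<dots> \<le> vnorm ?g * vnorm ((D v - D (?p t)) *\<^sub>v x)"
    using scalar_prod_le_vnorm[OF cg, of "(D v - D (?p t)) *\<^sub>v x"] cDD x by auto
  finally have le: "(vnorm ?g)^2 \<le> vnorm ?g * vnorm ((D v - D (?p t)) *\<^sub>v x)" .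
  have "v - ?p t = (1 - t) \<cdot>\<^sub>v x" using v x by (auto simp: algebra_simps)
  then have "vnorm (v - ?p t) \<le> vnorm x" using t by (simp add: mult_left_le_one_le)
  then have "c * vnorm (v - ?p t) \<le> \<bar>c\<bar> * vnorm x" by (intro mult_mono) auto
  then have op: "op_norm (D v - D (?p t)) \<le> \<bar>c\<bar> * vnorm x" using lip[OF v cp, of t] by linarith
  have "vnorm ((D v - D (?p t)) *\<^sub>v x) \<le> op_norm (D v - D (?p t)) * vnorm x"
    by (rule vnorm_mult_mat_vec_le[OF cDD x])
  also have "\<dots> \<le> \<bar>c\<bar> * vnorm x * vnorm x"
    using op by (intro mult_right_mono) auto
  finally have "vnorm ((D v - D (?p t)) *\<^sub>v x) \<le> \<bar>c\<bar> * (vnorm x)^2"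
    by (simp add: power2_eq_square)
  moreover have "vnorm ?g \<le> vnorm ((D v - D (?p t)) *\<^sub>v x)"
  proof (cases "vnorm ?g = 0")
    case False
    then have "0 < vnorm ?g" using vnorm_nonneg[of ?g] by linarith
    then show ?thesis using le by (simp add: power2_eq_square)
  qed simp
  ultimately show ?thesis by linarith
qed


section \<open>Block structure\<close>

text \<open>Common pattern of \<open>stage\<close> and \<open>mult_stage\<close>, so that block
  facts are proved once for both.\<close>

definition slice :: "(nat \<Rightarrow> nat) \<Rightarrow> nat \<Rightarrow> real vec \<Rightarrow> real vec" where
  "slice d i v = Matrix.vec (d i) (\<lambda>j. v $ ((\<Sum>k<i. d k) + j))"

text \<open>Slicing as a 0/1 matrix, which makes linearity, operator norms and the chain rule
  available; the transpose pads a block with zeros.\<close>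

definition block_sel :: "(nat \<Rightarrow> nat) \<Rightarrow> nat \<Rightarrow> nat \<Rightarrow> real mat" where
  "block_sel d n i =
     Matrix.mat (d i) (\<Sum>k<n. d k) (\<lambda>(r, c). if c = (\<Sum>k<i. d k) + r then 1 else 0)"

lemma slice_carrier [simp]: "slice d i v \<in> carrier_vec (d i)"
  unfolding slice_def by simp

lemma block_sel_carrier [simp]: "block_sel d n i \<in> carrier_mat (d i) (\<Sum>k<n. d k)"
  unfolding block_sel_def by simp

lemma block_index_less:
  fixes d :: "nat \<Rightarrow> nat"
  assumes "i < n" "j < d i"
  shows "(\<Sum>k<i. d k) + j < (\<Sum>k<n. d k)"
proof -
  have "(\<Sum>k<i. d k) + j < (\<Sum>k<Suc i. d k)" using assms by simp
  also have "\<dots> \<le> (\<Sum>k<n. d k)" using assms by (intro sum_mono2) auto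
  finally show ?thesis .
qed

lemma block_index_exists:
  fixes d :: "nat \<Rightarrow> nat"
  assumes "c < (\<Sum>k<n. d k)"
  obtains i j where "i < n" "j < d i" "c = (\<Sum>k<i. d k) + j"
  using assms
proof (induction n arbitrary: thesis)
  case (Suc n)
  show ?case
  proof (cases "c < (\<Sum>k<n. d k)")
    case True
    with Suc.IH obtain i j where "i < n" "j < d i" "c = (\<Sum>k<i. d k) + j" by blast
    with Suc.prems(1)[of i j] show ?thesis by simp
  next
    case False
    with Suc.prems(1)[of n "c - (\<Sum>k<n. d k)"] Suc.prems(2) show ?thesis by simp
  qed
qed simp

lemma block_index_eq_iff:
  fixes d :: "nat \<Rightarrow> nat"
  assumes "j < d i" "j' < d i'"
  shows "(\<Sum>k<i. d k) + j = (\<Sum>k<i'. d k) + j' \<longleftrightarrow> i = i' \<and> j = j'"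
proof -
  have less: "(\<Sum>k<a. d k) + x < (\<Sum>k<b. d k) + y" if "a < b" "x < d a" for a b x y
    using block_index_less[of a b x d] that by simp
  show ?thesis
    using less[of i i' j j'] less[of i' i j' j] assms by (cases i i' rule: linorder_cases) auto
qed

lemma slice_eq_block_sel:
  assumes i: "i < n" and v: "v \<in> carrier_vec (\<Sum>k<n. d k)"
  shows "slice d i v = block_sel d n i *\<^sub>v v"
proof (rule eq_vecI)
  fix j assume "j < dim_vec (block_sel d n i *\<^sub>v v)"
  then have j: "j < d i" unfolding block_sel_def by simp
  have b: "(\<Sum>k<i. d k) + j < (\<Sum>k<n. d k)" by (rule block_index_less[of i n j d, OF i j])
  have "(block_sel d n i *\<^sub>v v) $ j
      = (\<Sum>c = 0..<(\<Sum>k<n. d k). (if c = (\<Sum>k<i. d k) + j then 1 else 0) * v $ c)"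
    using v j unfolding block_sel_def scalar_prod_def by (auto simp: scalar_prod_def intro!: sum.cong)
  also have "\<dots> = (\<Sum>c = 0..<(\<Sum>k<n. d k). if c = (\<Sum>k<i. d k) + j then v $ c else 0)"
    by (intro sum.cong) auto
  also have "\<dots> = v $ ((\<Sum>k<i. d k) + j)"
    using b by (simp add: sum.delta)
  finally show "slice d i v $ j = (block_sel d n i *\<^sub>v v) $ j"
    using j unfolding slice_def by simp
qed (simp add: slice_def block_sel_def)

lemma slice_transpose_block_sel:
  assumes i: "i < n" and i': "i' < n" and u: "u \<in> carrier_vec (d i)"
  shows "slice d i' ((block_sel d n i)\<^sup>T *\<^sub>v u) = (if i' = i then u else 0\<^sub>v (d i'))"
proof (rule eq_vecI)
  fix j assume "j < dim_vec (if i' = i then u else 0\<^sub>v (d i'))"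
  then have j: "j < d i'" using u by (auto split: if_splits)
  have b: "(\<Sum>k<i'. d k) + j < (\<Sum>k<n. d k)" by (rule block_index_less[of i' n j d, OF i' j])
  have "((block_sel d n i)\<^sup>T *\<^sub>v u) $ ((\<Sum>k<i'. d k) + j)
      = (\<Sum>r = 0..<d i. (if (\<Sum>k<i'. d k) + j = (\<Sum>k<i. d k) + r then 1 else 0) * u $ r)"
    using u b unfolding block_sel_def by (auto simp: scalar_prod_def intro!: sum.cong)
  also have "\<dots> = (\<Sum>r = 0..<d i. if r = j then (if i' = i then u $ r else 0) else 0)"
    using j by (intro sum.cong) (auto simp: block_index_eq_iff)
  also have "\<dots> = (if i' = i then u $ j else 0)"
    using j by (auto simp: sum.delta)
  finally show "slice d i' ((block_sel d n i)\<^sup>T *\<^sub>v u) $ j = (if i' = i then u else 0\<^sub>v (d i')) $ j"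
    using j unfolding slice_def by simp
qed (use u in \<open>simp add: slice_def\<close>)

lemma block_sel_mult_transpose:
  assumes i: "i < n"
  shows "block_sel d n i * (block_sel d n i)\<^sup>T = 1\<^sub>m (d i)"
proof (rule eq_mat_on_vecI)
  let ?S = "block_sel d n i"
  have S: "?S \<in> carrier_mat (d i) (\<Sum>k<n. d k)" by simp
  then have T: "?S\<^sup>T \<in> carrier_mat (\<Sum>k<n. d k) (d i)" by simp
  show "?S * ?S\<^sup>T \<in> carrier_mat (d i) (d i)" by (rule mult_carrier_mat[OF S T])
  fix u :: "real vec" assume u: "u \<in> carrier_vec (d i)"
  show "?S * ?S\<^sup>T *\<^sub>v u = 1\<^sub>m (d i) *\<^sub>v u"
    using assoc_mult_mat_vec[OF S T u] slice_eq_block_sel[OF i mult_mat_vec_carrier[OF T u]]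
      slice_transpose_block_sel[of i n i u d, OF i i u] u by simp
qed simp

lemma vnorm_transpose_block_sel:
  assumes i: "i < n" and u: "u \<in> carrier_vec (d i)"
  shows "vnorm ((block_sel d n i)\<^sup>T *\<^sub>v u) = vnorm u"
proof -
  let ?S = "block_sel d n i"
  have S: "?S \<in> carrier_mat (d i) (\<Sum>k<n. d k)" by simp
  then have T: "?S\<^sup>T \<in> carrier_mat (\<Sum>k<n. d k) (d i)" by simp
  have Tu: "?S\<^sup>T *\<^sub>v u \<in> carrier_vec (\<Sum>k<n. d k)" by (rule mult_mat_vec_carrier[OF T u])
  have "(?S\<^sup>T *\<^sub>v u) \<bullet> (?S\<^sup>T *\<^sub>v u) = u \<bullet> (?S *\<^sub>v (?S\<^sup>T *\<^sub>v u))"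
    by (rule transpose_vec_mult_scalar[OF S Tu u])
  also have "\<dots> = u \<bullet> u"
    using assoc_mult_mat_vec[OF S T u] block_sel_mult_transpose[OF i, of d] u by simp
  finally show ?thesis unfolding vnorm_def by simp
qed

lemma slice_eqI:
  assumes "\<And>i. i < n \<Longrightarrow> slice d i u = slice d i v"
    and u: "u \<in> carrier_vec (\<Sum>k<n. d k)" and v: "v \<in> carrier_vec (\<Sum>k<n. d k)"
  shows "u = v"
proof (rule eq_vecI)
  fix c assume "c < dim_vec v"
  then obtain i j where ij: "i < n" "j < d i" "c = (\<Sum>k<i. d k) + j"
    using v block_index_exists[of c d n] by auto
  have "slice d i u $ j = slice d i v $ j" using assms(1)[OF ij(1)] by simp
  then show "u $ c = v $ c" using ij unfolding slice_def by simp
qed (use u v in auto)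

lemma slice_append_left:
  assumes "a \<in> carrier_vec (\<Sum>k<n. d k)" "i < n"
  shows "slice d i (a @\<^sub>v b) = slice d i a"
proof (rule eq_vecI)
  fix j assume "j < dim_vec (slice d i a)"
  then have j: "j < d i" by (simp add: slice_def)
  show "slice d i (a @\<^sub>v b) $ j = slice d i a $ j"
    using block_index_less[of i n j d] j assms by (simp add: slice_def)
qed (simp add: slice_def)

lemma slice_append_right:
  assumes "a \<in> carrier_vec (\<Sum>k<n. d k)" "b \<in> carrier_vec (d n)"
  shows "slice d n (a @\<^sub>v b) = b"
  using assms by (intro eq_vecI) (auto simp: slice_def)

text \<open>\<open>vec_concat\<close> recurses at the front, but the offsets
  \<open>\<Sum>k<n. d k\<close> grow at the back; peeling off the last block suits induction on
  \<open>n\<close>.\<close>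

lemma vec_concat_append: "vec_concat (xs @ [x]) = vec_concat xs @\<^sub>v x"
proof (induction xs)
  case Nil
  show ?case by (auto simp: vec_concat_def)
next
  case (Cons a xs)
  have assoc: "a @\<^sub>v (b @\<^sub>v c) = (a @\<^sub>v b) @\<^sub>v c" for b c :: "real vec"
    by (intro eq_vecI) auto
  show ?case using Cons assoc by (simp add: vec_concat_def)
qed

lemma
  assumes "\<And>k. k < n \<Longrightarrow> f k \<in> carrier_vec (d k)"
  shows vec_concat_carrier: "vec_concat (map f [0..<n]) \<in> carrier_vec (\<Sum>k<n. d k)"
    and slice_vec_concat: "i < n \<Longrightarrow> slice d i (vec_concat (map f [0..<n])) = f i"
proof -
  have "vec_concat (map f [0..<n]) \<in> carrier_vec (\<Sum>k<n. d k)
      \<and> (\<forall>i<n. slice d i (vec_concat (map f [0..<n])) = f i)"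
    using assms
  proof (induction n)
    case 0
    show ?case by (simp add: vec_concat_def)
  next
    case (Suc n)
    then have IH: "vec_concat (map f [0..<n]) \<in> carrier_vec (\<Sum>k<n. d k)"
      "\<And>i. i < n \<Longrightarrow> slice d i (vec_concat (map f [0..<n])) = f i"
      and fn: "f n \<in> carrier_vec (d n)" by auto
    have "vec_concat (map f [0..<Suc n]) = vec_concat (map f [0..<n]) @\<^sub>v f n"
      by (simp add: vec_concat_append)
    then show ?case
      using IH fn slice_append_left[OF IH(1)] slice_append_right[OF IH(1) fn]
      by (auto simp: less_Suc_eq)
  qed
  then show "vec_concat (map f [0..<n]) \<in> carrier_vec (\<Sum>k<n. d k)"
    "i < n \<Longrightarrow> slice d i (vec_concat (map f [0..<n])) = f i" by auto
qed

lemma diag_block_mat_carrier: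
  assumes "\<And>k. k < n \<Longrightarrow> B k \<in> carrier_mat (r k) (c k)"
  shows "diag_block_mat (map B [0..<n]) \<in> carrier_mat (\<Sum>k<n. r k) (\<Sum>k<n. c k)"
  using assms
proof (induction n)
  case (Suc n)
  then have "diag_block_mat (map B [0..<n]) \<in> carrier_mat (\<Sum>k<n. r k) (\<Sum>k<n. c k)"
    "B n \<in> carrier_mat (r n) (c n)" by auto
  then show ?case by (simp add: diag_block_mat_last Let_def)
qed simp

lemma slice_diag_block_mat:
  fixes B :: "nat \<Rightarrow> real mat"
  assumes "\<And>k. k < n \<Longrightarrow> B k \<in> carrier_mat (r k) (c k)"
    and "v \<in> carrier_vec (\<Sum>k<n. c k)" and "i < n"
  shows "slice r i (diag_block_mat (map B [0..<n]) *\<^sub>v v) = B i *\<^sub>v slice c i v"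
  using assms
proof (induction n arbitrary: v)
  case (Suc n)
  let ?D = "diag_block_mat (map B [0..<n])"
  have D: "?D \<in> carrier_mat (\<Sum>k<n. r k) (\<Sum>k<n. c k)"
    using Suc.prems(1) by (intro diag_block_mat_carrier) auto
  have Bn: "B n \<in> carrier_mat (r n) (c n)" using Suc.prems(1) by simp
  define v1 where "v1 = vec_first v (\<Sum>k<n. c k)"
  define v2 where "v2 = vec_last v (c n)"
  have v1: "v1 \<in> carrier_vec (\<Sum>k<n. c k)" and v2: "v2 \<in> carrier_vec (c n)"
    unfolding v1_def v2_def by auto
  have v: "v = v1 @\<^sub>v v2"
    unfolding v1_def v2_def using Suc.prems(2) by (intro vec_first_last_append[symmetric]) simp
  have z: "0\<^sub>m (\<Sum>k<n. r k) (c n) *\<^sub>v v2 = 0\<^sub>v (\<Sum>k<n. r k)" "0\<^sub>m (r n) (\<Sum>k<n. c k) *\<^sub>v v1 = 0\<^sub>v (r n)"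
    using v1 v2 by auto
  have Dv: "?D *\<^sub>v v1 \<in> carrier_vec (\<Sum>k<n. r k)" and Bv: "B n *\<^sub>v v2 \<in> carrier_vec (r n)"
    using D Bn v1 v2 by auto
  have "diag_block_mat (map B [0..<Suc n]) *\<^sub>v v = (?D *\<^sub>v v1) @\<^sub>v (B n *\<^sub>v v2)"
    using four_block_mat_mult_vec[OF D zero_carrier_mat zero_carrier_mat Bn v1 v2] z D Bn Dv Bv
    unfolding v by (simp add: diag_block_mat_last Let_def)
  then show ?case
    using Suc.IH[of v1] Suc.prems(1,3) v1 v2 slice_append_left[OF Dv] slice_append_right[OF Dv Bv]
      slice_append_left[OF v1] slice_append_right[OF v1 v2]
    unfolding v by (auto simp: less_Suc_eq)
qed simp


section \<open>Uniform linear independence\<close>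

text \<open>Pairing the eigenvector equation with the conjugate of \<open>v\<close> gives
  \<open>a \<parallel>v\<parallel>^2 = \<parallel>S v\<parallel>^2\<close>. The characteristic
  polynomial will be factored over the complex numbers, while \<open>singular_values\<close> speaks
  of real eigenvalues; this closes the gap.\<close>

lemma eigenvalue_gram_nonneg:
  fixes S :: "real mat"
  assumes S: "S \<in> carrier_mat m q" and a: "eigenvalue (map_mat complex_of_real (S\<^sup>T * S)) a"
  shows "a \<in> \<real> \<and> 0 \<le> Re a"
proof -
  let ?S = "map_mat complex_of_real S"
  have cS: "?S \<in> carrier_mat m q" and cT: "?S\<^sup>T \<in> carrier_mat q m" using S by auto
  have ST: "S\<^sup>T \<in> carrier_mat q m" using S by simp
  have "map_mat complex_of_real (S\<^sup>T) = ?S\<^sup>T" by (intro eq_matI) auto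
  then have G: "map_mat complex_of_real (S\<^sup>T * S) = ?S\<^sup>T * ?S"
    by (simp add: of_real_hom.mat_hom_mult[OF ST S])
  have cG: "?S\<^sup>T * ?S \<in> carrier_mat q q" by (rule mult_carrier_mat[OF cT cS])
  obtain v where v: "v \<in> carrier_vec q" "v \<noteq> 0\<^sub>v q" "(?S\<^sup>T * ?S) *\<^sub>v v = a \<cdot>\<^sub>v v"
    using a cG unfolding G eigenvalue_def eigenvector_def by auto
  have cv: "conjugate v \<in> carrier_vec q" and Sv: "?S *\<^sub>v v \<in> carrier_vec m"
    using v cS by auto
  have conj: "?S *\<^sub>v conjugate v = conjugate (?S *\<^sub>v v)"
    using S v(1) by (intro eq_vecI) (auto simp: scalar_prod_def sum_conjugate conjugate_dist_mul)
  have "a * (v \<bullet>c v) = (?S\<^sup>T *\<^sub>v (?S *\<^sub>v v)) \<bullet>c v"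
    using v(1,3) cv assoc_mult_mat_vec[OF cT cS v(1)] by simp
  also have "\<dots> = (?S *\<^sub>v v) \<bullet>c (?S *\<^sub>v v)"
    using transpose_vec_mult_scalar[OF cS cv Sv] conj by simp
  finally have eq: "a * (v \<bullet>c v) = (?S *\<^sub>v v) \<bullet>c (?S *\<^sub>v v)" .
  have "0 < v \<bullet>c v" and "0 \<le> (?S *\<^sub>v v) \<bullet>c (?S *\<^sub>v v)"
    using v(1,2) by auto
  then have "v \<bullet>c v = of_real (Re (v \<bullet>c v))" "0 < Re (v \<bullet>c v)"
    "(?S *\<^sub>v v) \<bullet>c (?S *\<^sub>v v) = of_real (Re ((?S *\<^sub>v v) \<bullet>c (?S *\<^sub>v v)))" "0 \<le> Re ((?S *\<^sub>v v) \<bullet>c (?S *\<^sub>v v))"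
    by (auto simp: less_complex_def less_eq_complex_def complex_eq_iff)
  then obtain x y :: real where xy: "v \<bullet>c v = of_real x" "0 < x"
    "(?S *\<^sub>v v) \<bullet>c (?S *\<^sub>v v) = of_real y" "0 \<le> y" by blast
  then have "a = of_real (y / x)" using eq by (simp add: field_simps)
  then show ?thesis using xy by simp
qed

text \<open>The square of \<open>det S\<close> is the product of the \<open>q\<close> eigenvalues of
  the Gram matrix, each at least \<open>c^2\<close>.\<close>

lemma det_gram_ge:
  fixes S :: "real mat"
  assumes S: "S \<in> carrier_mat q q" and c: "0 < c" and sv: "\<And>s. s \<in> singular_values S \<Longrightarrow> c \<le> s"
  shows "c ^ q \<le> \<bar>Determinant.det S\<bar>"
proof -
  let ?G = "S\<^sup>T * S"
  let ?C = "map_mat complex_of_real ?G"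
  have G: "?G \<in> carrier_mat q q" using S by auto
  then have C: "?C \<in> carrier_mat q q" by simp
  obtain as where as: "char_poly ?C = (\<Prod>a\<leftarrow>as. [:- a, 1:])" "length as = q"
    using char_poly_factorized[OF C] by blast
  have norm_as: "c^2 \<le> norm a" if a: "a \<in> set as" for a
  proof -
    have "poly (char_poly ?C) a = 0"
      unfolding as(1) poly_prod_list prod_list_zero_iff using a by auto
    then have ev: "eigenvalue ?C a" using eigenvalue_root_char_poly[OF C] by simp
    then have "a \<in> \<real>" "0 \<le> Re a" using eigenvalue_gram_nonneg[OF S] by auto
    then obtain t where t: "a = of_real t" "0 \<le> t" by (auto elim!: Reals_cases)
    \<comment> \<open>The complex characteristic matrix is the image of a real one, so the real
      determinant vanishes too and \<open>t\<close> is an eigenvalue over the reals.\<close>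
    have "map_mat complex_of_real (char_matrix ?G t) = char_matrix ?C a"
      unfolding char_matrix_def t using G by (intro eq_matI) auto
    then have "complex_of_real (Determinant.det (char_matrix ?G t)) = 0"
      using ev unfolding eigenvalue_det[OF C] by (simp flip: of_real_hom.hom_det)
    then have "eigenvalue ?G t" unfolding eigenvalue_det[OF G] by simp
    then have "sqrt t \<in> singular_values S" unfolding singular_values_def using t by simp
    then have "c^2 \<le> (sqrt t)^2" using sv c by (intro power_mono) auto
    then show ?thesis using t by simp
  qed
  \<comment> \<open>Up to sign, the constant term of the characteristic polynomial is both the
    determinant and the product of the roots.\<close>
  have "poly (char_poly ?C) 0 = Determinant.det (- char_matrix ?C 0)"
    by (rule char_poly_matrix[OF C])
  also have "- char_matrix ?C 0 = (-1) \<cdot>\<^sub>m ?C"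
    unfolding char_matrix_def using C by (intro eq_matI) auto
  finally have "norm (poly (char_poly ?C) 0) = norm (Determinant.det ?C)"
    by (simp add: norm_mult norm_power)
  also have "Determinant.det ?G = (Determinant.det S)^2"
    using Determinant.det_mult[of "S\<^sup>T" q S] S Determinant.det_transpose[OF S] by (simp add: power2_eq_square)
  then have "norm (Determinant.det ?C) = \<bar>Determinant.det S\<bar>^2"
    by (simp add: norm_power)
  also have "norm (poly (char_poly ?C) 0) = prod_list (map norm as)"
    unfolding as(1) by (induction as) (auto simp: norm_mult)
  finally have "prod_list (map norm as) = \<bar>Determinant.det S\<bar>^2" .
  moreover have "(c^2) ^ length as \<le> prod_list (map norm as)"
    using norm_as
  proof (induction as)
    case (Cons a as)
    then show ?case by (auto intro!: mult_mono)
  qed simp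
  ultimately have "(c ^ q)^2 \<le> \<bar>Determinant.det S\<bar>^2"
    by (simp add: as(2) power_mult[symmetric] mult.commute)
  then show ?thesis by (rule power2_le_imp_le) simp
qed

text \<open>The Leibniz formula has \<open>n!\<close> terms, each of modulus at most 1. It will
  bound the entries of an adjugate.\<close>

lemma abs_det_le_fact:
  fixes M :: "real mat"
  assumes M: "M \<in> carrier_mat n n" and le: "\<And>i j. i < n \<Longrightarrow> j < n \<Longrightarrow> \<bar>M $$ (i, j)\<bar> \<le> 1"
  shows "\<bar>Determinant.det M\<bar> \<le> fact n"
proof -
  have "\<bar>signof p * (\<Prod>i = 0..<n. M $$ (i, p i))\<bar> \<le> 1" if "p permutes {0..<n}" for p
  proof -
    have "p i < n" if "i < n" for i
      using permutes_in_image[OF \<open>p permutes {0..<n}\<close>, of i] that by simp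
    then have "(\<Prod>i = 0..<n. \<bar>M $$ (i, p i)\<bar>) \<le> 1" by (intro prod_le_1) (auto intro: le)
    then show ?thesis by (simp add: abs_mult abs_prod sign_def)
  qed
  then have "\<bar>Determinant.det M\<bar> \<le> (\<Sum>p \<in> {p. p permutes {0..<n}}. 1)"
    unfolding det_def'[OF M] by (intro order.trans[OF sum_abs] sum_mono) auto
  also have "\<dots> = fact n" by (simp add: card_permutations)
  finally show ?thesis .
qed

text \<open>From \<open>S adj S = det S\<close> follows \<open>det S N = (N S) adj S\<close>: on the
  right a small factor and a bounded one, on the left a determinant bounded away from zero.
  \<open>S\<close> may depend on \<open>e\<close>, since only these uniform bounds enter.\<close>

lemma mat_eq_0_if_small_on_uniform_bases:
  fixes N :: "real mat"
  assumes N: "N \<in> carrier_mat m q" and c: "0 < c"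
    and bases: "\<And>e. 0 < e \<Longrightarrow> \<exists>S \<in> carrier_mat q q. c \<le> \<bar>Determinant.det S\<bar> \<and>
      (\<forall>i<q. \<forall>j<q. \<bar>S $$ (i, j)\<bar> \<le> 1) \<and> (\<forall>j<q. vnorm (N *\<^sub>v col S j) \<le> e)"
  shows "N = 0\<^sub>m m q"
proof (rule ccontr)
  assume "N \<noteq> 0\<^sub>m m q"
  then obtain i j where ij: "i < m" "j < q" "N $$ (i, j) \<noteq> 0"
    using N by (metis carrier_matD eq_matI index_zero_mat)
  \<comment> \<open>An entry of \<open>(N S) adj S\<close> is a sum of \<open>q\<close> products
    whose adjugate factor is at most \<open>(q - 1)!\<close>. The choice of \<open>e\<close> makes
    that sum at most half of \<open>c\<close> times the nonzero entry of \<open>N\<close>.\<close>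
  let ?b = "real q * fact (q - 1)"
  have b: "0 < ?b" using ij by simp
  define e where "e = c * \<bar>N $$ (i, j)\<bar> / (2 * ?b)"
  have e: "0 < e" unfolding e_def using c ij b by simp
  obtain S where S: "S \<in> carrier_mat q q" "c \<le> \<bar>Determinant.det S\<bar>"
    "\<And>i j. i < q \<Longrightarrow> j < q \<Longrightarrow> \<bar>S $$ (i, j)\<bar> \<le> 1" "\<And>j. j < q \<Longrightarrow> vnorm (N *\<^sub>v col S j) \<le> e"
    using bases[OF e] by blast
  have NS: "N * S \<in> carrier_mat m q" using N S by auto
  have adj: "adj_mat S \<in> carrier_mat q q" "S * adj_mat S = Determinant.det S \<cdot>\<^sub>m 1\<^sub>m q"
    using adj_mat[OF S(1)] by auto
  have adj_le: "\<bar>adj_mat S $$ (k, l)\<bar> \<le> fact (q - 1)" if "k < q" "l < q" for k l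
  proof -
    have md: "mat_delete S l k \<in> carrier_mat (q - 1) (q - 1)"
      by (rule mat_delete_carrier[OF S(1)])
    have "\<bar>mat_delete S l k $$ (a, b)\<bar> \<le> 1" if "a < q - 1" "b < q - 1" for a b
      using that S(1) \<open>k < q\<close> \<open>l < q\<close> unfolding mat_delete_def by (auto intro: S(3))
    then have "\<bar>Determinant.det (mat_delete S l k)\<bar> \<le> fact (q - 1)"
      by (rule abs_det_le_fact[OF md])
    then show ?thesis
      using that S(1) unfolding adj_mat_def by (simp add: cofactor_def abs_mult)
  qed
  have NS_le: "\<bar>(N * S) $$ (i, k)\<bar> \<le> e" if k: "k < q" for k
  proof -
    have "(N * S) $$ (i, k) = (N *\<^sub>v col S k) $ i" using N S(1) ij k by simp
    then show ?thesis
      using abs_index_le_vnorm[of i "N *\<^sub>v col S k"] S(4)[OF k] N ij by simp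
  qed
  have entry: "(X * Y) $$ (i, j) = (\<Sum>k = 0..<q. X $$ (i, k) * Y $$ (k, j))"
    if "X \<in> carrier_mat m q" "Y \<in> carrier_mat q q" "i < m" "j < q" for X Y :: "real mat" and i j
    using that by (simp add: scalar_prod_def)
  have "N * S * adj_mat S = N * (Determinant.det S \<cdot>\<^sub>m 1\<^sub>m q)"
    using assoc_mult_mat[OF N S(1) adj(1)] adj(2) by simp
  also have "\<dots> = Determinant.det S \<cdot>\<^sub>m N"
    using N by (simp add: mult_smult_distrib[OF N one_carrier_mat])
  finally have "Determinant.det S * N $$ (i, j) = (N * S * adj_mat S) $$ (i, j)"
    using N ij by simp
  also have "\<dots> = (\<Sum>k = 0..<q. (N * S) $$ (i, k) * adj_mat S $$ (k, j))"
    by (rule entry[OF NS adj(1) ij(1,2)])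
  finally have "\<bar>Determinant.det S\<bar> * \<bar>N $$ (i, j)\<bar> \<le> (\<Sum>k = 0..<q. \<bar>(N * S) $$ (i, k) * adj_mat S $$ (k, j)\<bar>)"
    by (metis abs_mult sum_abs)
  also have "\<dots> \<le> (\<Sum>k = 0..<q. e * fact (q - 1))"
    using NS_le adj_le ij e unfolding abs_mult by (intro sum_mono mult_mono) auto
  also have "\<dots> = e * ?b" by simp
  also have "\<dots> = c * \<bar>N $$ (i, j)\<bar> / 2" unfolding e_def using ij(2) by simp
  finally have "\<bar>Determinant.det S\<bar> * \<bar>N $$ (i, j)\<bar> \<le> c * \<bar>N $$ (i, j)\<bar> / 2" .
  moreover have "c * \<bar>N $$ (i, j)\<bar> \<le> \<bar>Determinant.det S\<bar> * \<bar>N $$ (i, j)\<bar>"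
    using S(2) by (intro mult_right_mono) auto
  moreover have "0 < c * \<bar>N $$ (i, j)\<bar>" using c ij by simp
  ultimately show False by linarith
qed


section \<open>The secant condition of a TR1 update\<close>

lemma outer_mult_vec:
  assumes "s \<in> carrier_vec (dim_vec v)"
  shows "outer u v *\<^sub>v s = (v \<bullet> s) \<cdot>\<^sub>v u"
  using assms unfolding outer_def
  by (intro eq_vecI) (auto simp: scalar_prod_def sum_distrib_right sum_distrib_left mult_ac intro!: sum.cong)

lemma smult_mat_mult_vec:
  assumes "M \<in> carrier_mat m n" "v \<in> carrier_vec n"
  shows "(a \<cdot>\<^sub>m M) *\<^sub>v v = a \<cdot>\<^sub>v (M *\<^sub>v v)"
  using assms by (intro eq_vecI) (auto simp: scalar_prod_def sum_distrib_left mult_ac)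

text \<open>A forward update satisfies the secant condition exactly; for an adjoint one the error is
  \<open>r\<close> times \<open>\<sigma> \<bullet> (D s - y) / (\<sigma> \<bullet> r)\<close>, and the two skipping criteria together keep
  \<open>\<sigma> \<bullet> r\<close> above \<open>c\<^sup>2 \<parallel>\<sigma>\<parallel> \<parallel>r\<parallel>\<close>.\<close>

lemma tr1_secant_error:
  fixes A D :: "real mat"
  assumes A: "A \<in> carrier_mat m n" and D: "D \<in> carrier_mat m n"
    and s: "s \<in> carrier_vec n" and y: "y \<in> carrier_vec m" and sg: "sg \<in> carrier_vec m"
    and r: "r = y - A *\<^sub>v s" and rho: "rho = D\<^sup>T *\<^sub>v sg - A\<^sup>T *\<^sub>v sg"
    and c: "0 < c"
    and skip_fwd: "c * vnorm sg * vnorm r \<le> \<bar>rho \<bullet> s\<bar>"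
    and skip_adj: "c * vnorm s * vnorm rho \<le> \<bar>sg \<bullet> r\<bar>"
    and al: "rho \<bullet> s \<noteq> 0 \<and> al = 1 / (rho \<bullet> s) \<or> sg \<bullet> r \<noteq> 0 \<and> al = 1 / (sg \<bullet> r)"
  shows "vnorm ((A + al \<cdot>\<^sub>m outer r rho) *\<^sub>v s - y) \<le> vnorm (D *\<^sub>v s - y) / c^2"
proof -
  have As: "A *\<^sub>v s \<in> carrier_vec m" and Ds: "D *\<^sub>v s \<in> carrier_vec m" using A D s by auto
  have cr: "r \<in> carrier_vec m" unfolding r using y As by auto
  have At: "A\<^sup>T *\<^sub>v sg \<in> carrier_vec n" and Dt: "D\<^sup>T *\<^sub>v sg \<in> carrier_vec n" using A D sg by auto
  have crho: "rho \<in> carrier_vec n" unfolding rho using At Dt by auto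
  have "outer r rho \<in> carrier_mat m n" using cr crho unfolding outer_def by auto
  then have "(A + al \<cdot>\<^sub>m outer r rho) *\<^sub>v s = A *\<^sub>v s + (al * (rho \<bullet> s)) \<cdot>\<^sub>v r"
    using A s cr crho
    by (simp add: add_mult_distrib_mat_vec[of A m n] smult_mat_mult_vec[of _ m n] outer_mult_vec smult_smult_assoc)
  moreover have "a + t \<cdot>\<^sub>v (b - a) - b = (t - 1) \<cdot>\<^sub>v (b - a)"
    if "a \<in> carrier_vec m" "b \<in> carrier_vec m" for a b :: "real vec" and t
    using that by (auto simp: algebra_simps)
  ultimately have err: "(A + al \<cdot>\<^sub>m outer r rho) *\<^sub>v s - y = (al * (rho \<bullet> s) - 1) \<cdot>\<^sub>v r"
    using As y unfolding r by simp
  have c2: "0 < c^2" using c by simp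
  show ?thesis
  proof (cases "rho \<bullet> s \<noteq> 0 \<and> al = 1 / (rho \<bullet> s)")
    case True
    then show ?thesis unfolding err using c2 by simp
  next
    case False
    with al have nz: "sg \<bullet> r \<noteq> 0" and al: "al = 1 / (sg \<bullet> r)" by auto
    \<comment> \<open>In the difference of the two denominators the terms with \<open>A\<close>
      cancel; what remains is the secant defect of the true derivative \<open>D\<close>.\<close>
    have "rho \<bullet> s = sg \<bullet> (D *\<^sub>v s) - sg \<bullet> (A *\<^sub>v s)"
      unfolding rho using transpose_vec_mult_scalar[OF D s sg] transpose_vec_mult_scalar[OF A s sg]
        minus_scalar_prod_distrib[OF Dt At s] by simp
    moreover have "sg \<bullet> r = sg \<bullet> y - sg \<bullet> (A *\<^sub>v s)"
      unfolding r by (rule scalar_prod_minus_distrib[OF sg y As])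
    ultimately have "rho \<bullet> s - sg \<bullet> r = sg \<bullet> (D *\<^sub>v s - y)"
      using scalar_prod_minus_distrib[OF sg Ds y] by simp
    then have "al * (rho \<bullet> s) - 1 = (sg \<bullet> (D *\<^sub>v s - y)) / (sg \<bullet> r)"
      unfolding al using nz by (simp add: field_simps)
    then have norm: "vnorm ((A + al \<cdot>\<^sub>m outer r rho) *\<^sub>v s - y)
        = \<bar>sg \<bullet> (D *\<^sub>v s - y)\<bar> * vnorm r / \<bar>sg \<bullet> r\<bar>"
      unfolding err by (simp add: abs_divide)
    have num: "\<bar>sg \<bullet> (D *\<^sub>v s - y)\<bar> \<le> vnorm sg * vnorm (D *\<^sub>v s - y)"
      using sg Ds y by (intro scalar_prod_le_vnorm[of _ m]) auto
    \<comment> \<open>Cauchy-Schwarz for \<open>rho \<bullet> s\<close> links the forward criterion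
      to the adjoint one; each contributes a factor \<open>c\<close>.\<close>
    have "c^2 * (vnorm sg * vnorm r) = c * (c * vnorm sg * vnorm r)"
      by (simp add: power2_eq_square mult_ac)
    also have "\<dots> \<le> c * \<bar>rho \<bullet> s\<bar>" using skip_fwd c by simp
    also have "\<dots> \<le> c * (vnorm rho * vnorm s)"
      using scalar_prod_le_vnorm[OF crho s] c by simp
    also have "\<dots> \<le> \<bar>sg \<bullet> r\<bar>" using skip_adj by (simp add: mult_ac)
    finally have den: "c^2 * (vnorm sg * vnorm r) \<le> \<bar>sg \<bullet> r\<bar>" .
    have "\<bar>sg \<bullet> (D *\<^sub>v s - y)\<bar> * vnorm r * c^2
        \<le> vnorm sg * vnorm (D *\<^sub>v s - y) * vnorm r * c^2"
      using num by (intro mult_right_mono) auto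
    also have "\<dots> = c^2 * (vnorm sg * vnorm r) * vnorm (D *\<^sub>v s - y)" by (simp add: mult_ac)
    also have "\<dots> \<le> \<bar>sg \<bullet> r\<bar> * vnorm (D *\<^sub>v s - y)"
      using den by (intro mult_right_mono) auto
    finally show ?thesis
      unfolding norm using nz c2 by (simp add: field_simps)
  qed
qed

section \<open>Stages of the optimal control problem\<close>

abbreviation stage_sel :: "ocp \<Rightarrow> nat \<Rightarrow> real mat" where
  "stage_sel Q i \<equiv> block_sel (wdim Q) (Suc (horizon Q)) i"

text \<open>Block \<open>i\<close> of the dynamics and of the multipliers has the size of the
  successor state, hence \<open>Suc i\<close>; there are \<open>horizon Q\<close> such blocks but
  one more stage.\<close>

abbreviation mult_sel :: "ocp \<Rightarrow> nat \<Rightarrow> real mat" where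
  "mult_sel Q i \<equiv> block_sel (\<lambda>i. xdim Q (Suc i)) (horizon Q) i"

lemma stage_eq_slice: "stage Q i = slice (wdim Q) i"
  unfolding stage_def slice_def by simp

lemma mult_stage_eq_slice: "mult_stage Q i = slice (\<lambda>i. xdim Q (Suc i)) i"
  unfolding mult_stage_def slice_def by simp

lemma dimW_eq: "dimW Q = (\<Sum>k<Suc (horizon Q). wdim Q k)"
  unfolding dimW_def by (simp add: lessThan_Suc_atMost)

lemma stage_sel_carrier: "stage_sel Q i \<in> carrier_mat (wdim Q i) (dimW Q)"
  unfolding dimW_eq by (rule block_sel_carrier)

lemma mult_sel_carrier: "mult_sel Q i \<in> carrier_mat (xdim Q (Suc i)) (dimL Q)"
  unfolding dimL_def by (rule block_sel_carrier)

lemma stage_sel_transpose_carrier: "(stage_sel Q i)\<^sup>T \<in> carrier_mat (dimW Q) (wdim Q i)"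
  by (rule transpose_carrier_mat[THEN iffD2, OF stage_sel_carrier])

lemma stage_carrier: "stage Q i v \<in> carrier_vec (wdim Q i)"
  unfolding stage_def by simp

lemma mult_stage_carrier: "mult_stage Q i v \<in> carrier_vec (xdim Q (Suc i))"
  unfolding mult_stage_def by simp

lemma stage_eq_sel:
  assumes "i \<le> horizon Q" "v \<in> carrier_vec (dimW Q)"
  shows "stage Q i v = stage_sel Q i *\<^sub>v v"
  unfolding stage_eq_slice using assms by (intro slice_eq_block_sel) (auto simp: dimW_eq)

lemma mult_stage_eq_sel:
  assumes "i < horizon Q" "v \<in> carrier_vec (dimL Q)"
  shows "mult_stage Q i v = mult_sel Q i *\<^sub>v v"
  unfolding mult_stage_eq_slice using assms by (intro slice_eq_block_sel) (auto simp: dimL_def)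

lemma stage_embed:
  assumes "i \<le> horizon Q" "u \<in> carrier_vec (wdim Q i)"
  shows "stage Q i ((stage_sel Q i)\<^sup>T *\<^sub>v u) = u"
  unfolding stage_eq_slice
  using slice_transpose_block_sel[of i "Suc (horizon Q)" i u "wdim Q"] assms by simp

lemma vnorm_embed:
  assumes "i \<le> horizon Q" "u \<in> carrier_vec (wdim Q i)"
  shows "vnorm ((stage_sel Q i)\<^sup>T *\<^sub>v u) = vnorm u"
  using assms by (intro vnorm_transpose_block_sel) auto

lemma stage_diff:
  assumes "i \<le> horizon Q" "u \<in> carrier_vec (dimW Q)" "v \<in> carrier_vec (dimW Q)"
  shows "stage Q i (u - v) = stage Q i u - stage Q i v"
  using assms by (simp add: stage_eq_sel mult_minus_distrib_mat_vec[OF stage_sel_carrier])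

lemma mult_stage_eqI:
  assumes "\<And>i. i < horizon Q \<Longrightarrow> mult_stage Q i u = mult_stage Q i v"
    and "u \<in> carrier_vec (dimL Q)" "v \<in> carrier_vec (dimL Q)"
  shows "u = v"
  using assms unfolding mult_stage_eq_slice dimL_def by (rule slice_eqI)

lemma
  assumes "well_formed Q"
  shows Fmap_carrier: "Fmap Q w \<in> carrier_vec (dimL Q)"
    and mult_stage_Fmap: "i < horizon Q \<Longrightarrow> mult_stage Q i (Fmap Q w) = dynamics Q i (stage Q i w)"
proof -
  have c: "dynamics Q k (stage Q k w) \<in> carrier_vec (xdim Q (Suc k))" if "k < horizon Q" for k
    using assms that stage_carrier[of Q k w] unfolding well_formed_def by auto
  show "Fmap Q w \<in> carrier_vec (dimL Q)"
    unfolding Fmap_def dimL_def by (rule vec_concat_carrier) (rule c)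
  show "mult_stage Q i (Fmap Q w) = dynamics Q i (stage Q i w)" if "i < horizon Q"
    unfolding Fmap_def mult_stage_eq_slice by (rule slice_vec_concat) (use c that in auto)
qed

text \<open>Serves \<open>assemble_jac\<close>: the final stage has no dynamics, so its columns
  vanish.\<close>

lemma append_cols_zero_mult_vec:
  assumes B: "B \<in> carrier_mat m n" and a: "a \<in> carrier_vec n" and b: "b \<in> carrier_vec k"
  shows "append_cols B (0\<^sub>m m k) *\<^sub>v (a @\<^sub>v b) = B *\<^sub>v a"
proof -
  have Ba: "B *\<^sub>v a \<in> carrier_vec m" using B a by auto
  have "append_cols B (0\<^sub>m m k) *\<^sub>v (a @\<^sub>v b)
      = (B *\<^sub>v a + 0\<^sub>m m k *\<^sub>v b) @\<^sub>v (0\<^sub>m 0 n *\<^sub>v a + 0\<^sub>m 0 k *\<^sub>v b)"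
    unfolding append_cols_def using B a b by (subst four_block_mat_mult_vec[of _ m n _ k _ 0]) auto
  also have "0\<^sub>m m k *\<^sub>v b = 0\<^sub>v m"
    using b by auto
  also have "(B *\<^sub>v a + 0\<^sub>v m) @\<^sub>v (0\<^sub>m 0 n *\<^sub>v a + 0\<^sub>m 0 k *\<^sub>v b) = B *\<^sub>v a"
    using Ba by (intro eq_vecI) (auto simp del: index_mult_mat_vec)
  finally show ?thesis .
qed

lemma
  assumes B: "\<And>i. i < horizon Q \<Longrightarrow> B i \<in> carrier_mat (xdim Q (Suc i)) (wdim Q i)"
  shows assemble_jac_carrier: "assemble_jac Q B \<in> carrier_mat (dimL Q) (dimW Q)"
    and mult_stage_assemble_jac: "i < horizon Q \<Longrightarrow> v \<in> carrier_vec (dimW Q) \<Longrightarrow>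
      mult_stage Q i (assemble_jac Q B *\<^sub>v v) = B i *\<^sub>v stage Q i v"
proof -
  let ?N = "horizon Q"
  let ?D = "diag_block_mat (map B [0..<?N])"
  have D: "?D \<in> carrier_mat (dimL Q) (\<Sum>k<?N. wdim Q k)"
    unfolding dimL_def using B by (rule diag_block_mat_carrier)
  show "assemble_jac Q B \<in> carrier_mat (dimL Q) (dimW Q)"
    unfolding assemble_jac_def append_cols_def using D by (auto simp: dimW_eq)
  assume i: "i < ?N" and v: "v \<in> carrier_vec (dimW Q)"
  define a where "a = vec_first v (\<Sum>k<?N. wdim Q k)"
  define b where "b = vec_last v (wdim Q ?N)"
  have a: "a \<in> carrier_vec (\<Sum>k<?N. wdim Q k)" and b: "b \<in> carrier_vec (wdim Q ?N)"
    unfolding a_def b_def by auto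
  have vab: "v = a @\<^sub>v b"
    unfolding a_def b_def using v by (intro vec_first_last_append[symmetric]) (simp add: dimW_eq)
  have "mult_stage Q i (assemble_jac Q B *\<^sub>v v) = mult_stage Q i (?D *\<^sub>v a)"
    unfolding assemble_jac_def vab append_cols_zero_mult_vec[OF D a b] ..
  also have "\<dots> = B i *\<^sub>v slice (wdim Q) i a"
    unfolding mult_stage_eq_slice using B a i by (rule slice_diag_block_mat)
  also have "slice (wdim Q) i a = stage Q i v"
    unfolding stage_eq_slice vab by (rule slice_append_left[OF a i, symmetric])
  finally show "mult_stage Q i (assemble_jac Q B *\<^sub>v v) = B i *\<^sub>v stage Q i v" .
qed

section \<open>Stage-wise derivatives\<close>

text \<open>Differentiability is given for the stacked map only. The dynamics of one stage is
  recovered from it by freezing all other stages at \<open>w\<close> and selecting block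
  \<open>i\<close> of the value.\<close>

lemma stage_DF_has_jacobian:
  assumes wf: "well_formed Q" and M: "has_jacobian (dimW Q) (dimL Q) (Fmap Q) w M"
    and w: "w \<in> carrier_vec (dimW Q)" and i: "i < horizon Q"
  shows "has_jacobian (wdim Q i) (xdim Q (Suc i)) (dynamics Q i) (stage Q i w) (stage_DF Q i (stage Q i w))"
proof -
  let ?P = "(stage_sel Q i)\<^sup>T"
  let ?u = "stage Q i w"
  \<comment> \<open>\<open>b\<close> is \<open>w\<close> with block \<open>i\<close> set to zero, so
    \<open>?P *\<^sub>v v + b\<close> is \<open>w\<close> with that block replaced by
    \<open>v\<close>.\<close>
  define b where "b = w - ?P *\<^sub>v ?u"
  have P: "?P \<in> carrier_mat (dimW Q) (wdim Q i)" by (rule stage_sel_transpose_carrier)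
  have u: "?u \<in> carrier_vec (wdim Q i)" by (rule stage_carrier)
  have Pv: "?P *\<^sub>v v \<in> carrier_vec (dimW Q)" if "v \<in> carrier_vec (wdim Q i)" for v
    using mult_mat_vec_carrier[OF P that] .
  have b: "b \<in> carrier_vec (dimW Q)" unfolding b_def using Pv[OF u] w by auto
  have "x + (y - x) = y" if "x \<in> carrier_vec n" "y \<in> carrier_vec n" for x y :: "real vec" and n
    using that by auto
  from this[OF Pv[OF u] w] have "?P *\<^sub>v ?u + b = w"
    unfolding b_def .
  then have "has_jacobian (wdim Q i) (dimL Q) (\<lambda>v. Fmap Q (?P *\<^sub>v v + b)) ?u (M * ?P)"
    using has_jacobian_affine[OF _ P u b] M by simp
  then have "has_jacobian (wdim Q i) (xdim Q (Suc i)) (\<lambda>v. mult_sel Q i *\<^sub>v Fmap Q (?P *\<^sub>v v + b)) ?u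
      (mult_sel Q i * (M * ?P))"
    using Fmap_carrier[OF wf] by (intro has_jacobian_mult_left[OF _ _ mult_sel_carrier u]) auto
  moreover have "mult_sel Q i *\<^sub>v Fmap Q (?P *\<^sub>v v + b) = dynamics Q i v" if v: "v \<in> carrier_vec (wdim Q i)" for v
  proof -
    have "x + (z - y) = z - (y - x)"
      if "x \<in> carrier_vec n" "y \<in> carrier_vec n" "z \<in> carrier_vec n" for x y z :: "real vec" and n
      using that by auto
    from this[OF Pv[OF v] Pv[OF u] w]
    have "stage Q i (?P *\<^sub>v v + b) = stage Q i (w - ?P *\<^sub>v (?u - v))"
      unfolding b_def mult_minus_distrib_mat_vec[OF P u v] by simp
    also have "\<dots> = ?u - (?u - v)"
      using stage_diff[of i Q w "?P *\<^sub>v (?u - v)"] stage_embed[of i Q "?u - v"] Pv[of "?u - v"] w i u v by simp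
    also have "\<dots> = v" using u v by auto
    finally show ?thesis
      using mult_stage_Fmap[OF wf i, of "?P *\<^sub>v v + b"] mult_stage_eq_sel[OF i Fmap_carrier[OF wf]] by simp
  qed
  ultimately have "has_jacobian (wdim Q i) (xdim Q (Suc i)) (dynamics Q i) ?u (mult_sel Q i * (M * ?P))"
    by (rule has_jacobian_cong[OF _ u])
  then have "differentiable_vec (wdim Q i) (xdim Q (Suc i)) (dynamics Q i) ?u"
    unfolding differentiable_vec_def by blast
  then show ?thesis
    unfolding stage_DF_def by (rule differentiable_vec_has_jacobian)
qed

text \<open>Both sides are Jacobians at \<open>w\<close> of the map sending \<open>w\<close> to the
  dynamics of its stage \<open>i\<close>, one through the stacked map and one through the stage;
  uniqueness identifies them.\<close>

lemma mult_sel_DF: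
  assumes wf: "well_formed Q" and M: "has_jacobian (dimW Q) (dimL Q) (Fmap Q) w M"
    and w: "w \<in> carrier_vec (dimW Q)" and i: "i < horizon Q"
  shows "mult_sel Q i * M = stage_DF Q i (stage Q i w) * stage_sel Q i"
proof -
  let ?f = "\<lambda>v. mult_sel Q i *\<^sub>v Fmap Q v"
  have f: "?f v = dynamics Q i (stage Q i v)" for v
    using mult_stage_Fmap[OF wf i, of v] mult_stage_eq_sel[OF i Fmap_carrier[OF wf]] by simp
  have 1: "has_jacobian (dimW Q) (xdim Q (Suc i)) ?f w (mult_sel Q i * M)"
    using Fmap_carrier[OF wf] by (intro has_jacobian_mult_left[OF _ M mult_sel_carrier w]) auto
  have z: "stage_sel Q i *\<^sub>v v + 0\<^sub>v (wdim Q i) = stage Q i v" if "v \<in> carrier_vec (dimW Q)" for v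
    using stage_eq_sel[of i Q v] stage_carrier[of Q i v] that i by simp
  have "has_jacobian (dimW Q) (xdim Q (Suc i)) (\<lambda>v. dynamics Q i (stage_sel Q i *\<^sub>v v + 0\<^sub>v (wdim Q i))) w
      (stage_DF Q i (stage Q i w) * stage_sel Q i)"
    using stage_DF_has_jacobian[OF wf M w i]
    by (intro has_jacobian_affine[OF _ stage_sel_carrier w]) (simp_all add: z[OF w])
  then have 2: "has_jacobian (dimW Q) (xdim Q (Suc i)) ?f w (stage_DF Q i (stage Q i w) * stage_sel Q i)"
    by (rule has_jacobian_cong[OF _ w]) (simp add: z f)
  show ?thesis
    using mult_mat_vec_carrier[OF mult_sel_carrier Fmap_carrier[OF wf]]
    by (intro has_jacobian_unique[OF 1 2 w]) auto
qed

lemma mult_stage_DF: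
  assumes wf: "well_formed Q" and M: "has_jacobian (dimW Q) (dimL Q) (Fmap Q) w M"
    and w: "w \<in> carrier_vec (dimW Q)" and i: "i < horizon Q" and v: "v \<in> carrier_vec (dimW Q)"
  shows "mult_stage Q i (M *\<^sub>v v) = stage_DF Q i (stage Q i w) *\<^sub>v stage Q i v"
proof -
  have cM: "M \<in> carrier_mat (dimL Q) (dimW Q)" by (rule has_jacobian_carrier[OF M])
  have cD: "stage_DF Q i (stage Q i w) \<in> carrier_mat (xdim Q (Suc i)) (wdim Q i)"
    by (rule has_jacobian_carrier[OF stage_DF_has_jacobian[OF wf M w i]])
  have "mult_stage Q i (M *\<^sub>v v) = mult_sel Q i * M *\<^sub>v v"
    using mult_stage_eq_sel[OF i mult_mat_vec_carrier[OF cM v]] assoc_mult_mat_vec[OF mult_sel_carrier cM v] by simp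
  also have "\<dots> = stage_DF Q i (stage Q i w) *\<^sub>v (stage_sel Q i *\<^sub>v v)"
    unfolding mult_sel_DF[OF wf M w i] by (rule assoc_mult_mat_vec[OF cD stage_sel_carrier v])
  also have "stage_sel Q i *\<^sub>v v = stage Q i v"
    using stage_eq_sel[of i Q v] i v by simp
  finally show ?thesis .
qed

text \<open>Joint differentiability in \<open>(w, \<lambda>)\<close> restricts to differentiability in \<open>w\<close>, which makes the
  Hessian in \<open>w\<close> a genuine \<open>n \<times> n\<close> matrix rather than an arbitrary choice.\<close>

lemma hessian_first_carrier:
  assumes tcd: "twice_cont_differentiable (n + m) (\<lambda>z. g (vec_first z n) (vec_last z m))"
    and w: "w \<in> carrier_vec n" and lam: "lam \<in> carrier_vec m"
  shows "hessian n (\<lambda>w. g w lam) w \<in> carrier_mat n n"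
proof -
  let ?h = "\<lambda>z. g (vec_first z n) (vec_last z m)"
  let ?P = "1\<^sub>m n @\<^sub>r 0\<^sub>m m n :: real mat"
  let ?b = "0\<^sub>v n @\<^sub>v lam"
  let ?p = "\<lambda>u. ?P *\<^sub>v u + ?b"
  let ?J = "\<lambda>z. jacobian (n + m) 1 (vec_fun ?h) z"
  have P: "?P \<in> carrier_mat (n + m) n" by (intro carrier_append_rows) auto
  have b: "?b \<in> carrier_vec (n + m)" using lam by auto
  have zero_mult: "0\<^sub>m m n *\<^sub>v u = 0\<^sub>v m" if "u \<in> carrier_vec n" for u :: "real vec"
    using that by auto
  have p: "?p u = u @\<^sub>v lam" if u: "u \<in> carrier_vec n" for u
  proof -
    have "?P *\<^sub>v u = u @\<^sub>v 0\<^sub>v m"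
      using mat_mult_append[OF one_carrier_mat zero_carrier_mat u, of m] u by (simp add: zero_mult)
    then show ?thesis using u lam by (intro eq_vecI) auto
  qed
  have hp: "?h (?p u) = g u lam" if u: "u \<in> carrier_vec n" for u
  proof -
    have "vec_first (u @\<^sub>v lam) n = u" "vec_last (u @\<^sub>v lam) m = lam"
      using u lam unfolding vec_first_def vec_last_def by auto
    then show ?thesis unfolding p[OF u] by simp
  qed
  have cp: "?p u \<in> carrier_vec (n + m)" if "u \<in> carrier_vec n" for u
    unfolding p[OF that] using that lam by auto
  have J: "has_jacobian (n + m) 1 (vec_fun ?h) z (?J z)" if "z \<in> carrier_vec (n + m)" for z
    using tcd that unfolding twice_cont_differentiable_def by (auto intro: differentiable_vec_has_jacobian)
  \<comment> \<open>\<open>?p\<close> sends \<open>u\<close> to the stacked pair of \<open>u\<close>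
    and \<open>lam\<close>. The chain rule puts \<open>?P\<close> on the right of a Jacobian, hence
    its transpose in front of a gradient; differentiating once more cuts the upper left block out of
    the joint Hessian.\<close>
  have grad: "gradient n (\<lambda>w. g w lam) u = ?P\<^sup>T *\<^sub>v gradient (n + m) ?h (?p u)" if u: "u \<in> carrier_vec n" for u
  proof -
    have cJ: "?J (?p u) \<in> carrier_mat 1 (n + m)" by (rule has_jacobian_carrier[OF J[OF cp[OF u]]])
    have "has_jacobian n 1 (\<lambda>u. vec_fun ?h (?p u)) u (?J (?p u) * ?P)"
      by (rule has_jacobian_affine[OF J[OF cp[OF u]] P u b])
    then have "has_jacobian n 1 (vec_fun (\<lambda>w. g w lam)) u (?J (?p u) * ?P)"
      by (rule has_jacobian_cong[OF _ u]) (simp add: hp)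
    then have "jacobian n 1 (vec_fun (\<lambda>w. g w lam)) u = ?J (?p u) * ?P"
      by (rule jacobian_eqI[OF _ u]) simp
    then have "gradient n (\<lambda>w. g w lam) u = row (?J (?p u) * ?P) 0"
      by (simp only: gradient_def)
    also have "\<dots> = ?P\<^sup>T *\<^sub>v row (?J (?p u)) 0"
    proof -
      have "row (X * Y) 0 = Y\<^sup>T *\<^sub>v row X 0"
        if "X \<in> carrier_mat 1 (n + m)" "Y \<in> carrier_mat (n + m) n" for X Y :: "real mat"
        using that row_carrier_vec[of 0 1 X "n + m"]
        by (intro eq_vecI) (auto intro!: comm_scalar_prod[of _ "n + m"])
      from this[OF cJ P] show ?thesis .
    qed
    finally show ?thesis unfolding gradient_def .
  qed
  have cg: "gradient (n + m) ?h z \<in> carrier_vec (n + m)" if "z \<in> carrier_vec (n + m)" for z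
    unfolding gradient_def by (rule row_carrier_vec[OF _ has_jacobian_carrier[OF J[OF that]]]) simp
  have "differentiable_vec (n + m) (n + m) (gradient (n + m) ?h) (?p w)"
    using tcd cp[OF w] unfolding twice_cont_differentiable_def by blast
  then obtain H where "has_jacobian (n + m) (n + m) (gradient (n + m) ?h) (?p w) H"
    unfolding differentiable_vec_def ..
  then have 1: "has_jacobian n (n + m) (\<lambda>u. gradient (n + m) ?h (?p u)) w (H * ?P)"
    by (rule has_jacobian_affine[OF _ P w b])
  have "has_jacobian n n (\<lambda>u. ?P\<^sup>T *\<^sub>v gradient (n + m) ?h (?p u)) w (?P\<^sup>T * (H * ?P))"
  proof (rule has_jacobian_mult_left[OF _ 1 _ w])
    show "(\<lambda>u. gradient (n + m) ?h (?p u)) \<in> carrier_vec n \<rightarrow> carrier_vec (n + m)"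
      by (intro Pi_I cg cp)
    show "?P\<^sup>T \<in> carrier_mat n (n + m)"
      by (rule transpose_carrier_mat[THEN iffD2, OF P])
  qed
  then have "has_jacobian n n (gradient n (\<lambda>w. g w lam)) w (?P\<^sup>T * (H * ?P))"
    by (rule has_jacobian_cong[OF _ w]) (simp add: grad)
  then have "differentiable_vec n n (gradient n (\<lambda>w. g w lam)) w"
    unfolding differentiable_vec_def by blast
  then show ?thesis
    unfolding hessian_def by (rule has_jacobian_carrier[OF differentiable_vec_has_jacobian])
qed


section \<open>Structure of the KKT matrices\<close>

lemma mat_of_rows_carrier_dim: "mat_of_rows n rs \<in> carrier_mat (length rs) n"
  by simp

lemma stage_PA_carrier: "stage_PA Q Act i \<in> carrier_mat (dim_row (stage_PA Q Act i)) (wdim Q i)"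
proof -
  have "state_sel Q 0 \<in> carrier_mat (xdim Q 0) (wdim Q 0)" unfolding state_sel_def by simp
  then have "state_sel Q 0 @\<^sub>r mat_of_rows (wdim Q 0) rs \<in> carrier_mat (xdim Q 0 + length rs) (wdim Q 0)" for rs
    by (rule carrier_append_rows[OF _ mat_of_rows_carrier_dim])
  then have "dim_col (stage_PA Q Act i) = wdim Q i"
    unfolding stage_PA_def Let_def by (auto dest: carrier_matD)
  then show ?thesis by auto
qed

lemma PA_carrier: "PA Q Act \<in> carrier_mat (dim_row (PA Q Act)) (dimW Q)"
proof -
  have "PA Q Act \<in> carrier_mat (\<Sum>k<Suc (horizon Q). dim_row (stage_PA Q Act k)) (dimW Q)"
    unfolding PA_def dimW_eq by (rule diag_block_mat_carrier) (rule stage_PA_carrier)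
  then show ?thesis by auto
qed

lemma Emat_carrier: "Emat Q \<in> carrier_mat (dimL Q) (dimW Q)"
proof -
  let ?D = "diag_block_mat (map (state_sel Q) [1..<Suc (horizon Q)])"
  have "map (state_sel Q) [1..<Suc (horizon Q)] = map (\<lambda>k. state_sel Q (Suc k)) [0..<horizon Q]"
    by (simp add: map_Suc_upt[symmetric] del: upt_Suc)
  moreover have "diag_block_mat (map (\<lambda>k. state_sel Q (Suc k)) [0..<horizon Q])
      \<in> carrier_mat (\<Sum>k<horizon Q. xdim Q (Suc k)) (\<Sum>k<horizon Q. wdim Q (Suc k))"
    by (rule diag_block_mat_carrier) (simp add: state_sel_def)
  ultimately have "dim_col ?D = (\<Sum>k<horizon Q. wdim Q (Suc k))" by auto
  then show ?thesis
    unfolding Emat_def append_cols_def dimW_eq sum.lessThan_Suc_shift by (intro carrier_matI) simp_all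
qed

lemma gn_hess_carrier:
  assumes "well_formed Q"
  shows "gn_hess Q w \<in> carrier_mat (dimW Q) (dimW Q)"
  unfolding gn_hess_def dimW_eq
proof (rule diag_block_mat_carrier)
  fix k assume "k < Suc (horizon Q)"
  then have "differentiable_vec (wdim Q k) (resdim Q k) (residual Q k) (stage Q k w)"
    using assms stage_carrier[of Q k w] unfolding well_formed_def by auto
  from has_jacobian_carrier[OF differentiable_vec_has_jacobian[OF this]]
  show "stage_gn_hess Q k (stage Q k w) \<in> carrier_mat (wdim Q k) (wdim Q k)"
    unfolding stage_gn_hess_def Let_def by auto
qed

text \<open>Injectivity of the transpose makes the Gram matrix of the rows of \<open>P\<close>
  invertible, so \<open>P\<close> has a right inverse \<open>R\<close>. As \<open>v - R P v\<close>
  lies in the kernel of \<open>P\<close>, \<open>M\<close> agrees with \<open>M R P\<close>.\<close>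

lemma factor_through_full_row_rank:
  fixes P M :: "real mat"
  assumes P: "P \<in> carrier_mat p n" and M: "M \<in> carrier_mat m n"
    and inj: "\<And>u. u \<in> carrier_vec p \<Longrightarrow> P\<^sup>T *\<^sub>v u = 0\<^sub>v n \<Longrightarrow> u = 0\<^sub>v p"
    and ker: "\<And>v. v \<in> carrier_vec n \<Longrightarrow> P *\<^sub>v v = 0\<^sub>v p \<Longrightarrow> M *\<^sub>v v = 0\<^sub>v m"
  shows "\<exists>K \<in> carrier_mat m p. M = K * P"
proof -
  have T: "P\<^sup>T \<in> carrier_mat n p" using P by simp
  have G: "P * P\<^sup>T \<in> carrier_mat p p" using P by auto
  have "Determinant.det (P * P\<^sup>T) \<noteq> 0"
  proof
    assume "Determinant.det (P * P\<^sup>T) = 0"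
    then obtain u where u: "u \<in> carrier_vec p" "u \<noteq> 0\<^sub>v p" "P * P\<^sup>T *\<^sub>v u = 0\<^sub>v p"
      using det_0_iff_vec_prod_zero[OF G] by auto
    have Tu: "P\<^sup>T *\<^sub>v u \<in> carrier_vec n" by (rule mult_mat_vec_carrier[OF T u(1)])
    have "(P\<^sup>T *\<^sub>v u) \<bullet> (P\<^sup>T *\<^sub>v u) = u \<bullet> (P *\<^sub>v (P\<^sup>T *\<^sub>v u))"
      by (rule transpose_vec_mult_scalar[OF P Tu u(1)])
    also have "\<dots> = 0"
      using u(1,3) assoc_mult_mat_vec[OF P T u(1)] by simp
    finally have "P\<^sup>T *\<^sub>v u = 0\<^sub>v n"
      using vnorm_eq_0_iff[OF Tu] by (simp add: vnorm_def)
    with inj u show False by blast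
  qed
  then obtain B where B: "B \<in> carrier_mat p p" "P * P\<^sup>T * B = 1\<^sub>m p"
    using det_nonzero_mat_inverse[OF G] by metis
  \<comment> \<open>The Moore-Penrose inverse of a matrix of full row rank.\<close>
  define R where "R = P\<^sup>T * B"
  have R: "R \<in> carrier_mat n p" unfolding R_def by (rule mult_carrier_mat[OF T B(1)])
  have PR: "P * R = 1\<^sub>m p"
    unfolding R_def using B(2) assoc_mult_mat[OF P T B(1)] by simp
  have K: "M * R \<in> carrier_mat m p" by (rule mult_carrier_mat[OF M R])
  have "M = M * R * P"
  proof (rule eq_mat_on_vecI[OF M mult_carrier_mat[OF K P]])
    fix v :: "real vec" assume v: "v \<in> carrier_vec n"
    have Pv: "P *\<^sub>v v \<in> carrier_vec p" and RPv: "R *\<^sub>v (P *\<^sub>v v) \<in> carrier_vec n"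
      using P R v by (auto intro: mult_mat_vec_carrier)
    have "P *\<^sub>v (R *\<^sub>v (P *\<^sub>v v)) = P *\<^sub>v v"
      using assoc_mult_mat_vec[OF P R Pv] Pv unfolding PR by simp
    then have "P *\<^sub>v (v - R *\<^sub>v (P *\<^sub>v v)) = 0\<^sub>v p"
      using mult_minus_distrib_mat_vec[OF P v RPv] minus_cancel_vec[OF Pv] by simp
    moreover have "v - R *\<^sub>v (P *\<^sub>v v) \<in> carrier_vec n" using v RPv by simp
    ultimately have "M *\<^sub>v (v - R *\<^sub>v (P *\<^sub>v v)) = 0\<^sub>v m" by (rule ker[rotated])
    then have z: "M *\<^sub>v v - M *\<^sub>v (R *\<^sub>v (P *\<^sub>v v)) = 0\<^sub>v m"
      using mult_minus_distrib_mat_vec[OF M v RPv] by simp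
    have "x = y" if "x - y = 0\<^sub>v m" "x \<in> carrier_vec m" "y \<in> carrier_vec m" for x y :: "real vec"
    proof (rule eq_vecI)
      fix i assume i: "i < dim_vec y"
      have "(x - y) $ i = 0" using that i by simp
      moreover have "(x - y) $ i = x $ i - y $ i" using i by simp
      ultimately show "x $ i = y $ i" by simp
    qed (use that in simp)
    from this[OF z mult_mat_vec_carrier[OF M v] mult_mat_vec_carrier[OF M RPv]]
    have "M *\<^sub>v v = M *\<^sub>v (R *\<^sub>v (P *\<^sub>v v))" .
    also have "\<dots> = M * R *\<^sub>v (P *\<^sub>v v)" by (rule assoc_mult_mat_vec[OF M R Pv, symmetric])
    also have "\<dots> = M * R * P *\<^sub>v v" by (rule assoc_mult_mat_vec[OF K P v, symmetric])
    finally show "M *\<^sub>v v = M * R * P *\<^sub>v v" .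
  qed
  with K show ?thesis by blast
qed

section \<open>Consequences of an invertible KKT matrix\<close>

lemma invertible_mat_det_nonzero:
  fixes M :: "'a::field mat"
  assumes "M \<in> carrier_mat n n" "invertible_mat M"
  shows "Determinant.det M \<noteq> 0"
proof -
  obtain B where B: "M * B = 1\<^sub>m n" "B * M = 1\<^sub>m (dim_row B)"
    using assms unfolding invertible_mat_def inverts_mat_def by auto
  have "dim_col B = n" using arg_cong[OF B(1), of dim_col] by simp
  moreover have "dim_row B = n" using arg_cong[OF B(2), of dim_col] assms(1) by simp
  ultimately have "B \<in> carrier_mat n n" by auto
  from Determinant.det_mult[OF assms(1) this] show ?thesis unfolding B(1) by auto
qed

text \<open>If the transpose of \<open>P\<close> annihilates \<open>u\<close>, the vector with
  \<open>u\<close> in the last block and zeros elsewhere lies in the kernel of the KKT matrix,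
  whatever \<open>H\<close> and \<open>D\<close> are.\<close>

lemma kkt_lower_rows_injective:
  fixes H D P :: "real mat"
  assumes H: "H \<in> carrier_mat n n" and D: "D \<in> carrier_mat m n" and P: "P \<in> carrier_mat p n"
    and nz: "Determinant.det (four_block_mat H (D @\<^sub>r P)\<^sup>T (D @\<^sub>r P) (0\<^sub>m (m + p) (m + p))) \<noteq> 0"
    and u: "u \<in> carrier_vec p" and ker: "P\<^sup>T *\<^sub>v u = 0\<^sub>v n"
  shows "u = 0\<^sub>v p"
proof -
  let ?C = "D @\<^sub>r P"
  let ?u = "0\<^sub>v m @\<^sub>v u"
  let ?J = "four_block_mat H ?C\<^sup>T ?C (0\<^sub>m (m + p) (m + p))"
  have C: "?C \<in> carrier_mat (m + p) n" by (rule carrier_append_rows[OF D P])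
  have T: "?C\<^sup>T \<in> carrier_mat n (m + p)" by (rule transpose_carrier_mat[THEN iffD2, OF C])
  have cu: "?u \<in> carrier_vec (m + p)" using u by auto
  \<comment> \<open>That \<open>x\<close> vanishes is read off \<open>x \<bullet> x\<close>: moving
    the transpose across the scalar product leaves only the part of \<open>P\<close>, so the
    transpose of the stacked rows is never expanded.\<close>
  define x where "x = ?C\<^sup>T *\<^sub>v ?u"
  have x: "x \<in> carrier_vec n" unfolding x_def by (rule mult_mat_vec_carrier[OF T cu])
  have Dx: "D *\<^sub>v x \<in> carrier_vec m" and Px: "P *\<^sub>v x \<in> carrier_vec p"
    using D P x by (auto intro: mult_mat_vec_carrier)
  have "x \<bullet> x = ?u \<bullet> (?C *\<^sub>v x)"
    by (subst (1) x_def) (rule transpose_vec_mult_scalar[OF C x cu])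
  also have "\<dots> = 0\<^sub>v m \<bullet> (D *\<^sub>v x) + u \<bullet> (P *\<^sub>v x)"
    unfolding mat_mult_append[OF D P x] by (rule scalar_prod_append[OF zero_carrier_vec u Dx Px])
  also have "u \<bullet> (P *\<^sub>v x) = (P\<^sup>T *\<^sub>v u) \<bullet> x"
    by (rule transpose_vec_mult_scalar[OF P x u, symmetric])
  finally have "x \<bullet> x = 0" using Dx x unfolding ker by simp
  then have x0: "x = 0\<^sub>v n" using vnorm_eq_0_iff[OF x] by (simp add: vnorm_def)
  have J: "?J \<in> carrier_mat (n + (m + p)) (n + (m + p))" using H C by auto
  have zero: "X *\<^sub>v 0\<^sub>v c = 0\<^sub>v r" if "X \<in> carrier_mat r c" for X :: "real mat" and r c
    using that by auto
  have zero': "0\<^sub>m r c *\<^sub>v y = 0\<^sub>v r" if "y \<in> carrier_vec c" for y :: "real vec" and r c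
    using that by auto
  have "?J *\<^sub>v (0\<^sub>v n @\<^sub>v ?u)
      = (H *\<^sub>v 0\<^sub>v n + ?C\<^sup>T *\<^sub>v ?u) @\<^sub>v (?C *\<^sub>v 0\<^sub>v n + 0\<^sub>m (m + p) (m + p) *\<^sub>v ?u)"
    by (rule four_block_mat_mult_vec[OF H T C zero_carrier_mat zero_carrier_vec cu])
  also have "\<dots> = 0\<^sub>v (n + (m + p))"
    using x0 unfolding x_def zero[OF H] zero[OF C] zero'[OF cu] by (intro eq_vecI) auto
  finally have Jz: "?J *\<^sub>v (0\<^sub>v n @\<^sub>v ?u) = 0\<^sub>v (n + (m + p))" .
  moreover have "0\<^sub>v n @\<^sub>v ?u \<in> carrier_vec (n + (m + p))" using cu by auto
  ultimately have z: "0\<^sub>v n @\<^sub>v ?u = 0\<^sub>v (n + (m + p))"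
    using nz det_0_iff_vec_prod_zero[OF J] by blast
  show ?thesis
  proof (rule eq_vecI)
    fix i assume "i < dim_vec (0\<^sub>v p)"
    then have i: "i < p" by simp
    have "(0\<^sub>v n @\<^sub>v ?u) $ (n + (m + i)) = u $ i" using u i by simp
    then show "u $ i = 0\<^sub>v p $ i" unfolding z using i by simp
  qed (use u in simp)
qed

text \<open>The block matrix performs row operations: multiples of the rows of \<open>P\<close> are
  added to those of \<open>D\<close>.\<close>

lemma append_rows_shift_unipotent:
  fixes D P K :: "real mat"
  assumes D: "D \<in> carrier_mat m n" and P: "P \<in> carrier_mat p n" and K: "K \<in> carrier_mat m p"
  shows "(D + K * P) @\<^sub>r P = four_block_mat (1\<^sub>m m) K (0\<^sub>m p m) (1\<^sub>m p) * (D @\<^sub>r P)"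
proof -
  have KP: "K * P \<in> carrier_mat m n" by (rule mult_carrier_mat[OF K P])
  have DKP: "D + K * P \<in> carrier_mat m n" using D KP by auto
  have W: "four_block_mat (1\<^sub>m m) K (0\<^sub>m p m) (1\<^sub>m p) \<in> carrier_mat (m + p) (m + p)" by auto
  show ?thesis
  proof (rule eq_mat_on_vecI[OF carrier_append_rows[OF DKP P] mult_carrier_mat[OF W carrier_append_rows[OF D P]]])
    fix v :: "real vec" assume v: "v \<in> carrier_vec n"
    have Dv: "D *\<^sub>v v \<in> carrier_vec m" and Pv: "P *\<^sub>v v \<in> carrier_vec p"
      using D P v by (auto intro: mult_mat_vec_carrier)
    have z: "0\<^sub>m p m *\<^sub>v (D *\<^sub>v v) = 0\<^sub>v p"
      using Dv by auto
    have "((D + K * P) @\<^sub>r P) *\<^sub>v v = (D *\<^sub>v v + K *\<^sub>v (P *\<^sub>v v)) @\<^sub>v (P *\<^sub>v v)"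
      unfolding mat_mult_append[OF DKP P v] add_mult_distrib_mat_vec[OF D KP v] assoc_mult_mat_vec[OF K P v] ..
    also have "\<dots> = (1\<^sub>m m *\<^sub>v (D *\<^sub>v v) + K *\<^sub>v (P *\<^sub>v v)) @\<^sub>v (0\<^sub>m p m *\<^sub>v (D *\<^sub>v v) + 1\<^sub>m p *\<^sub>v (P *\<^sub>v v))"
      using Dv Pv by (simp add: z)
    also have "\<dots> = four_block_mat (1\<^sub>m m) K (0\<^sub>m p m) (1\<^sub>m p) *\<^sub>v ((D @\<^sub>r P) *\<^sub>v v)"
      unfolding mat_mult_append[OF D P v]
      by (rule four_block_mat_mult_vec[OF one_carrier_mat K zero_carrier_mat one_carrier_mat Dv Pv, symmetric])
    finally show "((D + K * P) @\<^sub>r P) *\<^sub>v v = four_block_mat (1\<^sub>m m) K (0\<^sub>m p m) (1\<^sub>m p) * (D @\<^sub>r P) *\<^sub>v v"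
      unfolding assoc_mult_mat_vec[OF W carrier_append_rows[OF D P] v] .
  qed
qed

text \<open>Interface between linear algebra and analysis: of the TR1 limit in the role of
  \<open>D'\<close>, only agreement with the true derivative \<open>D\<close> on the kernel of the
  active constraints and an invertible KKT matrix have to be supplied.\<close>

lemma contraction_rate_kkt_matrix:
  assumes H: "H \<in> carrier_mat (dimW Q) (dimW Q)" and L: "L \<in> carrier_mat (dimW Q) (dimW Q)"
    and D: "D \<in> carrier_mat (dimL Q) (dimW Q)" and D': "D' \<in> carrier_mat (dimL Q) (dimW Q)"
    and inv: "invertible_mat (kkt_matrix Q Act H D')"
    and ker: "\<And>v. v \<in> mat_kernel (PA Q Act) \<Longrightarrow> (D' - D) *\<^sub>v v = 0\<^sub>v (dimL Q)"
  shows "contraction_rate (kkt_matrix Q Act H D') (kkt_matrix Q Act L D)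
       = contraction_rate (kkt_matrix Q Act H D) (kkt_matrix Q Act L D)"
proof -
  let ?n = "dimW Q" and ?m = "dimL Q" and ?p = "dim_row (PA Q Act)" and ?E = "Emat Q"
  have P: "PA Q Act \<in> carrier_mat ?p ?n" by (rule PA_carrier)
  have E: "?E \<in> carrier_mat ?m ?n" by (rule Emat_carrier)
  have DE: "X - ?E \<in> carrier_mat ?m ?n" for X by (rule minus_carrier_mat[OF E])
  have kkt: "kkt_matrix Q Act G X
      = four_block_mat G ((X - ?E) @\<^sub>r PA Q Act)\<^sup>T ((X - ?E) @\<^sub>r PA Q Act) (0\<^sub>m (?m + ?p) (?m + ?p))" for G X
    using carrier_append_rows[OF DE P, of X] unfolding kkt_matrix_def Let_def by (metis carrier_matD(1))
  have "kkt_matrix Q Act H D' \<in> carrier_mat (?n + (?m + ?p)) (?n + (?m + ?p))"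
    unfolding kkt by (rule four_block_carrier_mat[OF H zero_carrier_mat])
  from invertible_mat_det_nonzero[OF this inv]
  have nz: "Determinant.det (kkt_matrix Q Act H D') \<noteq> 0" .
  have M: "D' - D \<in> carrier_mat ?m ?n" by (rule minus_carrier_mat[OF D])
  have "\<exists>K \<in> carrier_mat ?m ?p. D' - D = K * PA Q Act"
  proof (rule factor_through_full_row_rank[OF P M])
    show "u = 0\<^sub>v ?p" if "u \<in> carrier_vec ?p" "(PA Q Act)\<^sup>T *\<^sub>v u = 0\<^sub>v ?n" for u
      using kkt_lower_rows_injective[OF H DE P nz[unfolded kkt] that] .
    show "(D' - D) *\<^sub>v v = 0\<^sub>v ?m" if "v \<in> carrier_vec ?n" "PA Q Act *\<^sub>v v = 0\<^sub>v ?p" for v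
      using ker[OF mat_kernelI[OF P that]] .
  qed
  then obtain K where K: "K \<in> carrier_mat ?m ?p" "D' - D = K * PA Q Act" by blast
  have "D' - ?E = (D - ?E) + (D' - D)" using D D' E by (intro eq_matI) auto
  then have shift: "(D' - ?E) @\<^sub>r PA Q Act
      = four_block_mat (1\<^sub>m ?m) K (0\<^sub>m ?p ?m) (1\<^sub>m ?p) * ((D - ?E) @\<^sub>r PA Q Act)"
    using append_rows_shift_unipotent[OF DE P K(1), of D] K(2) by simp
  show ?thesis
    using contraction_rate_kkt_unipotent[OF H L carrier_append_rows[OF DE P] K(1) refl nz[unfolded kkt shift]]
    unfolding kkt shift .
qed


section \<open>Limits of block-wise TR1 updates\<close>

lemma DF_has_jacobian:
  assumes "lipschitz_jacobian Q c" "w \<in> carrier_vec (dimW Q)"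
  shows "has_jacobian (dimW Q) (dimL Q) (Fmap Q) w (DF Q w)"
  unfolding DF_def using assms unfolding lipschitz_jacobian_def
  by (intro differentiable_vec_has_jacobian) auto

lemma
  assumes "btr1_sqp_sequence Q w lam A"
  shows btr1_iterate_carrier: "w k \<in> carrier_vec (dimW Q)"
    and btr1_block_carrier: "i < horizon Q \<Longrightarrow> A k i \<in> carrier_mat (xdim Q (Suc i)) (wdim Q i)"
proof -
  show "w k \<in> carrier_vec (dimW Q)"
  proof (induction k)
    case 0
    then show ?case using assms unfolding btr1_sqp_sequence_def by simp
  next
    case (Suc k)
    obtain d where "qp_solution Q (w k) (lam k) (A k) d (lam (Suc k))" and w: "w (Suc k) = w k + d"
      using assms unfolding btr1_sqp_sequence_def by blast
    then have "d \<in> carrier_vec (dimW Q)" unfolding qp_solution_def qp_feasible_def by simp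
    then show ?case unfolding w using Suc by simp
  qed
  show "A k i \<in> carrier_mat (xdim Q (Suc i)) (wdim Q i)" if i: "i < horizon Q"
  proof (induction k)
    case 0
    then show ?case using assms i unfolding btr1_sqp_sequence_def by simp
  next
    case (Suc k)
    have "tr1_update Q w lam A k i"
      using assms i unfolding btr1_sqp_sequence_def by blast
    then obtain a where "A (Suc k) i = A k i + a \<cdot>\<^sub>m outer (sec_res Q w A k i) (adj_res Q w lam A k i)"
      unfolding tr1_update_def by blast
    then show ?case
      using Suc unfolding outer_def sec_res_def adj_res_def by auto
  qed
qed

text \<open>On the padded step, the difference is telescoped through the updated block
  \<open>A (Suc k) i\<close>, the secant value \<open>y\<close> and the derivative at the new
  iterate. Each of the four gaps is of smaller order than the step.\<close>

lemma btr1_block_error: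
  assumes wf: "well_formed Q" and lip: "lipschitz_jacobian Q c3"
    and sqp: "btr1_sqp_sequence Q w lam A" and c1: "0 < c1" and skip: "skipping_criteria Q w lam A c1"
    and ws: "w_star \<in> carrier_vec (dimW Q)" and wlim: "vec_tendsto w w_star"
    and Al: "A_lim \<in> carrier_mat (dimL Q) (dimW Q)"
    and Alim: "mat_tendsto (\<lambda>k. assemble_jac Q (A k)) A_lim"
    and i: "i < horizon Q" and e: "0 < e"
  shows "\<exists>K. \<forall>k\<ge>K. vnorm (mult_sel Q i *\<^sub>v ((A_lim - DF Q w_star) *\<^sub>v ((stage_sel Q i)\<^sup>T *\<^sub>v s_step Q w k i)))
      \<le> e * vnorm (s_step Q w k i)"
proof -
  let ?n = "dimW Q" and ?m = "dimL Q" and ?wi = "wdim Q i" and ?xi = "xdim Q (Suc i)"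
  let ?SL = "mult_sel Q i" and ?SW = "stage_sel Q i"
  let ?X = "\<lambda>k. assemble_jac Q (A k)"
  let ?op = "op_norm ?SL"
  let ?dw = "\<lambda>k. vnorm (w k - w_star)"
  \<comment> \<open>Per unit of step length: distance of the updated approximation from its limit;
    drift of the derivative between the new iterate and \<open>w_star\<close>; and the secant defect
    (factor \<open>1 / c1^2\<close>) plus the Taylor remainder (factor 1). The last two are
    quadratic in the step, so one factor of the step norm is bounded by distances to
    \<open>w_star\<close>.\<close>
  define \<delta> where "\<delta> k = ?op * (op_norm (?X (Suc k) - A_lim) + \<bar>c3\<bar> * ?dw (Suc k)
      + (1 / c1^2 + 1) * \<bar>c3\<bar> * (op_norm ?SW * (?dw (Suc k) + ?dw k)))" for k
  have i': "i \<le> horizon Q" using i by simp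
  note SL = mult_sel_carrier[of Q i] and SW = stage_sel_carrier[of Q i]
    and T = stage_sel_transpose_carrier[of Q i]
  have wk: "w k \<in> carrier_vec ?n" for k by (rule btr1_iterate_carrier[OF sqp])
  have Ak: "A k j \<in> carrier_mat (xdim Q (Suc j)) (wdim Q j)" if "j < horizon Q" for k j
    by (rule btr1_block_carrier[OF sqp that])
  have X: "?X k \<in> carrier_mat ?m ?n" for k by (rule assemble_jac_carrier[OF Ak])
  have jac: "has_jacobian ?n ?m (Fmap Q) v (DF Q v)" if "v \<in> carrier_vec ?n" for v
    by (rule DF_has_jacobian[OF lip that])
  have DF: "DF Q v \<in> carrier_mat ?m ?n" if "v \<in> carrier_vec ?n" for v
    by (rule has_jacobian_carrier[OF jac[OF that]])
  have op_lip: "op_norm (DF Q u - DF Q v) \<le> c3 * vnorm (u - v)"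
    if "u \<in> carrier_vec ?n" "v \<in> carrier_vec ?n" for u v
    using lip that unfolding lipschitz_jacobian_def by blast
  have SLv: "?SL *\<^sub>v v \<in> carrier_vec ?xi" if "v \<in> carrier_vec ?m" for v
    by (rule mult_mat_vec_carrier[OF SL that])
  have SL_le: "vnorm (?SL *\<^sub>v v) \<le> ?op * vnorm v" if "v \<in> carrier_vec ?m" for v
    by (rule vnorm_mult_mat_vec_le[OF SL that])
  have SL_diff: "?SL *\<^sub>v (u - v) = ?SL *\<^sub>v u - ?SL *\<^sub>v v" if "u \<in> carrier_vec ?m" "v \<in> carrier_vec ?m" for u v
    by (rule mult_minus_distrib_mat_vec[OF SL that])
  have op0: "0 \<le> ?op" by (rule op_norm_nonneg[OF SL])
  have bound: "vnorm (?SL *\<^sub>v ((A_lim - DF Q w_star) *\<^sub>v (?SW\<^sup>T *\<^sub>v s_step Q w k i))) \<le> \<delta> k * vnorm (s_step Q w k i)" for k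
  proof -
    let ?s = "s_step Q w k i" and ?w = "w (Suc k)"
    let ?x = "?SW\<^sup>T *\<^sub>v ?s"
    let ?y = "y_diff Q w k i"
    let ?D = "stage_DF Q i (stage Q i ?w)"
    have s: "?s \<in> carrier_vec ?wi" unfolding s_step_def using stage_carrier by (metis minus_carrier_vec)
    have x: "?x \<in> carrier_vec ?n" by (rule mult_mat_vec_carrier[OF T s])
    have nx: "vnorm ?x = vnorm ?s" by (rule vnorm_embed[OF i' s])
    have sx: "stage Q i ?x = ?s" by (rule stage_embed[OF i' s])
    have cD: "?D \<in> carrier_mat ?xi ?wi"
      by (rule has_jacobian_carrier[OF stage_DF_has_jacobian[OF wf jac[OF wk] wk i]])
    have Fw: "Fmap Q v \<in> carrier_vec ?m" for v by (rule Fmap_carrier[OF wf])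
    have wx: "?w - ?x \<in> carrier_vec ?n" using wk x by simp
    \<comment> \<open>\<open>?w - ?x\<close> differs from the new iterate in block \<open>i\<close>
      only, where it equals the old iterate. The remainder estimate of the stacked map then involves
      the step of this block and of no other.\<close>
    have base: "stage Q i (?w - ?x) = stage Q i (w k)"
    proof -
      have "a - (a - b) = b" if "a \<in> carrier_vec ?wi" "b \<in> carrier_vec ?wi" for a b :: "real vec"
        using that by auto
      from this[OF stage_carrier stage_carrier] show ?thesis
        unfolding stage_diff[OF i' wk x] sx unfolding s_step_def .
    qed
    have SLF: "?SL *\<^sub>v Fmap Q v = dynamics Q i (stage Q i v)" for v
      using mult_stage_Fmap[OF wf i] mult_stage_eq_sel[OF i Fw] by simp
    have y: "?y = ?SL *\<^sub>v (Fmap Q ?w - Fmap Q (?w - ?x))"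
      unfolding SL_diff[OF Fw Fw] SLF base y_diff_def ..
    have cy: "?y \<in> carrier_vec ?xi" unfolding y by (rule SLv) (simp add: Fw)
    have DFx: "DF Q v *\<^sub>v ?x \<in> carrier_vec ?m" if "v \<in> carrier_vec ?n" for v
      by (rule mult_mat_vec_carrier[OF DF[OF that] x])
    have Ds: "?D *\<^sub>v ?s = ?SL *\<^sub>v (DF Q ?w *\<^sub>v ?x)"
      using mult_stage_DF[OF wf jac[OF wk] wk i x] mult_stage_eq_sel[OF i DFx[OF wk]] unfolding sx by simp
    have "vnorm (DF Q ?w *\<^sub>v ?x - (Fmap Q ?w - Fmap Q (?w - ?x))) \<le> \<bar>c3\<bar> * (vnorm ?x)^2"
      using Fw by (intro lipschitz_jacobian_remainder[of ?n ?m "Fmap Q" "DF Q"] jac op_lip wk x) auto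
    then have "vnorm (?SL *\<^sub>v (DF Q ?w *\<^sub>v ?x - (Fmap Q ?w - Fmap Q (?w - ?x)))) \<le> ?op * (\<bar>c3\<bar> * (vnorm ?s)^2)"
      using SL_le[of "DF Q ?w *\<^sub>v ?x - (Fmap Q ?w - Fmap Q (?w - ?x))"] DFx[OF wk] Fw op0 unfolding nx
      by (intro order.trans[OF SL_le] mult_left_mono) auto
    then have rem: "vnorm (?D *\<^sub>v ?s - ?y) \<le> ?op * (\<bar>c3\<bar> * (vnorm ?s)^2)"
      unfolding y Ds using SL_diff[OF DFx[OF wk], of "Fmap Q ?w - Fmap Q (?w - ?x)"] Fw by simp
    have "tr1_update Q w lam A k i" using sqp i unfolding btr1_sqp_sequence_def by blast
    then obtain al where al: "denom_fwd Q w lam A k i \<noteq> 0 \<and> al = 1 / denom_fwd Q w lam A k i \<or>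
           denom_adj Q w lam A k i \<noteq> 0 \<and> al = 1 / denom_adj Q w lam A k i"
      and upd: "A (Suc k) i = A k i + al \<cdot>\<^sub>m outer (sec_res Q w A k i) (adj_res Q w lam A k i)"
      unfolding tr1_update_def by blast
    have sg: "sigma_step Q lam k i \<in> carrier_vec ?xi"
      unfolding sigma_step_def using mult_stage_carrier by (metis minus_carrier_vec)
    have skip_k: "c1 * vnorm (sigma_step Q lam k i) * vnorm (sec_res Q w A k i) \<le> \<bar>denom_fwd Q w lam A k i\<bar>"
      "c1 * vnorm ?s * vnorm (adj_res Q w lam A k i) \<le> \<bar>denom_adj Q w lam A k i\<bar>"
      using skip i unfolding skipping_criteria_def by auto
    have "vnorm (A (Suc k) i *\<^sub>v ?s - ?y) \<le> vnorm (?D *\<^sub>v ?s - ?y) / c1^2"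
      unfolding upd
      by (rule tr1_secant_error[OF Ak[OF i] cD s cy sg sec_res_def adj_res_def[unfolded gamma_adj_def] c1
            skip_k[unfolded denom_fwd_def denom_adj_def] al[unfolded denom_fwd_def denom_adj_def]])
    also have "\<dots> \<le> ?op * (\<bar>c3\<bar> * (vnorm ?s)^2) / c1^2"
      using rem by (intro divide_right_mono) auto
    finally have sec: "vnorm (A (Suc k) i *\<^sub>v ?s - ?y) \<le> ?op * (\<bar>c3\<bar> * (vnorm ?s)^2) / c1^2" .
    have Xx: "?X (Suc k) *\<^sub>v ?x \<in> carrier_vec ?m" by (rule mult_mat_vec_carrier[OF X x])
    have Alx: "A_lim *\<^sub>v ?x \<in> carrier_vec ?m" by (rule mult_mat_vec_carrier[OF Al x])
    have As: "A (Suc k) i *\<^sub>v ?s = ?SL *\<^sub>v (?X (Suc k) *\<^sub>v ?x)"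
      using mult_stage_assemble_jac[of Q "A (Suc k)", OF Ak i x] mult_stage_eq_sel[OF i Xx] unfolding sx by simp
    have cAs: "A (Suc k) i *\<^sub>v ?s \<in> carrier_vec ?xi" unfolding As by (rule SLv[OF Xx])
    have cDs: "?D *\<^sub>v ?s \<in> carrier_vec ?xi" unfolding Ds by (rule SLv[OF DFx[OF wk]])
    have e1: "vnorm (?SL *\<^sub>v (A_lim *\<^sub>v ?x) - A (Suc k) i *\<^sub>v ?s) \<le> ?op * (op_norm (?X (Suc k) - A_lim) * vnorm ?s)"
    proof -
      have "vnorm (?SL *\<^sub>v (A_lim *\<^sub>v ?x) - A (Suc k) i *\<^sub>v ?s) = vnorm (?SL *\<^sub>v ((?X (Suc k) - A_lim) *\<^sub>v ?x))"
        unfolding As minus_mult_distrib_mat_vec[OF X Al x] SL_diff[OF Xx Alx]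
        by (rule vnorm_minus_commute[OF SLv[OF Alx] SLv[OF Xx]])
      also have "\<dots> \<le> ?op * vnorm ((?X (Suc k) - A_lim) *\<^sub>v ?x)"
        by (rule SL_le[OF mult_mat_vec_carrier[OF minus_carrier_mat[OF Al] x]])
      also have "\<dots> \<le> ?op * (op_norm (?X (Suc k) - A_lim) * vnorm ?x)"
        by (rule mult_left_mono[OF vnorm_mult_mat_vec_le[OF minus_carrier_mat[OF Al] x] op0])
      finally show ?thesis unfolding nx .
    qed
    have e2: "vnorm (?D *\<^sub>v ?s - ?SL *\<^sub>v (DF Q w_star *\<^sub>v ?x)) \<le> ?op * (\<bar>c3\<bar> * ?dw (Suc k) * vnorm ?s)"
    proof -
      have "vnorm (?D *\<^sub>v ?s - ?SL *\<^sub>v (DF Q w_star *\<^sub>v ?x)) = vnorm (?SL *\<^sub>v ((DF Q ?w - DF Q w_star) *\<^sub>v ?x))"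
        unfolding Ds minus_mult_distrib_mat_vec[OF DF[OF wk] DF[OF ws] x] SL_diff[OF DFx[OF wk] DFx[OF ws]] ..
      also have "\<dots> \<le> ?op * vnorm ((DF Q ?w - DF Q w_star) *\<^sub>v ?x)"
        by (rule SL_le[OF mult_mat_vec_carrier[OF minus_carrier_mat[OF DF[OF ws]] x]])
      also have "\<dots> \<le> ?op * (op_norm (DF Q ?w - DF Q w_star) * vnorm ?x)"
        by (rule mult_left_mono[OF vnorm_mult_mat_vec_le[OF minus_carrier_mat[OF DF[OF ws]] x] op0])
      also have "\<dots> \<le> ?op * (\<bar>c3\<bar> * ?dw (Suc k) * vnorm ?x)"
      proof (intro mult_left_mono mult_right_mono op0)
        have "c3 * ?dw (Suc k) \<le> \<bar>c3\<bar> * ?dw (Suc k)" by (intro mult_right_mono) auto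
        then show "op_norm (DF Q ?w - DF Q w_star) \<le> \<bar>c3\<bar> * ?dw (Suc k)"
          using op_lip[OF wk ws, of "Suc k"] by linarith
      qed simp
      finally show ?thesis unfolding nx .
    qed
    have ns: "vnorm ?s \<le> op_norm ?SW * (?dw (Suc k) + ?dw k)"
    proof -
      have "?s = ?SW *\<^sub>v (w (Suc k) - w k)"
        unfolding s_step_def using stage_diff[OF i' wk wk, of "Suc k" k] stage_eq_sel[OF i', of "w (Suc k) - w k"] wk by simp
      then have "vnorm ?s \<le> op_norm ?SW * vnorm (w (Suc k) - w k)"
        using vnorm_mult_mat_vec_le[OF SW, of "w (Suc k) - w k"] wk by simp
      also have "\<dots> \<le> op_norm ?SW * (?dw (Suc k) + ?dw k)"
        using vnorm_triangle_diff[OF wk wk ws, of "Suc k" k] vnorm_minus_commute[OF ws wk, of k]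
        by (intro mult_left_mono op_norm_nonneg[OF SW]) simp
      finally show ?thesis .
    qed
    let ?a = "?SL *\<^sub>v (A_lim *\<^sub>v ?x)" and ?b = "?SL *\<^sub>v (DF Q w_star *\<^sub>v ?x)"
    have ca: "?a \<in> carrier_vec ?xi" and cb: "?b \<in> carrier_vec ?xi"
      by (rule SLv[OF Alx], rule SLv[OF DFx[OF ws]])
    have "vnorm (?SL *\<^sub>v ((A_lim - DF Q w_star) *\<^sub>v ?x)) = vnorm (?a - ?b)"
      unfolding minus_mult_distrib_mat_vec[OF Al DF[OF ws] x] SL_diff[OF Alx DFx[OF ws]] ..
    also have "\<dots> \<le> vnorm (?a - A (Suc k) i *\<^sub>v ?s) + (vnorm (A (Suc k) i *\<^sub>v ?s - ?y)
        + (vnorm (?D *\<^sub>v ?s - ?y) + vnorm (?D *\<^sub>v ?s - ?b)))"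
      using vnorm_triangle_diff[OF ca cb cAs] vnorm_triangle_diff[OF cAs cb cy]
        vnorm_triangle_diff[OF cy cb cDs] vnorm_minus_commute[OF cy cDs] by linarith
    also have "\<dots> \<le> ?op * (op_norm (?X (Suc k) - A_lim) * vnorm ?s) + (?op * (\<bar>c3\<bar> * (vnorm ?s)^2) / c1^2
        + (?op * (\<bar>c3\<bar> * (vnorm ?s)^2) + ?op * (\<bar>c3\<bar> * ?dw (Suc k) * vnorm ?s)))"
      using e1 sec rem e2 by linarith
    also have "\<dots> = ?op * (op_norm (?X (Suc k) - A_lim) + \<bar>c3\<bar> * ?dw (Suc k) + (1 / c1^2 + 1) * \<bar>c3\<bar> * vnorm ?s) * vnorm ?s"
      by (simp add: algebra_simps power2_eq_square)
    also have "\<dots> \<le> \<delta> k * vnorm ?s"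
      unfolding \<delta>_def using ns c1 op0
      by (intro mult_right_mono mult_left_mono add_left_mono) auto
    finally show ?thesis .
  qed
  have "(\<lambda>k. ?dw k) \<longlonglongrightarrow> 0" using wlim unfolding vec_tendsto_def .
  moreover from this have "(\<lambda>k. ?dw (Suc k)) \<longlonglongrightarrow> 0" by (rule LIMSEQ_Suc)
  moreover have "(\<lambda>k. op_norm (?X (Suc k) - A_lim)) \<longlonglongrightarrow> 0"
    using Alim unfolding mat_tendsto_def by (rule LIMSEQ_Suc)
  ultimately have "\<delta> \<longlonglongrightarrow> ?op * (0 + \<bar>c3\<bar> * 0 + (1 / c1^2 + 1) * \<bar>c3\<bar> * (op_norm ?SW * (0 + 0)))"
    unfolding \<delta>_def by (intro tendsto_intros)
  then have "\<forall>\<^sub>F k in sequentially. \<delta> k < e"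
    using e by (intro order_tendstoD(2)) auto
  then obtain K where K: "\<And>k. k \<ge> K \<Longrightarrow> \<delta> k < e"
    unfolding eventually_sequentially by blast
  show ?thesis
  proof (intro exI[of _ K] allI impI)
    fix k assume "K \<le> k"
    then have "\<delta> k * vnorm (s_step Q w k i) \<le> e * vnorm (s_step Q w k i)"
      using K[of k] by (intro mult_right_mono) auto
    with bound[of k] show "vnorm (?SL *\<^sub>v ((A_lim - DF Q w_star) *\<^sub>v (?SW\<^sup>T *\<^sub>v s_step Q w k i)))
        \<le> e * vnorm (s_step Q w k i)" by linarith
  qed
qed

text \<open>Dividing a late step by the norm of its coordinates in \<open>Z i\<close> exhibits
  \<open>N * Z i\<close> as small on the normalized coordinate vectors, whose matrix has a
  determinant of modulus at least \<open>c4 ^ q i\<close> in every window.\<close>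

lemma mat_vanishes_on_uniform_steps:
  assumes N: "N \<in> carrier_mat m (wdim Q i)" and Z: "Z i \<in> carrier_mat (wdim Q i) (q i)"
    and steps: "unif_lin_indep_steps Q w q Z k0 i"
    and small: "\<And>e. 0 < e \<Longrightarrow> \<exists>K. \<forall>k\<ge>K. vnorm (N *\<^sub>v s_step Q w k i) \<le> e * vnorm (s_step Q w k i)"
  shows "N * Z i = 0\<^sub>m m (q i)"
proof -
  obtain c4 l where c4: "0 < c4"
    and window: "\<forall>k\<ge>k0. \<exists>(idx :: nat \<Rightarrow> nat) (sZ :: nat \<Rightarrow> real vec).
        strict_mono_on {1..q i} idx \<and>
        (\<forall>j \<in> {1..q i}. k \<le> idx j \<and> idx j \<le> k + l \<and>
           sZ j \<in> carrier_vec (q i) \<and> s_step Q w (idx j) i = Z i *\<^sub>v sZ j) \<and>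
        (\<forall>s \<in> singular_values
           (mat_of_cols (q i) (map (\<lambda>j. (1 / vnorm (sZ j)) \<cdot>\<^sub>v sZ j) [1..<Suc (q i)])).
             c4 \<le> s)"
    using steps unfolding unif_lin_indep_steps_def by blast
  have NZ: "N * Z i \<in> carrier_mat m (q i)" by (rule mult_carrier_mat[OF N Z])
  show ?thesis
  proof (rule mat_eq_0_if_small_on_uniform_bases[OF NZ zero_less_power[OF c4, of "q i"]])
    fix e :: real assume e: "0 < e"
    have oz: "0 \<le> op_norm (Z i)" by (rule op_norm_nonneg[OF Z])
    \<comment> \<open>The operator norm of \<open>Z i\<close> converts step lengths into coordinate
      lengths; the added 1 avoids division by zero.\<close>
    define e' where "e' = e / (op_norm (Z i) + 1)"
    have e': "0 < e'" unfolding e'_def using e oz by simp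
    obtain K where K: "\<And>k. k \<ge> K \<Longrightarrow> vnorm (N *\<^sub>v s_step Q w k i) \<le> e' * vnorm (s_step Q w k i)"
      using small[OF e'] by blast
    obtain idx :: "nat \<Rightarrow> nat" and sZ :: "nat \<Rightarrow> real vec" where
      steps: "\<And>j. j \<in> {1..q i} \<Longrightarrow> max K k0 \<le> idx j \<and> sZ j \<in> carrier_vec (q i) \<and> s_step Q w (idx j) i = Z i *\<^sub>v sZ j"
      and sv: "\<And>s. s \<in> singular_values (mat_of_cols (q i) (map (\<lambda>j. (1 / vnorm (sZ j)) \<cdot>\<^sub>v sZ j) [1..<Suc (q i)])) \<Longrightarrow> c4 \<le> s"
    proof -
      \<comment> \<open>A window starting at \<open>max K k0\<close> contains only steps to which
        the smallness estimate applies.\<close>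
      have "k0 \<le> max K k0" by simp
      from window[rule_format, OF this] show thesis
        using that by (meson order.trans)
    qed
    \<comment> \<open>Steps are numbered from 1 but columns from 0, hence
      \<open>Suc j\<close>.\<close>
    let ?c = "\<lambda>j. (1 / vnorm (sZ (Suc j))) \<cdot>\<^sub>v sZ (Suc j)"
    define S where "S = mat_of_cols (q i) (map (\<lambda>j. (1 / vnorm (sZ j)) \<cdot>\<^sub>v sZ j) [1..<Suc (q i)])"
    have S: "S \<in> carrier_mat (q i) (q i)" unfolding S_def by (intro carrier_matI) (simp_all del: upt_Suc)
    have csZ: "sZ (Suc j) \<in> carrier_vec (q i)" if "j < q i" for j using steps[of "Suc j"] that by auto
    have cc: "?c j \<in> carrier_vec (q i)" if "j < q i" for j using csZ[OF that] by simp
    have colS: "col S j = ?c j" if j: "j < q i" for j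
      unfolding S_def using j csZ[OF j] by (subst col_mat_of_cols) (simp_all del: upt_Suc)
    \<comment> \<open>The bound also covers a zero coordinate vector, as
      \<open>1 / 0 = 0\<close>.\<close>
    have nc: "vnorm (?c j) \<le> 1" for j
      by (cases "vnorm (sZ (Suc j)) = 0") auto
    have "c4 ^ q i \<le> \<bar>Determinant.det S\<bar>"
      by (rule det_gram_ge[OF S c4 sv[folded S_def]])
    moreover have "\<bar>S $$ (a, b)\<bar> \<le> 1" if "a < q i" "b < q i" for a b
    proof -
      have "S $$ (a, b) = ?c b $ a" using colS[OF that(2)] S that by (metis carrier_matD index_col)
      then show ?thesis using abs_index_le_vnorm[of a "?c b"] nc[of b] cc[OF that(2)] that(1) by simp
    qed
    moreover have "vnorm (N * Z i *\<^sub>v col S j) \<le> e" if j: "j < q i" for j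
    proof -
      let ?t = "1 / vnorm (sZ (Suc j))"
      have st: "s_step Q w (idx (Suc j)) i = Z i *\<^sub>v sZ (Suc j)" and ge: "K \<le> idx (Suc j)"
        using steps[of "Suc j"] j by auto
      have ZsZ: "Z i *\<^sub>v sZ (Suc j) \<in> carrier_vec (wdim Q i)" by (rule mult_mat_vec_carrier[OF Z csZ[OF j]])
      have "N * Z i *\<^sub>v col S j = ?t \<cdot>\<^sub>v (N *\<^sub>v (Z i *\<^sub>v sZ (Suc j)))"
        unfolding colS[OF j] mult_mat_vec[OF NZ csZ[OF j]] assoc_mult_mat_vec[OF N Z csZ[OF j]] ..
      then have "vnorm (N * Z i *\<^sub>v col S j) = ?t * vnorm (N *\<^sub>v s_step Q w (idx (Suc j)) i)"
        unfolding st by simp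
      also have "\<dots> \<le> ?t * (e' * vnorm (Z i *\<^sub>v sZ (Suc j)))"
        using K[OF ge] unfolding st by (intro mult_left_mono) auto
      also have "\<dots> \<le> ?t * (e' * (op_norm (Z i) * vnorm (sZ (Suc j))))"
        using vnorm_mult_mat_vec_le[OF Z csZ[OF j]] e' by (intro mult_left_mono) auto
      also have "\<dots> \<le> e' * op_norm (Z i)"
        using e' oz by (cases "vnorm (sZ (Suc j)) = 0") auto
      also have "\<dots> \<le> e' * (op_norm (Z i) + 1)" using e' by simp
      also have "\<dots> = e" unfolding e'_def using oz by simp
      finally show ?thesis .
    qed
    ultimately show "\<exists>S \<in> carrier_mat (q i) (q i). c4 ^ q i \<le> \<bar>Determinant.det S\<bar> \<and>
        (\<forall>a<q i. \<forall>b<q i. \<bar>S $$ (a, b)\<bar> \<le> 1) \<and> (\<forall>j<q i. vnorm (N * Z i *\<^sub>v col S j) \<le> e)"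
      using S by blast
  qed
qed


text \<open>Block row \<open>i\<close> of either matrix sees only stage \<open>i\<close> of
  \<open>v\<close>, and for \<open>v\<close> in the kernel that stage lies in the range of
  \<open>Z i\<close>, where late steps determine the limit.\<close>

lemma btr1_limit_exact_on_kernel:
  assumes wf: "well_formed Q" and lip: "lipschitz_jacobian Q c3"
    and sqp: "btr1_sqp_sequence Q w lam A" and c1: "0 < c1" and skip: "skipping_criteria Q w lam A c1"
    and ws: "w_star \<in> carrier_vec (dimW Q)" and wlim: "vec_tendsto w w_star"
    and basis: "null_space_basis Q Act q Z"
    and steps: "\<And>i. i < horizon Q \<Longrightarrow> unif_lin_indep_steps Q w q Z k0 i"
    and Al: "A_lim \<in> carrier_mat (dimL Q) (dimW Q)"
    and Alim: "mat_tendsto (\<lambda>k. assemble_jac Q (A k)) A_lim"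
    and v: "v \<in> mat_kernel (PA Q Act)"
  shows "(A_lim - DF Q w_star) *\<^sub>v v = 0\<^sub>v (dimL Q)"
proof -
  let ?n = "dimW Q" and ?m = "dimL Q"
  let ?M = "A_lim - DF Q w_star"
  have Z: "Z i \<in> carrier_mat (wdim Q i) (q i)" if "i < Suc (horizon Q)" for i
    using basis that unfolding null_space_basis_def by auto
  have Z_carrier: "diag_block_mat (map Z [0..<Suc (horizon Q)]) \<in> carrier_mat ?n (\<Sum>k<Suc (horizon Q). q k)"
    unfolding dimW_eq by (rule diag_block_mat_carrier) (rule Z)
  obtain z where z: "z \<in> carrier_vec (\<Sum>k<Suc (horizon Q). q k)"
    and vz: "v = diag_block_mat (map Z [0..<Suc (horizon Q)]) *\<^sub>v z"
    using basis v unfolding null_space_basis_def Let_def lessThan_Suc_atMost by blast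
  have cv: "v \<in> carrier_vec ?n" unfolding vz by (rule mult_mat_vec_carrier[OF Z_carrier z])
  have jac: "has_jacobian ?n ?m (Fmap Q) w_star (DF Q w_star)"
    by (rule DF_has_jacobian[OF lip ws])
  have D: "DF Q w_star \<in> carrier_mat ?m ?n" by (rule has_jacobian_carrier[OF jac])
  have M: "?M \<in> carrier_mat ?m ?n" by (rule minus_carrier_mat[OF D])
  have Ak: "A k j \<in> carrier_mat (xdim Q (Suc j)) (wdim Q j)" if "j < horizon Q" for k j
    by (rule btr1_block_carrier[OF sqp that])
  have X: "assemble_jac Q (A k) \<in> carrier_mat ?m ?n" for k by (rule assemble_jac_carrier[OF Ak])
  have "mult_stage Q i (?M *\<^sub>v v) = 0\<^sub>v (xdim Q (Suc i))" if i: "i < horizon Q" for i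
  proof -
    let ?SL = "mult_sel Q i" and ?T = "(stage_sel Q i)\<^sup>T" and ?xi = "xdim Q (Suc i)"
    let ?u = "stage Q i v"
    note SL = mult_sel_carrier[of Q i] and T = stage_sel_transpose_carrier[of Q i]
    have i': "i \<le> horizon Q" "i < Suc (horizon Q)" using i by auto
    have cu: "?u \<in> carrier_vec (wdim Q i)" by (rule stage_carrier)
    have Tu: "?T *\<^sub>v ?u \<in> carrier_vec ?n" by (rule mult_mat_vec_carrier[OF T cu])
    \<comment> \<open>\<open>d\<close> carries all stages of \<open>v\<close> except stage
      \<open>i\<close>; block row \<open>i\<close> must annihilate it.\<close>
    define d where "d = v - ?T *\<^sub>v ?u"
    have d: "d \<in> carrier_vec ?n" unfolding d_def using cv Tu by simp
    have sd: "stage Q i d = 0\<^sub>v (wdim Q i)"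
      unfolding d_def stage_diff[OF i'(1) cv Tu] stage_embed[OF i'(1) cu] by (rule minus_cancel_vec[OF cu])
    have zero: "B *\<^sub>v 0\<^sub>v c = 0\<^sub>v r" if "B \<in> carrier_mat r c" for B :: "real mat" and r c
      using that by auto
    have Dd: "DF Q w_star *\<^sub>v d \<in> carrier_vec ?m" by (rule mult_mat_vec_carrier[OF D d])
    have Ald: "A_lim *\<^sub>v d \<in> carrier_vec ?m" by (rule mult_mat_vec_carrier[OF Al d])
    have "?SL *\<^sub>v (DF Q w_star *\<^sub>v d) = 0\<^sub>v ?xi"
      using mult_stage_DF[OF wf jac ws i d] mult_stage_eq_sel[OF i Dd]
        zero[OF has_jacobian_carrier[OF stage_DF_has_jacobian[OF wf jac ws i]]] unfolding sd by simp
    \<comment> \<open>\<open>A_lim\<close> is given merely as a limit, so its block sparsity is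
      inherited from the assembled approximations by letting \<open>k\<close> tend to
      infinity.\<close>
    moreover have "?SL *\<^sub>v (A_lim *\<^sub>v d) = 0\<^sub>v ?xi"
    proof -
      let ?X = "\<lambda>k. assemble_jac Q (A k)"
      have SLA: "?SL *\<^sub>v (A_lim *\<^sub>v d) \<in> carrier_vec ?xi" by (rule mult_mat_vec_carrier[OF SL Ald])
      have "vnorm (?SL *\<^sub>v (A_lim *\<^sub>v d)) \<le> op_norm ?SL * (op_norm (?X k - A_lim) * vnorm d)" for k
      proof -
        have Xd: "?X k *\<^sub>v d \<in> carrier_vec ?m" by (rule mult_mat_vec_carrier[OF X d])
        have "?SL *\<^sub>v (?X k *\<^sub>v d) = 0\<^sub>v ?xi"
          using mult_stage_assemble_jac[of Q "A k", OF Ak i d] mult_stage_eq_sel[OF i Xd] zero[OF Ak[OF i]]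
          unfolding sd by simp
        then have "?SL *\<^sub>v ((?X k - A_lim) *\<^sub>v d) = 0\<^sub>v ?xi - ?SL *\<^sub>v (A_lim *\<^sub>v d)"
          unfolding minus_mult_distrib_mat_vec[OF X Al d] mult_minus_distrib_mat_vec[OF SL Xd Ald] by simp
        then have "vnorm (?SL *\<^sub>v ((?X k - A_lim) *\<^sub>v d)) = vnorm (?SL *\<^sub>v (A_lim *\<^sub>v d))"
          using vnorm_minus_commute[OF zero_carrier_vec SLA] SLA by (simp add: minus_zero_vec)
        then have "vnorm (?SL *\<^sub>v (A_lim *\<^sub>v d)) \<le> op_norm ?SL * vnorm ((?X k - A_lim) *\<^sub>v d)"
          using vnorm_mult_mat_vec_le[OF SL mult_mat_vec_carrier[OF minus_carrier_mat[OF Al] d], of "?X k"] by simp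
        also have "\<dots> \<le> op_norm ?SL * (op_norm (?X k - A_lim) * vnorm d)"
          by (rule mult_left_mono[OF vnorm_mult_mat_vec_le[OF minus_carrier_mat[OF Al] d] op_norm_nonneg[OF SL]])
        finally show ?thesis .
      qed
      moreover have "(\<lambda>k. op_norm ?SL * (op_norm (?X k - A_lim) * vnorm d)) \<longlonglongrightarrow> op_norm ?SL * (0 * vnorm d)"
        using Alim unfolding mat_tendsto_def by (intro tendsto_intros)
      ultimately have "vnorm (?SL *\<^sub>v (A_lim *\<^sub>v d)) \<le> op_norm ?SL * (0 * vnorm d)"
        by (intro LIMSEQ_le_const) auto
      then have "vnorm (?SL *\<^sub>v (A_lim *\<^sub>v d)) = 0"
        using vnorm_nonneg[of "?SL *\<^sub>v (A_lim *\<^sub>v d)"] by linarith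
      then show ?thesis using vnorm_eq_0_iff[OF SLA] by simp
    qed
    ultimately have Md: "?SL *\<^sub>v (?M *\<^sub>v d) = 0\<^sub>v ?xi"
      unfolding minus_mult_distrib_mat_vec[OF Al D d] mult_minus_distrib_mat_vec[OF SL Ald Dd] by simp
    define N where "N = ?SL * (?M * ?T)"
    have MT: "?M * ?T \<in> carrier_mat ?m (wdim Q i)" by (rule mult_carrier_mat[OF M T])
    have N: "N \<in> carrier_mat ?xi (wdim Q i)" unfolding N_def by (rule mult_carrier_mat[OF SL MT])
    have Nu: "N *\<^sub>v u = ?SL *\<^sub>v (?M *\<^sub>v (?T *\<^sub>v u))" if "u \<in> carrier_vec (wdim Q i)" for u
      unfolding N_def assoc_mult_mat_vec[OF SL MT that] assoc_mult_mat_vec[OF M T that] ..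
    have cs: "s_step Q w k i \<in> carrier_vec (wdim Q i)" for k
      unfolding s_step_def using stage_carrier by (metis minus_carrier_vec)
    have NZ: "N * Z i = 0\<^sub>m ?xi (q i)"
    proof (rule mat_vanishes_on_uniform_steps[OF N Z[OF i'(2)] steps[OF i]])
      show "\<exists>K. \<forall>k\<ge>K. vnorm (N *\<^sub>v s_step Q w k i) \<le> e * vnorm (s_step Q w k i)" if "0 < e" for e
        unfolding Nu[OF cs] by (rule btr1_block_error[OF wf lip sqp c1 skip ws wlim Al Alim i that])
    qed
    have zi: "slice q i z \<in> carrier_vec (q i)" by simp
    \<comment> \<open>The kernel is parametrized by the whole block diagonal matrix; slicing yields
      the coordinates of the single stage.\<close>
    have "?u = Z i *\<^sub>v slice q i z"
      unfolding vz stage_eq_slice using Z z i'(2) by (rule slice_diag_block_mat)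
    then have "N *\<^sub>v ?u = N * Z i *\<^sub>v slice q i z"
      using assoc_mult_mat_vec[OF N Z[OF i'(2)] zi] by simp
    also have "\<dots> = 0\<^sub>v ?xi"
      unfolding NZ using zi by auto
    finally have Nu0: "?SL *\<^sub>v (?M *\<^sub>v (?T *\<^sub>v ?u)) = 0\<^sub>v ?xi" unfolding Nu[OF cu] .
    have Mv: "?M *\<^sub>v v \<in> carrier_vec ?m" and MTu: "?M *\<^sub>v (?T *\<^sub>v ?u) \<in> carrier_vec ?m"
      by (rule mult_mat_vec_carrier[OF M cv], rule mult_mat_vec_carrier[OF M Tu])
    have SLMv: "?SL *\<^sub>v (?M *\<^sub>v v) \<in> carrier_vec ?xi" by (rule mult_mat_vec_carrier[OF SL Mv])
    have "?SL *\<^sub>v (?M *\<^sub>v d) = ?SL *\<^sub>v (?M *\<^sub>v v) - ?SL *\<^sub>v (?M *\<^sub>v (?T *\<^sub>v ?u))"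
      unfolding d_def mult_minus_distrib_mat_vec[OF M cv Tu] by (rule mult_minus_distrib_mat_vec[OF SL Mv MTu])
    then have "?SL *\<^sub>v (?M *\<^sub>v v) = 0\<^sub>v ?xi"
      using SLMv unfolding Md Nu0 by simp
    then show ?thesis
      using mult_stage_eq_sel[OF i Mv] by simp
  qed
  moreover have "mult_stage Q i (0\<^sub>v ?m) = 0\<^sub>v (xdim Q (Suc i))" if "i < horizon Q" for i
    using mult_stage_eq_sel[OF that zero_carrier_vec] mult_sel_carrier[of Q i] by auto
  ultimately show ?thesis
    by (intro mult_stage_eqI[OF _ mult_mat_vec_carrier[OF M cv] zero_carrier_vec]) simp
qed

theorem corollary3p9:
  fixes Q :: ocp
    and w lam :: "nat \<Rightarrow> real vec"
    and A :: "nat \<Rightarrow> nat \<Rightarrow> real mat"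
    and w_star lam_star mu_star :: "real vec"
    and A_lim :: "real mat"
    and Act :: "(nat \<times> nat) set"
    and q :: "nat \<Rightarrow> nat"
    and Z :: "nat \<Rightarrow> real mat"
    and c1 c3 :: real
    and k0 :: nat
  assumes "well_formed Q"
    and AS1: "twice_cont_differentiable (dimW Q + dimL Q)
                (\<lambda>z. lagrangian Q (vec_first z (dimW Q)) (vec_last z (dimL Q)))"
    and AS2: "lipschitz_jacobian Q c3"
    and AS3: "btr1_sqp_sequence Q w lam A"
             "0 < c1" "c1 < 1" "skipping_criteria Q w lam A c1"
    and AS4: "vec_tendsto w w_star" "vec_tendsto lam lam_star"
    and AS5: "\<And>k. k \<ge> k0 \<Longrightarrow> active_set Q (w k) = Act"
    and null_space: "null_space_basis Q Act q Z"
    and AS6: "\<And>i. i < horizon Q \<Longrightarrow> unif_lin_indep_steps Q w q Z k0 i"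
    and regular: "regular_kkt_point Q Act w_star lam_star mu_star"
    and limit: "A_lim \<in> carrier_mat (dimL Q) (dimW Q)"
               "mat_tendsto (\<lambda>k. assemble_jac Q (A k)) A_lim"
    and invertible: "invertible_mat (J_IN Q Act w_star A_lim)"
  shows "contraction_rate (J_IN Q Act w_star A_lim) (J_exact Q Act w_star lam_star)
       = contraction_rate (J_GN Q Act w_star) (J_exact Q Act w_star lam_star)"
proof -
  \<comment> \<open>\<open>vec_tendsto\<close> alone does not fix the dimension of a limit; it comes
    from the KKT point.\<close>
  have ws: "w_star \<in> carrier_vec (dimW Q)" and ls: "lam_star \<in> carrier_vec (dimL Q)"
    using regular unfolding regular_kkt_point_def eq_feasible_def by auto
  have D: "DF Q w_star \<in> carrier_mat (dimL Q) (dimW Q)"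
    by (rule has_jacobian_carrier[OF DF_has_jacobian[OF AS2 ws]])
  show ?thesis
    unfolding J_IN_def J_GN_def J_exact_def
  proof (rule contraction_rate_kkt_matrix)
    show "gn_hess Q w_star \<in> carrier_mat (dimW Q) (dimW Q)"
      by (rule gn_hess_carrier[OF assms(1)])
    show "hessian (dimW Q) (\<lambda>w. lagrangian Q w lam_star) w_star \<in> carrier_mat (dimW Q) (dimW Q)"
      by (rule hessian_first_carrier[OF AS1 ws ls])
    show "invertible_mat (kkt_matrix Q Act (gn_hess Q w_star) A_lim)"
      using invertible unfolding J_IN_def .
    show "(A_lim - DF Q w_star) *\<^sub>v v = 0\<^sub>v (dimL Q)" if "v \<in> mat_kernel (PA Q Act)" for v
      by (rule btr1_limit_exact_on_kernel[OF assms(1) AS2 AS3(1,2,4) ws AS4(1) null_space AS6 limit that])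
  qed (fact D limit(1))+
qed

end
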